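(* Let $\mathcal{P}$ be a partial order $\preceq$ on $\{1,\dots,N\}$ and let $\mathbf{k}$ be a field whose characteristic is either $0$ or greater than $N$. Let $\mathfrak{g}(\mathcal{P})$ be the Lie poset algebra of $\mathcal{P}$ over $\mathbf{k}$, $\mathfrak{h}$ its subalgebra of diagonal elements, $\Sigma$ the nerve of $\mathcal{P}$, and $\Sigma^+$ the augmentation of $\Sigma$. Then, as graded vector spaces, $$H^*(\mathfrak{g}(\mathcal{P}),\mathfrak{g}(\mathcal{P}))\;\cong\;\bigwedge\mathfrak{h}^{\vee}\otimes H^*(\Sigma^+,\mathbf{k})\;=\;H^*(\mathfrak{h},\mathbf{k})\otimes H^*(\Sigma^+,\mathbf{k}).$$
   Context: The associative poset algebra $A(\mathcal{P},\mathbf{k})$ is the $\mathbf{k}$-span of elements $e_{ij}$, $i\preceq j$, with $e_{ij}e_{j'k}=e_{ik}$ if $j=j'$ and $0$ otherwise. The Lie poset algebra $\mathfrak{g}(\mathcal{P})$ is the Lie algebra (under commutator) of all elements $\sum c_{ij}e_{ij}$ of $A(\mathcal{P},\mathbf{k})$ of trace $\sum c_{ii}=0$. $\mathfrak{h}$ is the Abelian subalgebra of elements $\sum_i c_{ii}e_{ii}$ of trace zero, and $\mathfrak{h}^\vee$ is its dual space. $H^*(\mathfrak{g},\mathfrak{g})$ is Chevalley–Eilenberg cohomology with coefficients in the adjoint module; $H^*(\mathfrak{h},\mathbf{k})$ has trivial coefficients. The nerve $\Sigma$ is the simplicial complex whose $n$-simplices are the chains $i_0\prec i_1\prec\dots\prec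 i_n$ of $\mathcal{P}$. $\Sigma^+$ is obtained from $\Sigma$ by adjoining a single simplex of dimension $-1$ serving as the boundary of every $0$-simplex, so $H^*(\Sigma^+,\mathbf{k})$ is the reduced simplicial cohomology of $\Sigma$ with coefficients in $\mathbf{k}$. *)

theory Defs
  imports Complex_Main "HOL-Library.Function_Algebras" "HOL-Algebra.AbelCoset" "HOL-Algebra.Module"
begin

section \<open>Vector spaces\<close>

text \<open>The base field is a type \<open>'k :: field\<close>. Abstract vector spaces (quotients, tensor products,
  exterior powers, direct sums) are module records; concrete ones are subspaces of an ambient type
  of class \<open>ab_group_add\<close> with an explicit scalar multiplication.\<close>

definition fscale :: "'k::field \<Rightarrow> ('x \<Rightarrow> 'k) \<Rightarrow> 'x \<Rightarrow> 'k"
  where "fscale a f = (\<lambda>x. a * f x)"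

interpretation fun_vs: vector_space "fscale :: 'k::field \<Rightarrow> ('x \<Rightarrow> 'k) \<Rightarrow> 'x \<Rightarrow> 'k"
  by unfold_locales (auto simp: fscale_def fun_eq_iff algebra_simps)

text \<open>The ring structure fields \<open>mult\<close> and \<open>one\<close> of the records are irrelevant for modules.\<close>

definition subspace_module :: "('k::field \<Rightarrow> 'v::ab_group_add \<Rightarrow> 'v) \<Rightarrow> 'v set \<Rightarrow> ('k, 'v) module"
  where "subspace_module sc U =
    \<lparr>carrier = U, mult = undefined, one = undefined, zero = 0, add = (+), smult = sc\<rparr>"

text \<open>In a quotient, \<open>a \<odot> X\<close> is the coset \<open>a X + U\<close>; adding \<open>U\<close> matters only for \<open>a = 0\<close>.\<close>

definition quotient_module :: "('k, 'v) module \<Rightarrow> 'v set \<Rightarrow> ('k, 'v set) module"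
  where "quotient_module V U =
    \<lparr>carrier = a_rcosets\<^bsub>V\<^esub> U, mult = undefined, one = undefined, zero = U, add = set_add V,
     smult = (\<lambda>a X. set_add V (smult V a ` X) U)\<rparr>"

definition module_iso :: "('k, 'v) module \<Rightarrow> ('k, 'w) module \<Rightarrow> bool"
  where "module_iso V W \<longleftrightarrow> (\<exists>f. bij_betw f (carrier V) (carrier W) \<and>
    (\<forall>x\<in>carrier V. \<forall>y\<in>carrier V. f (x \<oplus>\<^bsub>V\<^esub> y) = f x \<oplus>\<^bsub>W\<^esub> f y) \<and>
    (\<forall>a. \<forall>x\<in>carrier V. f (a \<odot>\<^bsub>V\<^esub> x) = a \<odot>\<^bsub>W\<^esub> f x))"

text \<open>The vector space with basis \<open>S\<close>: finitely supported functions on \<open>S\<close>.\<close>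

definition free_space :: "'x set \<Rightarrow> ('x \<Rightarrow> 'k::field) set"
  where "free_space S = {f. finite {x. f x \<noteq> 0} \<and> {x. f x \<noteq> 0} \<subseteq> S}"

definition basis_vec :: "'x \<Rightarrow> 'x \<Rightarrow> 'k::field"
  where "basis_vec x = (\<lambda>y. if y = x then 1 else 0)"

definition presented_space :: "'x set \<Rightarrow> ('x \<Rightarrow> 'k::field) set \<Rightarrow> ('k, ('x \<Rightarrow> 'k) set) module"
  where "presented_space S rels =
    quotient_module (subspace_module fscale (free_space S)) (fun_vs.span rels)"

definition tensor_rels :: "('k::field, 'a) module \<Rightarrow> ('k, 'b) module \<Rightarrow> ('a \<times> 'b \<Rightarrow> 'k) set"
  where "tensor_rels V W =
    {basis_vec (v \<oplus>\<^bsub>V\<^esub> v', w) - basis_vec (v, w) - basis_vec (v', w) |v v' w.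
       v \<in> carrier V \<and> v' \<in> carrier V \<and> w \<in> carrier W} \<union>
    {basis_vec (v, w \<oplus>\<^bsub>W\<^esub> w') - basis_vec (v, w) - basis_vec (v, w') |v w w'.
       v \<in> carrier V \<and> w \<in> carrier W \<and> w' \<in> carrier W} \<union>
    {basis_vec (a \<odot>\<^bsub>V\<^esub> v, w) - fscale a (basis_vec (v, w)) |a v w.
       v \<in> carrier V \<and> w \<in> carrier W} \<union>
    {basis_vec (v, a \<odot>\<^bsub>W\<^esub> w) - fscale a (basis_vec (v, w)) |a v w.
       v \<in> carrier V \<and> w \<in> carrier W}"

definition tensor :: "('k::field, 'a) module \<Rightarrow> ('k, 'b) module \<Rightarrow> ('k, ('a \<times> 'b \<Rightarrow> 'k) set) module"
  where "tensor V W = presented_space (carrier V \<times> carrier W) (tensor_rels V W)"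


section \<open>Graded vector spaces\<close>

text \<open>A graded vector space is a family of vector spaces indexed by the integers.\<close>

definition direct_sum :: "(int \<Rightarrow> ('k, 'v) module) \<Rightarrow> ('k, int \<Rightarrow> 'v) module"
  where "direct_sum V =
    \<lparr>carrier = {f. (\<forall>p. f p \<in> carrier (V p)) \<and> finite {p. f p \<noteq> \<zero>\<^bsub>V p\<^esub>}},
     mult = undefined, one = undefined, zero = (\<lambda>p. \<zero>\<^bsub>V p\<^esub>),
     add = (\<lambda>f g p. f p \<oplus>\<^bsub>V p\<^esub> g p), smult = (\<lambda>a f p. a \<odot>\<^bsub>V p\<^esub> f p)\<rparr>"

definition graded_tensor ::
  "(int \<Rightarrow> ('k::field, 'a) module) \<Rightarrow> (int \<Rightarrow> ('k, 'b) module) \<Rightarrow>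
   int \<Rightarrow> ('k, int \<Rightarrow> ('a \<times> 'b \<Rightarrow> 'k) set) module"
  where "graded_tensor V W n = direct_sum (\<lambda>p. tensor (V p) (W (n - p)))"

definition graded_iso :: "(int \<Rightarrow> ('k, 'v) module) \<Rightarrow> (int \<Rightarrow> ('k, 'w) module) \<Rightarrow> bool"
  where "graded_iso V W \<longleftrightarrow> (\<forall>n. module_iso (V n) (W n))"

definition tuples :: "'v set \<Rightarrow> int \<Rightarrow> 'v list set"
  where "tuples A n = {xs. int (length xs) = n \<and> set xs \<subseteq> A}"

text \<open>The \<open>n\<close>-th exterior power, presented by the symbols \<open>v\<^sub>1 \<and> \<dots> \<and> v\<^sub>n\<close> subject to
  multilinearity and vanishing on tuples with a repeated entry; it is zero for \<open>n < 0\<close>.\<close>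

definition exterior_rels :: "('k::field, 'v) module \<Rightarrow> int \<Rightarrow> ('v list \<Rightarrow> 'k) set"
  where "exterior_rels V n =
    {basis_vec (xs[i := v \<oplus>\<^bsub>V\<^esub> w]) - basis_vec (xs[i := v]) - basis_vec (xs[i := w]) |xs i v w.
       xs \<in> tuples (carrier V) n \<and> i < length xs \<and> v \<in> carrier V \<and> w \<in> carrier V} \<union>
    {basis_vec (xs[i := a \<odot>\<^bsub>V\<^esub> v]) - fscale a (basis_vec (xs[i := v])) |xs i a v.
       xs \<in> tuples (carrier V) n \<and> i < length xs \<and> v \<in> carrier V} \<union>
    {basis_vec xs |xs. xs \<in> tuples (carrier V) n \<and> \<not> distinct xs}"

definition exterior :: "('k::field, 'v) module \<Rightarrow> int \<Rightarrow> ('k, ('v list \<Rightarrow> 'k) set) module"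
  where "exterior V n = presented_space (tuples (carrier V) n) (exterior_rels V n)"

text \<open>Linear functionals on a subspace \<open>U\<close>, extended by zero outside \<open>U\<close>.\<close>

definition dual_space :: "('k::field \<Rightarrow> 'v::ab_group_add \<Rightarrow> 'v) \<Rightarrow> 'v set \<Rightarrow> ('k, 'v \<Rightarrow> 'k) module"
  where "dual_space sc U = subspace_module fscale
    {f. (\<forall>x\<in>U. \<forall>y\<in>U. f (x + y) = f x + f y) \<and> (\<forall>a. \<forall>x\<in>U. f (sc a x) = a * f x) \<and>
        (\<forall>x. x \<notin> U \<longrightarrow> f x = 0)}"


section \<open>Chevalley--Eilenberg cohomology\<close>

text \<open>\<open>L\<close> is a Lie algebra with bracket \<open>br\<close> and scalar multiplication \<open>sL\<close>, and \<open>M\<close> an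
  \<open>L\<close>-module with action \<open>act\<close> and scalar multiplication \<open>sM\<close>. An \<open>n\<close>-cochain is an alternating
  \<open>n\<close>-linear map \<open>L\<^sup>n \<rightarrow> M\<close>, taken to be zero off \<open>L\<^sup>n\<close>. For \<open>n < 0\<close> only the zero map remains.\<close>

definition ce_cochains ::
  "('k::field \<Rightarrow> 'v::ab_group_add \<Rightarrow> 'v) \<Rightarrow> 'v set \<Rightarrow>
   ('k \<Rightarrow> 'w::ab_group_add \<Rightarrow> 'w) \<Rightarrow> 'w set \<Rightarrow> int \<Rightarrow> ('v list \<Rightarrow> 'w) set"
  where "ce_cochains sL L sM M n =
    {\<omega>. (\<forall>xs\<in>tuples L n. \<omega> xs \<in> M) \<and>
        (\<forall>xs. xs \<notin> tuples L n \<longrightarrow> \<omega> xs = 0) \<and>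
        (\<forall>xs\<in>tuples L n. \<forall>i<length xs. \<forall>x\<in>L. \<forall>y\<in>L.
           \<omega> (xs[i := x + y]) = \<omega> (xs[i := x]) + \<omega> (xs[i := y])) \<and>
        (\<forall>xs\<in>tuples L n. \<forall>i<length xs. \<forall>a. \<forall>x\<in>L. \<omega> (xs[i := sL a x]) = sM a (\<omega> (xs[i := x]))) \<and>
        (\<forall>xs\<in>tuples L n. \<not> distinct xs \<longrightarrow> \<omega> xs = 0)}"

text \<open>\<open>nths xs (- I)\<close> is the list \<open>xs\<close> with the entries at the positions in \<open>I\<close> omitted.\<close>

definition ce_diff ::
  "'v set \<Rightarrow> ('v \<Rightarrow> 'v \<Rightarrow> 'v) \<Rightarrow> ('k::field \<Rightarrow> 'w::ab_group_add \<Rightarrow> 'w) \<Rightarrow> ('v \<Rightarrow> 'w \<Rightarrow> 'w) \<Rightarrow>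
   int \<Rightarrow> ('v list \<Rightarrow> 'w) \<Rightarrow> 'v list \<Rightarrow> 'w"
  where "ce_diff L br sM act n \<omega> xs =
    (if xs \<in> tuples L (n + 1) then
       (\<Sum>i<length xs. sM ((-1) ^ i) (act (xs ! i) (\<omega> (nths xs (- {i}))))) +
       (\<Sum>j<length xs. \<Sum>i<j. sM ((-1) ^ (i + j)) (\<omega> (br (xs ! i) (xs ! j) # nths xs (- {i, j}))))
     else 0)"

definition ce_cohomology ::
  "('k::field \<Rightarrow> 'v::ab_group_add \<Rightarrow> 'v) \<Rightarrow> 'v set \<Rightarrow> ('v \<Rightarrow> 'v \<Rightarrow> 'v) \<Rightarrow>
   ('k \<Rightarrow> 'w::ab_group_add \<Rightarrow> 'w) \<Rightarrow> 'w set \<Rightarrow> ('v \<Rightarrow> 'w \<Rightarrow> 'w) \<Rightarrow>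
   int \<Rightarrow> ('k, ('v list \<Rightarrow> 'w) set) module"
  where "ce_cohomology sL L br sM M act n = quotient_module
    (subspace_module (\<lambda>a \<omega> xs. sM a (\<omega> xs)) {\<omega> \<in> ce_cochains sL L sM M n. ce_diff L br sM act n \<omega> = 0})
    (ce_diff L br sM act (n - 1) ` ce_cochains sL L sM M (n - 1))"

definition adjoint_cohomology ::
  "('k::field \<Rightarrow> 'v::ab_group_add \<Rightarrow> 'v) \<Rightarrow> 'v set \<Rightarrow> ('v \<Rightarrow> 'v \<Rightarrow> 'v) \<Rightarrow>
   int \<Rightarrow> ('k, ('v list \<Rightarrow> 'v) set) module"
  where "adjoint_cohomology sL L br = ce_cohomology sL L br sL L br"

definition trivial_cohomology ::
  "('k::field \<Rightarrow> 'v::ab_group_add \<Rightarrow> 'v) \<Rightarrow> 'v set \<Rightarrow> ('v \<Rightarrow> 'v \<Rightarrow> 'v) \<Rightarrow>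
   int \<Rightarrow> ('k, ('v list \<Rightarrow> 'k) set) module"
  where "trivial_cohomology sL L br = ce_cohomology sL L br (*) UNIV (\<lambda>_ _. 0)"


section \<open>Poset algebras\<close>

text \<open>The element \<open>\<Sum> c\<^sub>i\<^sub>j e\<^sub>i\<^sub>j\<close> is represented by its coefficient family \<open>c\<close> on pairs, which
  vanishes off the relation \<open>r\<close>. Its product is \<open>poset_mult\<close>, not the pointwise \<open>(*)\<close> that
  functions inherit from \<^theory>\<open>HOL-Library.Function_Algebras\<close>.\<close>

definition poset_algebra :: "(nat \<times> nat) set \<Rightarrow> (nat \<times> nat \<Rightarrow> 'k::field) set"
  where "poset_algebra r = {c. \<forall>p. p \<notin> r \<longrightarrow> c p = 0}"

definition poset_mult ::
  "nat \<Rightarrow> (nat \<times> nat \<Rightarrow> 'k::field) \<Rightarrow> (nat \<times> nat \<Rightarrow> 'k) \<Rightarrow> nat \<times> nat \<Rightarrow> 'k"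
  where "poset_mult N c d = (\<lambda>(i, k). \<Sum>j\<in>{1..N}. c (i, j) * d (j, k))"

definition commutator ::
  "nat \<Rightarrow> (nat \<times> nat \<Rightarrow> 'k::field) \<Rightarrow> (nat \<times> nat \<Rightarrow> 'k) \<Rightarrow> nat \<times> nat \<Rightarrow> 'k"
  where "commutator N c d = poset_mult N c d - poset_mult N d c"

definition lie_poset_algebra :: "nat \<Rightarrow> (nat \<times> nat) set \<Rightarrow> (nat \<times> nat \<Rightarrow> 'k::field) set"
  where "lie_poset_algebra N r = {c \<in> poset_algebra r. (\<Sum>i\<in>{1..N}. c (i, i)) = 0}"

definition diagonal_subalgebra :: "nat \<Rightarrow> (nat \<times> nat) set \<Rightarrow> (nat \<times> nat \<Rightarrow> 'k::field) set"
  where "diagonal_subalgebra N r = {c \<in> lie_poset_algebra N r. \<forall>i j. i \<noteq> j \<longrightarrow> c (i, j) = 0}"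


section \<open>Simplicial cohomology of the nerve\<close>

text \<open>A simplicial complex with ordered simplices is a set of vertex lists closed under omitting
  entries; a list of length \<open>n + 1\<close> is an \<open>n\<close>-simplex, so \<open>[]\<close>, if present, has dimension \<open>-1\<close>.\<close>

definition simplices :: "'a list set \<Rightarrow> int \<Rightarrow> 'a list set"
  where "simplices K n = {xs \<in> K. int (length xs) = n + 1}"

definition simplicial_cochains :: "'a list set \<Rightarrow> int \<Rightarrow> ('a list \<Rightarrow> 'k::field) set"
  where "simplicial_cochains K n = {c. \<forall>xs. xs \<notin> simplices K n \<longrightarrow> c xs = 0}"

definition coboundary :: "'a list set \<Rightarrow> int \<Rightarrow> ('a list \<Rightarrow> 'k::field) \<Rightarrow> 'a list \<Rightarrow> 'k"
  where "coboundary K n c xs =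
    (if xs \<in> simplices K (n + 1) then \<Sum>i<length xs. (-1) ^ i * c (nths xs (- {i})) else 0)"

definition simplicial_cohomology :: "'a list set \<Rightarrow> int \<Rightarrow> ('k::field, ('a list \<Rightarrow> 'k) set) module"
  where "simplicial_cohomology K n = quotient_module
    (subspace_module fscale {c \<in> simplicial_cochains K n. coboundary K n c = 0})
    (coboundary K (n - 1) ` simplicial_cochains K (n - 1))"

text \<open>\<open>sorted_wrt\<close> compares all pairs of entries, which for a partial order \<open>r\<close> amounts to
  \<open>i\<^sub>0 \<prec> i\<^sub>1 \<prec> \<dots> \<prec> i\<^sub>n\<close>.\<close>

definition nerve :: "nat \<Rightarrow> (nat \<times> nat) set \<Rightarrow> nat list set"
  where "nerve N r =
    {xs. xs \<noteq> [] \<and> set xs \<subseteq> {1..N} \<and> sorted_wrt (\<lambda>i j. (i, j) \<in> r \<and> i \<noteq> j) xs}"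

definition augment :: "'a list set \<Rightarrow> 'a list set"
  where "augment K = insert [] K"

end

theory Submission
  imports Defs
begin

text \<open>Two graded vector spaces with finite-dimensional pieces are isomorphic once their dimensions agree
  degree by degree, so it suffices to compute dimensions. On \<open>\<gg>\<close>-valued forms on \<open>\<gg>\<close> the elements of
  \<open>\<hh>\<close> act diagonalisably by Lie derivatives, which are homotopic to zero by Cartan's formula; hence the
  \<open>\<hh>\<close>-invariant forms compute \<open>H\<^sup>*(\<gg>, \<gg>)\<close>. As \<open>\<hh>\<close> is Abelian and the coordinates on \<open>\<hh>\<close> extend to closed
  1-forms on \<open>\<gg>\<close>, one may split off the elements of a basis of \<open>\<hh>\<close> one at a time, each contributing
  a factor \<open>1 + t\<close> to the Poincare series; what remains is the complex of invariant forms killed by contraction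
  with \<open>\<hh>\<close>. By weights, such a form of degree \<open>n \<ge> 1\<close> is supported on the sets of edges of chains
  \<open>i\<^sub>0 \<prec> \<dots> \<prec> i\<^sub>n\<close> and takes values there in the multiples of \<open>e\<close> with indices \<open>i\<^sub>0, i\<^sub>n\<close>: the
  integer weights can be compared in \<open>k\<close> since the characteristic is \<open>0\<close> or exceeds \<open>N\<close>. This
  complex is thus the simplicial cochain complex of the nerve.\<close>

section \<open>Dimensions of quotient spaces\<close>

text \<open>The isomorphisms to be produced relate quotient records over unrelated types. Counting
  dimensions avoids building maps between them: the numbers dim H^n(\<Sigma>^+) need not be known,
  it suffices that they exist and enter both sides through the same convolution with the binomial
  coefficients of N - 1, the dimension of \<hh>. Alternating maps are treated through contraction
  with a first argument. Exterior multiplication by a 1-form, Lie derivative and differential are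
  defined by their commutation rules with contraction, so that Cartan's formula holds by definition
  and the identities of the calculus follow by induction on the degree or on the list of arguments.
  The classical alternating sum is recovered once, to match the given differential. The bound on the
  characteristic has two sources. At most N - 1 edges meet a given vertex and the value of the form
  adds one more unit of weight, so the integers to be compared differ by at most N. Moreover N must
  be invertible to make diagonal matrix units traceless and to take means over the vertices; the
  latter settles degree 0, where a function on the vertices comes from a form only up to a
  constant.\<close>

definition coord_space :: "nat \<Rightarrow> (nat \<Rightarrow> 'k::field) set"
  where "coord_space m = {f. \<forall>i\<ge>m. f i = 0}"

text \<open>\<open>V\<close> is a bare record without axioms, so this isomorphism with the model
  space is also the source of the vector space laws used for it.\<close>

definition has_dim :: "('k::field, 'v) module \<Rightarrow> nat \<Rightarrow> bool"
  where "has_dim V m \<longleftrightarrow> module_iso (subspace_module fscale (coord_space m)) V"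

lemma has_dimE:
  assumes "has_dim V m"
  obtains f where "bij_betw f (coord_space m) (carrier V)"
    and "\<And>x y. x \<in> coord_space m \<Longrightarrow> y \<in> coord_space m \<Longrightarrow> f (x + y) = f x \<oplus>\<^bsub>V\<^esub> f y"
    and "\<And>a x. x \<in> coord_space m \<Longrightarrow> f (fscale a x) = a \<odot>\<^bsub>V\<^esub> f x"
  using assms unfolding has_dim_def module_iso_def subspace_module_def by auto

lemma has_dimI:
  assumes "bij_betw f (coord_space m) (carrier V)"
    and "\<And>x y. x \<in> coord_space m \<Longrightarrow> y \<in> coord_space m \<Longrightarrow> f (x + y) = f x \<oplus>\<^bsub>V\<^esub> f y"
    and "\<And>a x. x \<in> coord_space m \<Longrightarrow> f (fscale a x) = a \<odot>\<^bsub>V\<^esub> f x"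
  shows "has_dim V m"
  using assms unfolding has_dim_def module_iso_def subspace_module_def by auto

lemma coord_space_add: "x \<in> coord_space m \<Longrightarrow> y \<in> coord_space m \<Longrightarrow> x + y \<in> coord_space m"
  and coord_space_scale: "x \<in> coord_space m \<Longrightarrow> fscale a x \<in> coord_space m"
  by (auto simp: coord_space_def fscale_def)

lemma has_dim_imp_module_iso:
  assumes "has_dim V m" and "has_dim W m"
  shows "module_iso V W"
proof -
  obtain f where f: "bij_betw f (coord_space m) (carrier V)"
    and f_add: "\<And>x y. x \<in> coord_space m \<Longrightarrow> y \<in> coord_space m \<Longrightarrow> f (x + y) = f x \<oplus>\<^bsub>V\<^esub> f y"
    and f_smult: "\<And>a x. x \<in> coord_space m \<Longrightarrow> f (fscale a x) = a \<odot>\<^bsub>V\<^esub> f x"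
    using has_dimE[OF assms(1)] by blast
  obtain g where g: "bij_betw g (coord_space m) (carrier W)"
    and g_add: "\<And>x y. x \<in> coord_space m \<Longrightarrow> y \<in> coord_space m \<Longrightarrow> g (x + y) = g x \<oplus>\<^bsub>W\<^esub> g y"
    and g_smult: "\<And>a x. x \<in> coord_space m \<Longrightarrow> g (fscale a x) = a \<odot>\<^bsub>W\<^esub> g x"
    using has_dimE[OF assms(2)] by blast
  let ?h = "inv_into (coord_space m) f"
  have h: "bij_betw ?h (carrier V) (coord_space m)"
    using f by (rule bij_betw_inv_into)
  have hf: "?h (f x) = x" if "x \<in> coord_space m" for x
    using f that by (simp add: bij_betw_def)
  have img: "\<exists>x\<in>coord_space m. v = f x" if "v \<in> carrier V" for v
    using f that by (auto simp: bij_betw_def)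
  have "bij_betw (g \<circ> ?h) (carrier V) (carrier W)"
    using h g by (rule bij_betw_trans)
  moreover have "(g \<circ> ?h) (x \<oplus>\<^bsub>V\<^esub> y) = (g \<circ> ?h) x \<oplus>\<^bsub>W\<^esub> (g \<circ> ?h) y"
    if xy: "x \<in> carrier V" "y \<in> carrier V" for x y
  proof -
    obtain u v where uv: "u \<in> coord_space m" "v \<in> coord_space m" "x = f u" "y = f v"
      using img xy by blast
    then have "x \<oplus>\<^bsub>V\<^esub> y = f (u + v)" by (simp add: f_add)
    then show ?thesis using uv by (simp add: hf coord_space_add g_add)
  qed
  moreover have "(g \<circ> ?h) (a \<odot>\<^bsub>V\<^esub> x) = a \<odot>\<^bsub>W\<^esub> (g \<circ> ?h) x" if x: "x \<in> carrier V" for a x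
  proof -
    obtain u where u: "u \<in> coord_space m" "x = f u"
      using img x by blast
    then have "a \<odot>\<^bsub>V\<^esub> x = f (fscale a u)" by (simp add: f_smult)
    then show ?thesis using u by (simp add: hf coord_space_scale g_smult)
  qed
  ultimately show ?thesis unfolding module_iso_def by blast
qed

section \<open>Quotients of subspaces by means of representatives\<close>

lemma carrier_quotient: "carrier (quotient_module (subspace_module sc Z) B) = (\<lambda>z. (\<lambda>b. b + z) ` B) ` Z"
  unfolding quotient_module_def  A_RCOSETS_def RCOSETS_def r_coset_def subspace_module_def by (simp add: UNION_singleton_eq_range)
lemma add_quotient: "X \<oplus>\<^bsub>quotient_module (subspace_module sc Z) B\<^esub> Y = {u + v |u v. u \<in> X \<and> v \<in> Y}"
  unfolding quotient_module_def set_add_def set_mult_def subspace_module_def by auto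
lemma smult_quotient: "a \<odot>\<^bsub>quotient_module (subspace_module sc Z) B\<^esub> X = {sc a u + v |u v. u \<in> X \<and> v \<in> B}"
  unfolding quotient_module_def set_add_def set_mult_def subspace_module_def by auto

locale scaled_space = vector_space scale
  for scale :: "'k::field \<Rightarrow> 'v::ab_group_add \<Rightarrow> 'v"
begin

text \<open>States dim Z/B = m through m representatives in \<open>Z\<close> that form a basis
  modulo \<open>B\<close>. Complexes are compared in this form, and cosets appear only when
  \<open>has_dim_quotient\<close> returns to the quotient record.\<close>

definition quotient_dim :: "'v set \<Rightarrow> 'v set \<Rightarrow> nat \<Rightarrow> bool"
  where "quotient_dim Z B m \<longleftrightarrow> (\<exists>c. (\<forall>i<m. c i \<in> Z) \<and>
    (\<forall>z\<in>Z. \<exists>a. z - (\<Sum>i<m. scale (a i) (c i)) \<in> B) \<and>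
    (\<forall>a. (\<Sum>i<m. scale (a i) (c i)) \<in> B \<longrightarrow> (\<forall>i<m. a i = 0)))"

lemma quotient_dimE:
  assumes "quotient_dim Z B m"
  obtains c :: "nat \<Rightarrow> 'v" where "\<And>i. i < m \<Longrightarrow> c i \<in> Z"
    and "\<And>z. z \<in> Z \<Longrightarrow> \<exists>a. z - (\<Sum>i<m. scale (a i) (c i)) \<in> B"
    and "\<And>a i. (\<Sum>i<m. scale (a i) (c i)) \<in> B \<Longrightarrow> i < m \<Longrightarrow> a i = 0"
  using assms unfolding quotient_dim_def by blast

lemma quotient_dimI:
  assumes "finite J" and "\<And>j. j \<in> J \<Longrightarrow> c j \<in> Z"
    and ex: "\<And>z. z \<in> Z \<Longrightarrow> \<exists>a. z - (\<Sum>j\<in>J. scale (a j) (c j)) \<in> B"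
    and un: "\<And>a j. (\<Sum>j\<in>J. scale (a j) (c j)) \<in> B \<Longrightarrow> j \<in> J \<Longrightarrow> a j = 0"
  shows "quotient_dim Z B (card J)"
proof -
  obtain h where h: "bij_betw h {..<card J} J"
    using ex_bij_betw_nat_finite[OF assms(1)] by (auto simp: atLeast0LessThan)
  have sum_h: "(\<Sum>i<card J. scale (a (h i)) (c (h i))) = (\<Sum>j\<in>J. scale (a j) (c j))" for a
    using sum.reindex_bij_betw[OF h, of "\<lambda>j. scale (a j) (c j)"] by simp
  let ?g = "inv_into {..<card J} h"
  have g: "?g (h i) = i" if "i < card J" for i
    using h that by (simp add: bij_betw_def)
  have img: "h i \<in> J" if "i < card J" for i
    using h that by (auto simp: bij_betw_def)
  have "a i = 0" if s: "(\<Sum>i<card J. scale (a i) (c (h i))) \<in> B" and i: "i < card J" for a i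
  proof -
    have "(\<Sum>i<card J. scale (a i) (c (h i))) = (\<Sum>j\<in>J. scale (a (?g j)) (c j))"
      unfolding sum_h[symmetric] by (rule sum.cong) (auto simp: g)
    then have "a (?g (h i)) = 0"
      using un[of "\<lambda>j. a (?g j)" "h i"] s img[OF i] by simp
    then show ?thesis using i by (simp add: g)
  qed
  moreover have "\<exists>a. z - (\<Sum>i<card J. scale (a i) (c (h i))) \<in> B" if "z \<in> Z" for z
  proof -
    obtain a where "z - (\<Sum>j\<in>J. scale (a j) (c j)) \<in> B" using ex \<open>z \<in> Z\<close> by blast
    then show ?thesis by (intro exI[of _ "\<lambda>i. a (h i)"]) (simp only: sum_h)
  qed
  moreover have "c (h i) \<in> Z" if "i < card J" for i
    using assms(2) img that by simp
  ultimately show ?thesis unfolding quotient_dim_def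
    by (intro exI[of _ "\<lambda>i. c (h i)"] conjI allI impI ballI)
qed

text \<open>A basis \<open>A\<close> of \<open>B\<close> extends to a basis of \<open>Z\<close>, and
  the added vectors represent a basis of the quotient; \<open>F\<close> bounds the size of
  independent sets.\<close>

lemma quotient_dim_exists:
  assumes "subspace Z" and "subspace B" and "B \<subseteq> Z" and "finite F" and "Z \<subseteq> span F"
  shows "\<exists>m. quotient_dim Z B m"
proof -
  obtain A where A: "A \<subseteq> B" "independent A" "B \<subseteq> span A"
    by (rule basis_exists[of B])
  obtain A' where A': "A \<subseteq> A'" "A' \<subseteq> Z" "independent A'" "Z \<subseteq> span A'"
    using maximal_independent_subset_extend[of A Z] A assms(3) by blast
  have fin: "finite A'"
    using independent_span_bound[OF assms(4) A'(3)] A'(2) assms(5) by (meson subset_trans)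
  define C where "C = A' - A"
  have finC: "finite C" "finite A"
    using fin finite_subset[OF A'(1) fin] by (simp_all add: C_def)
  have spanA: "span A = B"
    using span_minimal[OF A(1) assms(2)] A(3) by (rule subset_antisym)
  have "\<exists>a. z - (\<Sum>j\<in>C. scale (a j) j) \<in> B" if "z \<in> Z" for z
  proof -
    have "C \<union> A = A'" using A'(1) by (auto simp: C_def)
    then have "z \<in> span (C \<union> A)" using that A'(4) by (simp add: subsetD)
    then obtain x y where xy: "x \<in> span C" "y \<in> span A" "z = x + y"
      unfolding span_Un by blast
    then obtain a where "x = (\<Sum>j\<in>C. scale (a j) j)"
      unfolding span_finite[OF finC(1)] by blast
    then have "z - (\<Sum>j\<in>C. scale (a j) j) = y" using xy by simp
    then show ?thesis using xy(2) spanA by (intro exI[of _ a]) simp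
  qed
  moreover have "a j = 0" if s: "(\<Sum>j\<in>C. scale (a j) j) \<in> B" and j: "j \<in> C" for a j
  proof -
    obtain b where b: "(\<Sum>j\<in>C. scale (a j) j) = (\<Sum>j\<in>A. scale (b j) j)"
      using s unfolding spanA[symmetric] span_finite[OF finC(2)] by blast
    \<comment> \<open>The coefficients of the difference of the two expansions, which is a relation
      among the independent vectors \<open>A'\<close>.\<close>
    let ?u = "\<lambda>j. if j \<in> A then - b j else a j"
    have "A' = C \<union> A" "C \<inter> A = {}" using A' by (auto simp: C_def)
    then have "(\<Sum>j\<in>A'. scale (?u j) j) = (\<Sum>j\<in>C. scale (?u j) j) + (\<Sum>j\<in>A. scale (?u j) j)"
      using finC by (simp add: sum.union_disjoint)
    also have "(\<Sum>j\<in>C. scale (?u j) j) = (\<Sum>j\<in>C. scale (a j) j)"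
      by (rule sum.cong) (auto simp: C_def)
    also have "(\<Sum>j\<in>A. scale (?u j) j) = - (\<Sum>j\<in>A. scale (b j) j)"
      by (simp add: sum_negf)
    finally have "(\<Sum>j\<in>A'. scale (?u j) j) = 0" using b by simp
    from independentD[OF A'(3) fin subset_refl this, of j] have "?u j = 0"
      using j by (simp add: C_def)
    then show ?thesis using j by (simp add: C_def)
  qed
  ultimately have "quotient_dim Z B (card C)"
    using A'(2) finC(1) by (intro quotient_dimI[where c = "\<lambda>x. x"]) (auto simp only: C_def)
  then show ?thesis ..
qed

text \<open>The hypotheses say that the inclusion of \<open>Z\<close> into \<open>Z'\<close> induces
  a bijection of the quotients, injective by \<open>B' \<inter> Z \<subseteq> B\<close> and
  surjective by the last one, so the same representatives serve. This will compare a subcomplex with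
  the whole complex.\<close>

lemma quotient_dim_mono:
  assumes "quotient_dim Z B m" and "subspace B'"
    and "Z \<subseteq> Z'" and "B \<subseteq> B'" and "B' \<inter> Z \<subseteq> B" and "subspace Z"
    and "\<And>z. z \<in> Z' \<Longrightarrow> \<exists>w\<in>Z. z - w \<in> B'"
  shows "quotient_dim Z' B' m"
proof -
  obtain c where c: "\<And>i. i < m \<Longrightarrow> c i \<in> Z"
    and ex: "\<And>z. z \<in> Z \<Longrightarrow> \<exists>a. z - (\<Sum>i<m. scale (a i) (c i)) \<in> B"
    and un: "\<And>a i. (\<Sum>i<m. scale (a i) (c i)) \<in> B \<Longrightarrow> i < m \<Longrightarrow> a i = 0"
    using assms(1) by (rule quotient_dimE) blast
  have "\<exists>a. z - (\<Sum>i<m. scale (a i) (c i)) \<in> B'" if "z \<in> Z'" for z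
  proof -
    obtain w where w: "w \<in> Z" "z - w \<in> B'" using assms(7)[OF \<open>z \<in> Z'\<close>] by blast
    obtain a where "w - (\<Sum>i<m. scale (a i) (c i)) \<in> B'" using ex[OF w(1)] assms(4) by blast
    then have "(z - w) + (w - (\<Sum>i<m. scale (a i) (c i))) \<in> B'"
      using w(2) subspace_add[OF assms(2)] by blast
    then show ?thesis by auto
  qed
  moreover have "(\<Sum>i<m. scale (a i) (c i)) \<in> Z" for a
    by (intro subspace_sum subspace_scale assms(6) c) simp
  moreover have "a i = 0" if "(\<Sum>i<m. scale (a i) (c i)) \<in> B'" "i < m" for a i
    using un[of a i] that \<open>\<And>a. (\<Sum>i<m. scale (a i) (c i)) \<in> Z\<close>[of a] assms(5) by auto
  ultimately show ?thesis
    unfolding quotient_dim_def using c assms(3) by (intro exI[of _ c] conjI allI impI ballI) blast+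
qed

text \<open>The map (x, y) -> x + T y identifies the direct sum of Z0/B0 and Z1/B1 with Z/B, and the
  two families of representatives are united. \<open>T\<close> will be exterior multiplication by a
  closed 1-form.\<close>

lemma quotient_dim_unique_sum:
  assumes "quotient_dim Z0 B0 m" and "quotient_dim Z1 B1 n"
    and lin: "\<And>x y. T (x + y) = T x + T y" "\<And>a x. T (scale a x) = scale a (T x)"
    and "subspace B" and "subspace Z0" and "subspace Z1"
    and "Z0 \<subseteq> Z" and "T ` Z1 \<subseteq> Z" and "\<And>z. z \<in> Z \<Longrightarrow> \<exists>x\<in>Z0. \<exists>y\<in>Z1. z = x + T y"
    and "B0 \<subseteq> B" and "T ` B1 \<subseteq> B"
    and "\<And>x y. x \<in> Z0 \<Longrightarrow> y \<in> Z1 \<Longrightarrow> x + T y \<in> B \<Longrightarrow> x \<in> B0 \<and> y \<in> B1"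
  shows "quotient_dim Z B (m + n)"
proof -
  obtain c where c: "\<And>i. i < m \<Longrightarrow> c i \<in> Z0"
    and c_ex: "\<And>z. z \<in> Z0 \<Longrightarrow> \<exists>a. z - (\<Sum>i<m. scale (a i) (c i)) \<in> B0"
    and c_un: "\<And>a i. (\<Sum>i<m. scale (a i) (c i)) \<in> B0 \<Longrightarrow> i < m \<Longrightarrow> a i = 0"
    using assms(1) by (rule quotient_dimE) blast
  obtain d where d: "\<And>i. i < n \<Longrightarrow> d i \<in> Z1"
    and d_ex: "\<And>z. z \<in> Z1 \<Longrightarrow> \<exists>a. z - (\<Sum>i<n. scale (a i) (d i)) \<in> B1"
    and d_un: "\<And>a i. (\<Sum>i<n. scale (a i) (d i)) \<in> B1 \<Longrightarrow> i < n \<Longrightarrow> a i = 0"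
    using assms(2) by (rule quotient_dimE) blast
  have T0: "T 0 = 0" using lin(1)[of 0 0] by simp
  have T_diff: "T (x - y) = T x - T y" for x y
    using lin(1)[of "x - y" y] by simp
  have T_sum: "T (\<Sum>i<n. scale (a i) (d i)) = (\<Sum>i<n. scale (a i) (T (d i)))" for a
    by (induction n) (simp_all add: T0 lin)
  let ?J = "Inl ` {..<m} \<union> Inr ` {..<n} :: (nat + nat) set"
  let ?e = "case_sum c (\<lambda>i. T (d i))"
  have split: "(\<Sum>j\<in>?J. scale (a j) (?e j)) =
      (\<Sum>i<m. scale (a (Inl i)) (c i)) + T (\<Sum>i<n. scale (a (Inr i)) (d i))" for a
    by (subst sum.union_disjoint) (auto simp: sum.reindex T_sum)
  have Z0: "(\<Sum>i<m. scale (a i) (c i)) \<in> Z0" for a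
    by (intro subspace_sum subspace_scale assms c) simp
  have Z1: "(\<Sum>i<n. scale (a i) (d i)) \<in> Z1" for a
    by (intro subspace_sum subspace_scale assms d) simp
  have "quotient_dim Z B (card ?J)"
  proof (rule quotient_dimI[where c = ?e])
    show "\<exists>a. z - (\<Sum>j\<in>?J. scale (a j) (?e j)) \<in> B" if z: "z \<in> Z" for z
    proof -
      obtain x y where xy: "x \<in> Z0" "y \<in> Z1" "z = x + T y" using assms(10)[OF z] by blast
      obtain a where a: "x - (\<Sum>i<m. scale (a i) (c i)) \<in> B0" using c_ex xy by blast
      obtain b where b: "y - (\<Sum>i<n. scale (b i) (d i)) \<in> B1" using d_ex xy by blast
      have "x - (\<Sum>i<m. scale (a i) (c i)) + T (y - (\<Sum>i<n. scale (b i) (d i))) \<in> B"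
        using a b assms(11,12) by (intro subspace_add[OF assms(5)]) auto
      then show ?thesis
        unfolding split by (intro exI[of _ "case_sum a b"]) (simp add: xy T_diff algebra_simps)
    qed
    show "a j = 0" if s: "(\<Sum>j\<in>?J. scale (a j) (?e j)) \<in> B" and j: "j \<in> ?J" for a j
      using assms(13)[OF Z0 Z1 s[unfolded split]] c_un[of "\<lambda>i. a (Inl i)"] d_un[of "\<lambda>i. a (Inr i)"] j
      by auto
  qed (use c d assms(8,9) in auto)
  also have "card ?J = m + n"
    by (subst card_Un_disjoint) (auto simp: card_image)
  finally show ?thesis .
qed

lemma has_dim_quotient:
  assumes "subspace Z" and "subspace B" and "B \<subseteq> Z" and "quotient_dim Z B m"
  shows "has_dim (quotient_module (subspace_module scale Z) B) m"
proof -
  obtain c where c: "\<And>i. i < m \<Longrightarrow> c i \<in> Z"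
    and ex: "\<And>z. z \<in> Z \<Longrightarrow> \<exists>a. z - (\<Sum>i<m. scale (a i) (c i)) \<in> B"
    and un: "\<And>a i. (\<Sum>i<m. scale (a i) (c i)) \<in> B \<Longrightarrow> i < m \<Longrightarrow> a i = 0"
    using assms(4) by (rule quotient_dimE) blast
  define co where "co z = (\<lambda>b. b + z) ` B" for z
  have co_eq: "co z = co w" if "z - w \<in> B" for z w
  proof -
    have "b + z \<in> co w" if "b \<in> B" for b
      using subspace_add[OF assms(2) that \<open>z - w \<in> B\<close>] unfolding co_def
      by (intro image_eqI[of _ _ "b + (z - w)"]) auto
    moreover have "b + w \<in> co z" if "b \<in> B" for b
      using subspace_diff[OF assms(2) that \<open>z - w \<in> B\<close>] unfolding co_def
      by (intro image_eqI[of _ _ "b - (z - w)"]) auto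
    ultimately show ?thesis by (auto simp: co_def)
  qed
  have co_mem: "z \<in> co z" for z
    using subspace_0[OF assms(2)] by (force simp: co_def)
  have co_eqD: "z - w \<in> B" if "co z = co w" for z w
    using co_mem[of z] that by (auto simp: co_def)
  define L where "L a = (\<Sum>i<m. scale (a i) (c i))" for a
  have L_add: "L (a + b) = L a + L b" for a b
    by (simp add: L_def algebra_simps sum.distrib)
  have L_scale: "L (fscale r a) = scale r (L a)" for a r
    by (simp add: L_def fscale_def scale_sum_right)
  have LZ: "L a \<in> Z" for a
    unfolding L_def by (intro subspace_sum subspace_scale assms c) simp
  let ?Q = "quotient_module (subspace_module scale Z) B"
  have carr: "carrier ?Q = co ` Z"
    by (simp add: carrier_quotient co_def[abs_def])
  have add: "co x \<oplus>\<^bsub>?Q\<^esub> co y = co (x + y)" for x y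
  proof -
    have "co x \<oplus>\<^bsub>?Q\<^esub> co y = {u + v |u v. u \<in> co x \<and> v \<in> co y}"
      by (rule add_quotient)
    also have "\<dots> = co (x + y)"
    proof safe
      fix u v assume "u \<in> co x" "v \<in> co y"
      then obtain b b' where "b \<in> B" "b' \<in> B" "u = b + x" "v = b' + y" by (auto simp: co_def)
      then show "u + v \<in> co (x + y)" unfolding co_def
        by (intro image_eqI[of _ _ "b + b'"] subspace_add[OF assms(2)]) (auto simp: algebra_simps)
    next
      fix w assume "w \<in> co (x + y)"
      then obtain b where "b \<in> B" "w = b + (x + y)" by (auto simp: co_def)
      then show "\<exists>u v. w = u + v \<and> u \<in> co x \<and> v \<in> co y"
        using co_mem[of y] by (intro exI[of _ "b + x"] exI[of _ y]) (auto simp: co_def algebra_simps)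
    qed
    finally show ?thesis .
  qed
  have smult: "r \<odot>\<^bsub>?Q\<^esub> co x = co (scale r x)" for r x
  proof -
    have "r \<odot>\<^bsub>?Q\<^esub> co x = {scale r u + b |u b. u \<in> co x \<and> b \<in> B}"
      by (rule smult_quotient)
    also have "\<dots> = co (scale r x)"
    proof safe
      fix u b assume "u \<in> co x" "b \<in> B"
      then obtain b' where "b' \<in> B" "u = b' + x" by (auto simp: co_def)
      then show "scale r u + b \<in> co (scale r x)" unfolding co_def using \<open>b \<in> B\<close>
        by (intro image_eqI[of _ _ "scale r b' + b"] subspace_add[OF assms(2)] subspace_scale[OF assms(2)])
           (auto simp: algebra_simps)
    next
      fix w assume "w \<in> co (scale r x)"
      then obtain b where "b \<in> B" "w = b + scale r x" by (auto simp: co_def)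
      then show "\<exists>u b. w = scale r u + b \<and> u \<in> co x \<and> b \<in> B"
        using co_mem[of x] by (intro exI[of _ x] exI[of _ b]) (auto simp: algebra_simps)
    qed
    finally show ?thesis .
  qed
  show ?thesis
  proof (rule has_dimI[where f = "\<lambda>a. co (L a)"])
    show "bij_betw (\<lambda>a. co (L a)) (coord_space m) (carrier ?Q)"
      unfolding bij_betw_def
    proof
      show "inj_on (\<lambda>a. co (L a)) (coord_space m)"
      proof (rule inj_onI)
        fix a b assume ab: "a \<in> coord_space m" "b \<in> coord_space m" and "co (L a) = co (L b)"
        then have "L a - L b \<in> B" by (intro co_eqD)
        then have "(\<Sum>i<m. scale ((a - b) i) (c i)) \<in> B"
          by (simp add: L_def algebra_simps sum_subtractf)
        then have "(a - b) i = 0" if "i < m" for i using un that by blast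
        then show "a = b" using ab unfolding coord_space_def
          by (auto simp: fun_eq_iff) (metis linorder_not_less)
      qed
      show "(\<lambda>a. co (L a)) ` coord_space m = carrier ?Q"
      proof
        show "(\<lambda>a. co (L a)) ` coord_space m \<subseteq> carrier ?Q" using LZ by (auto simp: carr)
        show "carrier ?Q \<subseteq> (\<lambda>a. co (L a)) ` coord_space m"
        proof
          fix X assume "X \<in> carrier ?Q"
          then obtain z where z: "z \<in> Z" "X = co z" by (auto simp: carr)
          obtain a where a: "z - L a \<in> B" using ex[OF z(1)] unfolding L_def by blast
          \<comment> \<open>The coefficients found are arbitrary from \<open>m\<close> on, whereas
            the model space asks for zeros there.\<close>
          have "L (\<lambda>i. if i < m then a i else 0) = L a" by (simp add: L_def)
          then have "X = co (L (\<lambda>i. if i < m then a i else 0))" using co_eq[OF a] z by simp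
          then show "X \<in> (\<lambda>a. co (L a)) ` coord_space m"
            by (intro image_eqI) (auto simp: coord_space_def)
        qed
      qed
    qed
  qed (simp_all add: L_add L_scale add smult)
qed

end

text \<open>A linear \<open>T\<close> that induces a bijection of Z1/B1 with Z2/B2 allows dimensions
  to be pulled back. Surjectivity is demanded modulo \<open>B2\<close> only, because the map to
  simplicial cochains will miss the nonzero constants in degree 0.\<close>

lemma quotient_dim_transfer:
  fixes T :: "'v::ab_group_add \<Rightarrow> 'w::ab_group_add" and s1 :: "'k::field \<Rightarrow> 'v \<Rightarrow> 'v"
  assumes "scaled_space s1" and "scaled_space s2"
    and "scaled_space.quotient_dim s2 Z2 B2 m"
    and lin: "\<And>x y. T (x + y) = T x + T y" "\<And>a x. T (s1 a x) = s2 a (T x)"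
    and "module.subspace s1 Z1" and "module.subspace s2 B2"
    and "T ` Z1 \<subseteq> Z2" and "T ` B1 \<subseteq> B2"
    and refl: "\<And>z. z \<in> Z1 \<Longrightarrow> T z \<in> B2 \<Longrightarrow> z \<in> B1"
    and surj: "\<And>z. z \<in> Z2 \<Longrightarrow> \<exists>w\<in>Z1. z - T w \<in> B2"
  shows "scaled_space.quotient_dim s1 Z1 B1 m"
proof -
  interpret V: scaled_space s1 by fact
  interpret W: scaled_space s2 by fact
  obtain c where c: "\<And>i. i < m \<Longrightarrow> c i \<in> Z2"
    and ex: "\<And>z. z \<in> Z2 \<Longrightarrow> \<exists>a. z - (\<Sum>i<m. s2 (a i) (c i)) \<in> B2"
    and un: "\<And>a i. (\<Sum>i<m. s2 (a i) (c i)) \<in> B2 \<Longrightarrow> i < m \<Longrightarrow> a i = 0"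
    using assms(3) by (rule W.quotient_dimE) blast
  have T0: "T 0 = 0" using lin(1)[of 0 0] by simp
  have T_diff: "T (x - y) = T x - T y" for x y
    using lin(1)[of "x - y" y] by simp
  \<comment> \<open>The representatives in \<open>Z2\<close> are lifted up to elements of
    \<open>B2\<close>.\<close>
  have "\<forall>i. \<exists>w. i < m \<longrightarrow> w \<in> Z1 \<and> c i - T w \<in> B2"
    using surj c by blast
  then obtain d where d: "\<And>i. i < m \<Longrightarrow> d i \<in> Z1 \<and> c i - T (d i) \<in> B2" by metis
  have T_sum: "T (\<Sum>i<n. s1 (a i) (d i)) = (\<Sum>i<n. s2 (a i) (T (d i)))" for a n
    by (induction n) (simp_all add: T0 lin)
  have dif: "(\<Sum>i<m. s2 (a i) (c i)) - T (\<Sum>i<m. s1 (a i) (d i)) \<in> B2" for a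
  proof -
    have "(\<Sum>i<m. s2 (a i) (c i - T (d i))) \<in> B2"
      using d by (intro W.subspace_sum W.subspace_scale assms(7)) auto
    then show ?thesis by (simp add: T_sum W.scale_right_diff_distrib sum_subtractf)
  qed
  have sumZ: "(\<Sum>i<m. s1 (a i) (d i)) \<in> Z1" for a
    using d by (intro V.subspace_sum V.subspace_scale assms(6)) auto
  have "\<exists>a. z - (\<Sum>i<m. s1 (a i) (d i)) \<in> B1" if z: "z \<in> Z1" for z
  proof -
    obtain a where a: "T z - (\<Sum>i<m. s2 (a i) (c i)) \<in> B2" using ex[of "T z"] z assms(8) by blast
    have "T (z - (\<Sum>i<m. s1 (a i) (d i))) \<in> B2"
      using W.subspace_add[OF assms(7) a dif[of a]] by (simp add: T_diff)
    then have "z - (\<Sum>i<m. s1 (a i) (d i)) \<in> B1"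
      by (intro refl V.subspace_diff[OF assms(6)] z sumZ)
    then show ?thesis by (intro exI[of _ a])
  qed
  moreover have "a i = 0" if s: "(\<Sum>i<m. s1 (a i) (d i)) \<in> B1" and i: "i < m" for a i
  proof -
    have "T (\<Sum>i<m. s1 (a i) (d i)) \<in> B2" using s assms(9) by blast
    from W.subspace_add[OF assms(7) dif[of a] this] have "(\<Sum>i<m. s2 (a i) (c i)) \<in> B2" by simp
    then show ?thesis using un i by blast
  qed
  ultimately show ?thesis unfolding V.quotient_dim_def using d by (intro exI[of _ d] conjI allI impI ballI) auto
qed

section \<open>Presented spaces, tensor products and direct sums\<close>

lemma sum_fun_apply: "(\<Sum>i\<in>A. f i) x = (\<Sum>i\<in>A. f i x)"
  for f :: "'i \<Rightarrow> 'x \<Rightarrow> 'b::comm_monoid_add"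
  by (induction A rule: infinite_finite_induct) auto

lemma has_dim_index:
  fixes f :: "('j \<Rightarrow> 'k::field) \<Rightarrow> 'v"
  assumes "finite J"
    and bij: "bij_betw f {x. \<forall>j. j \<notin> J \<longrightarrow> x j = 0} (carrier V)"
    and add: "\<And>x y. \<lbrakk>\<forall>j. j \<notin> J \<longrightarrow> x j = 0; \<forall>j. j \<notin> J \<longrightarrow> y j = 0\<rbrakk> \<Longrightarrow> f (x + y) = f x \<oplus>\<^bsub>V\<^esub> f y"
    and smult: "\<And>a x. \<forall>j. j \<notin> J \<longrightarrow> x j = 0 \<Longrightarrow> f (fscale a x) = a \<odot>\<^bsub>V\<^esub> f x"
  shows "has_dim V (card J)"
proof -
  obtain h where h: "bij_betw h J {..<card J}"
    using ex_bij_betw_finite_nat[OF assms(1)] by (auto simp: atLeast0LessThan)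
  have hJ: "h j < card J" if "j \<in> J" for j using h that by (auto simp: bij_betw_def)
  define R where "R x j = (if j \<in> J then x (h j) else 0)" for x :: "nat \<Rightarrow> 'k" and j
  have "bij_betw R (coord_space (card J)) {x. \<forall>j. j \<notin> J \<longrightarrow> x j = 0}"
  proof (rule bij_betw_byWitness[where f' = "\<lambda>y i. if i < card J then y (inv_into J h i) else 0"])
    show "\<forall>x\<in>coord_space (card J). (\<lambda>i. if i < card J then R x (inv_into J h i) else 0) = x"
      using h by (auto simp: R_def coord_space_def fun_eq_iff bij_betw_def inv_into_into f_inv_into_f)
    show "\<forall>y\<in>{x. \<forall>j. j \<notin> J \<longrightarrow> x j = 0}. R (\<lambda>i. if i < card J then y (inv_into J h i) else 0) = y"
      using h hJ by (auto simp: R_def fun_eq_iff bij_betw_def)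
  qed (auto simp: R_def coord_space_def)
  then have "bij_betw (f \<circ> R) (coord_space (card J)) (carrier V)"
    using bij by (rule bij_betw_trans)
  moreover have "R (x + y) = R x + R y" "R (fscale a x) = fscale a (R x)" for x y a
    by (auto simp: R_def fun_eq_iff fscale_def)
  moreover have "\<forall>j. j \<notin> J \<longrightarrow> R x j = 0" for x by (simp add: R_def)
  ultimately show ?thesis
    by (intro has_dimI[where f = "f \<circ> R"]) (auto simp: add smult)
qed

text \<open>Basis and coordinates are transported from the model space. The expansion is stated for
  linear functionals instead of vectors, so that no finite sum has to be formed inside the record
  \<open>V\<close>; presentations by relations need just this dual form.\<close>

lemma has_dim_coordinates:
  fixes V :: "('k::field, 'v) module"
  assumes "has_dim V m"
  obtains p :: "'v \<Rightarrow> nat \<Rightarrow> 'k" and e :: "nat \<Rightarrow> 'v"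
  where "\<And>i. e i \<in> carrier V"
    and "\<And>x y. x \<in> carrier V \<Longrightarrow> y \<in> carrier V \<Longrightarrow> x \<oplus>\<^bsub>V\<^esub> y \<in> carrier V"
    and "\<And>a x. x \<in> carrier V \<Longrightarrow> a \<odot>\<^bsub>V\<^esub> x \<in> carrier V"
    and "\<And>i j. i < m \<Longrightarrow> j < m \<Longrightarrow> p (e j) i = (if j = i then 1 else 0)"
    and "\<And>x y i. x \<in> carrier V \<Longrightarrow> y \<in> carrier V \<Longrightarrow> p (x \<oplus>\<^bsub>V\<^esub> y) i = p x i + p y i"
    and "\<And>a x i. x \<in> carrier V \<Longrightarrow> p (a \<odot>\<^bsub>V\<^esub> x) i = a * p x i"
    and "\<And>(\<beta> :: 'v \<Rightarrow> 'k) x. \<lbrakk>\<And>x y. x \<in> carrier V \<Longrightarrow> y \<in> carrier V \<Longrightarrow> \<beta> (x \<oplus>\<^bsub>V\<^esub> y) = \<beta> x + \<beta> y;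
      \<And>a x. x \<in> carrier V \<Longrightarrow> \<beta> (a \<odot>\<^bsub>V\<^esub> x) = a * \<beta> x; x \<in> carrier V\<rbrakk> \<Longrightarrow>
      \<beta> x = (\<Sum>i<m. \<beta> (e i) * p x i)"
proof -
  obtain f where f: "bij_betw f (coord_space m) (carrier V)"
    and f_add: "\<And>x y. x \<in> coord_space m \<Longrightarrow> y \<in> coord_space m \<Longrightarrow> f (x + y) = f x \<oplus>\<^bsub>V\<^esub> f y"
    and f_smult: "\<And>a x. x \<in> coord_space m \<Longrightarrow> f (fscale a x) = a \<odot>\<^bsub>V\<^esub> f x"
    using has_dimE[OF assms(1)] by blast
  define p where "p = inv_into (coord_space m) f"
  \<comment> \<open>Setting \<open>u i\<close> to 0 from \<open>m\<close> on keeps every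
    \<open>e i\<close> in the carrier, so membership needs no bound on the index.\<close>
  define u :: "nat \<Rightarrow> nat \<Rightarrow> 'k" where "u i = (if i < m then basis_vec i else 0)" for i
  have u: "u i \<in> coord_space m" for i by (auto simp: u_def coord_space_def basis_vec_def)
  have pf: "p (f x) = x" if "x \<in> coord_space m" for x
    using f that by (simp add: bij_betw_def p_def)
  have img: "\<exists>x\<in>coord_space m. v = f x" if "v \<in> carrier V" for v
    using f that by (auto simp: bij_betw_def)
  have fV: "f x \<in> carrier V" if "x \<in> coord_space m" for x
    using f that by (auto simp: bij_betw_def)
  have exp: "\<beta> x = (\<Sum>i<m. \<beta> (f (u i)) * p x i)"
    if add: "\<And>x y. x \<in> carrier V \<Longrightarrow> y \<in> carrier V \<Longrightarrow> \<beta> (x \<oplus>\<^bsub>V\<^esub> y) = \<beta> x + \<beta> y"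
      and smult: "\<And>a x. x \<in> carrier V \<Longrightarrow> \<beta> (a \<odot>\<^bsub>V\<^esub> x) = a * \<beta> x"
      and x: "x \<in> carrier V" for \<beta> :: "'v \<Rightarrow> 'k" and x
  proof -
    obtain y where y: "y \<in> coord_space m" "x = f y" using img x by blast
    \<comment> \<open>As \<open>V\<close> is a bare record, the value at zero has to be obtained
      from homogeneity with the scalar 0.\<close>
    have "fscale 0 0 = (0 :: nat \<Rightarrow> 'k)" "0 \<in> (coord_space m :: (nat \<Rightarrow> 'k) set)"
      by (simp_all add: fun_eq_iff fscale_def coord_space_def)
    then have f0: "\<beta> (f 0) = 0"
      using smult[of "f 0" 0] f_smult[of 0 0] fV[of 0] by simp
    have part: "(\<Sum>i<n. fscale (y i) (u i)) \<in> coord_space m \<and>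
        \<beta> (f (\<Sum>i<n. fscale (y i) (u i))) = (\<Sum>i<n. \<beta> (f (u i)) * y i)" for n
    proof (induction n)
      case 0
      have "(\<Sum>i<0::nat. fscale (y i) (u i)) = 0" by simp
      then show ?case using f0 \<open>0 \<in> coord_space m\<close> by (simp del: zero_fun_apply)
    next
      case (Suc n)
      let ?s = "\<Sum>i<n. fscale (y i) (u i)" and ?t = "fscale (y n) (u n)"
      have t: "?t \<in> coord_space m" by (rule coord_space_scale[OF u])
      have s: "?s \<in> coord_space m" using Suc by blast
      have "\<beta> (f (?s + ?t)) = \<beta> (f ?s) + \<beta> (f ?t)"
        by (simp only: f_add[OF s t] add[OF fV[OF s] fV[OF t]])
      moreover have "\<beta> (f ?t) = y n * \<beta> (f (u n))"
        by (simp only: f_smult[OF u] smult[OF fV[OF u]])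
      moreover have "?s + ?t \<in> coord_space m" by (rule coord_space_add[OF s t])
      ultimately show ?case using Suc by (simp add: mult.commute del: plus_fun_apply)
    qed
    have "(\<Sum>i<m. fscale (y i) (u i)) = y"
    proof
      fix k
      have "(\<Sum>i<m. fscale (y i) (u i)) k = (\<Sum>i<m. if i = k then y k else 0)"
        unfolding sum_fun_apply by (rule sum.cong) (auto simp: fscale_def u_def basis_vec_def)
      also have "\<dots> = y k" using y(1) by (auto simp: coord_space_def)
      finally show "(\<Sum>i<m. fscale (y i) (u i)) k = y k" .
    qed
    then show ?thesis using part[of m] y by (simp add: pf)
  qed
  show ?thesis
  proof (rule that[of "\<lambda>i. f (u i)" p])
    show "f (u i) \<in> carrier V" for i by (rule fV[OF u])
    show "x \<oplus>\<^bsub>V\<^esub> y \<in> carrier V" if "x \<in> carrier V" "y \<in> carrier V" for x y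
      using img[OF that(1)] img[OF that(2)] fV coord_space_add f_add by metis
    show "a \<odot>\<^bsub>V\<^esub> x \<in> carrier V" if "x \<in> carrier V" for a x
      using img[OF that(1)] fV coord_space_scale f_smult by metis
    show "p (f (u j)) i = (if j = i then 1 else 0)" if "i < m" "j < m" for i j
      using that by (auto simp: pf u) (auto simp: u_def basis_vec_def)
    show "p (x \<oplus>\<^bsub>V\<^esub> y) i = p x i + p y i" if xy: "x \<in> carrier V" "y \<in> carrier V" for x y i
    proof -
      obtain v w where "v \<in> coord_space m" "x = f v" "w \<in> coord_space m" "y = f w"
        using img[OF xy(1)] img[OF xy(2)] by blast
      then show ?thesis by (simp add: f_add[symmetric] pf coord_space_add)
    qed
    show "p (a \<odot>\<^bsub>V\<^esub> x) i = a * p x i" if x: "x \<in> carrier V" for a x i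
    proof -
      obtain v where "v \<in> coord_space m" "x = f v"
        using img[OF x] by blast
      then show ?thesis by (simp add: f_smult[symmetric] pf coord_space_scale) (simp add: fscale_def)
    qed
  qed (rule exp)
qed

interpretation fun_scaled: scaled_space "fscale :: 'k::field \<Rightarrow> ('x \<Rightarrow> 'k) \<Rightarrow> 'x \<Rightarrow> 'k"
  by (simp add: scaled_space_def fun_vs.vector_space_axioms)

section \<open>Functionals on free spaces and spaces given by relations\<close>

definition lin_ext :: "('x \<Rightarrow> 'k::field) \<Rightarrow> ('x \<Rightarrow> 'k) \<Rightarrow> 'k"
  where "lin_ext \<beta> \<phi> = (\<Sum>x | \<phi> x \<noteq> 0. \<phi> x * \<beta> x)"

lemma lin_ext_superset:
  "finite A \<Longrightarrow> {x. \<phi> x \<noteq> 0} \<subseteq> A \<Longrightarrow> lin_ext \<beta> \<phi> = (\<Sum>x\<in>A. \<phi> x * \<beta> x)"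
  unfolding lin_ext_def by (rule sum.mono_neutral_left) auto

lemma free_space_subspace: "fun_vs.subspace (free_space S :: ('a \<Rightarrow> 'b::field) set)"
proof (rule fun_vs.subspaceI)
  show "0 \<in> free_space S" by (simp add: free_space_def)
next
  fix x y :: "'a \<Rightarrow> 'b::field" assume xy: "x \<in> free_space S" "y \<in> free_space S"
  have "{z. (x + y) z \<noteq> 0} \<subseteq> {z. x z \<noteq> 0} \<union> {z. y z \<noteq> 0}" by auto
  with xy show "x + y \<in> free_space S" unfolding free_space_def
    by (auto dest: finite_subset)
next
  fix c and x :: "'a \<Rightarrow> 'b::field" assume x: "x \<in> free_space S"
  have "{z. fscale c x z \<noteq> 0} \<subseteq> {z. x z \<noteq> 0}" by (auto simp: fscale_def)
  with x show "fscale c x \<in> free_space S" unfolding free_space_def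
    by (auto dest: finite_subset)
qed

lemma basis_vec_free: "x \<in> S \<Longrightarrow> basis_vec x \<in> free_space S"
  unfolding free_space_def basis_vec_def by (auto intro: finite_subset[of _ "{x}"])

lemma lin_ext_basis_vec [simp]: "lin_ext \<beta> (basis_vec x) = \<beta> x"
  by (subst lin_ext_superset[of "{x}"]) (auto simp: basis_vec_def)

lemma lin_ext_add:
  assumes "\<phi> \<in> free_space S" and "\<psi> \<in> free_space S"
  shows "lin_ext \<beta> (\<phi> + \<psi>) = lin_ext \<beta> \<phi> + lin_ext \<beta> \<psi>"
proof -
  let ?A = "{x. \<phi> x \<noteq> 0} \<union> {x. \<psi> x \<noteq> 0}"
  have A: "finite ?A" using assms by (simp add: free_space_def)
  show ?thesis
    by (subst (1 2 3) lin_ext_superset[OF A]) (auto simp: algebra_simps sum.distrib)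
qed

lemma lin_ext_diff:
  assumes "\<phi> \<in> free_space S" and "\<psi> \<in> free_space S"
  shows "lin_ext \<beta> (\<phi> - \<psi>) = lin_ext \<beta> \<phi> - lin_ext \<beta> \<psi>"
  using lin_ext_add[of "\<phi> - \<psi>" S \<psi> \<beta>] assms
  by (simp add: fun_vs.subspace_diff[OF free_space_subspace])

lemma lin_ext_fscale:
  assumes "\<phi> \<in> free_space S"
  shows "lin_ext \<beta> (fscale a \<phi>) = a * lin_ext \<beta> \<phi>"
proof -
  have A: "finite {x. \<phi> x \<noteq> 0}" using assms by (simp add: free_space_def)
  show ?thesis
    by (subst (1 2) lin_ext_superset[OF A]) (auto simp: fscale_def sum_distrib_left mult.assoc)
qed

lemma free_space_sum: "(\<And>j. j \<in> J \<Longrightarrow> f j \<in> free_space S) \<Longrightarrow> sum f J \<in> free_space S"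
  by (rule fun_vs.subspace_sum[OF free_space_subspace])

lemma lin_ext_sum:
  assumes "finite J" and "\<And>j. j \<in> J \<Longrightarrow> f j \<in> free_space S"
  shows "lin_ext \<beta> (\<Sum>j\<in>J. f j) = (\<Sum>j\<in>J. lin_ext \<beta> (f j))"
  using assms
proof (induction J)
  case empty
  then show ?case by (simp add: lin_ext_def)
next
  case (insert j J)
  then show ?case
    using lin_ext_add[of "f j" S "sum f J" \<beta>] by (simp add: free_space_sum del: plus_fun_apply)
qed

lemma free_space_expand:
  assumes "\<phi> \<in> free_space S"
  shows "\<phi> = (\<Sum>x | \<phi> x \<noteq> 0. fscale (\<phi> x) (basis_vec x))"
proof
  fix y
  have "finite {x. \<phi> x \<noteq> 0}" using assms by (simp add: free_space_def)
  moreover have "(\<Sum>x | \<phi> x \<noteq> 0. fscale (\<phi> x) (basis_vec x)) y = (\<Sum>x | \<phi> x \<noteq> 0. if x = y then \<phi> y else 0)"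
    unfolding sum_fun_apply by (rule sum.cong) (auto simp: fscale_def basis_vec_def)
  ultimately show "\<phi> y = (\<Sum>x | \<phi> x \<noteq> 0. fscale (\<phi> x) (basis_vec x)) y" by auto
qed

interpretation fun_functional: vector_space_pair "fscale :: 'k::field \<Rightarrow> ('x \<Rightarrow> 'k) \<Rightarrow> 'x \<Rightarrow> 'k" "(*)"
  by unfold_locales (auto simp: algebra_simps)

text \<open>A basis of the span stays independent when \<phi> is added, so the functional that is 1
  on \<phi> and 0 on that basis extends to the whole space.\<close>

lemma separating_functional:
  fixes \<phi> :: "'x \<Rightarrow> 'k::field"
  assumes "\<phi> \<notin> fun_vs.span R"
  obtains g where "Vector_Spaces.linear fscale (*) g" and "\<And>\<psi>. \<psi> \<in> fun_vs.span R \<Longrightarrow> g \<psi> = 0" and "g \<phi> = (1::'k)"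
proof -
  obtain A where A: "A \<subseteq> fun_vs.span R" "fun_vs.independent A" "fun_vs.span R \<subseteq> fun_vs.span A"
    by (rule fun_vs.basis_exists[of "fun_vs.span R"])
  have "fun_vs.span A \<subseteq> fun_vs.span R"
    by (rule fun_vs.span_minimal[OF A(1)]) simp
  then have "\<phi> \<notin> fun_vs.span A" using assms by blast
  then have "fun_vs.independent (insert \<phi> A)" "\<phi> \<notin> A"
    using fun_vs.independent_insertI[OF _ A(2)] fun_vs.span_base[of \<phi> A] by blast+
  then obtain g where g: "Vector_Spaces.linear fscale (*) g"
    "\<forall>x\<in>insert \<phi> A. g x = (if x = \<phi> then 1 else 0)"
    using fun_functional.linear_independent_extend[of "insert \<phi> A" "\<lambda>x. if x = \<phi> then 1 else 0"] by blast
  interpret g: Vector_Spaces.linear fscale "(*)" g by (rule g(1))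
  have "g \<psi> = 0" if "\<psi> \<in> fun_vs.span A" for \<psi>
    using that
    by (rule fun_vs.span_induct)
      (use g(2) \<open>\<phi> \<notin> A\<close> in \<open>auto intro!: fun_vs.subspaceI simp: g.zero g.add g.scale simp del: plus_fun_apply zero_fun_apply\<close>)
  then show ?thesis using g A(3) by (intro that[of g]) auto
qed

text \<open>A criterion for the classes of the generators \<open>s j\<close> to form a basis. Dual
  functionals that kill the relations give independence; spanning is tested dually, by requiring
  every functional that kills the relations to be a combination of the \<delta> j. No vector has to
  be rewritten modulo the relations.\<close>

theorem has_dim_presented:
  fixes S :: "'x set" and rels :: "('x \<Rightarrow> 'k::field) set"
  assumes "finite J"
    and rels: "rels \<subseteq> free_space S"
    and s: "\<And>j. j \<in> J \<Longrightarrow> s j \<in> S"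
    and dual: "\<And>i j. i \<in> J \<Longrightarrow> j \<in> J \<Longrightarrow> \<delta> j (s i) = (if i = j then 1 else 0)"
    and kills: "\<And>j \<rho>. j \<in> J \<Longrightarrow> \<rho> \<in> rels \<Longrightarrow> lin_ext (\<delta> j) \<rho> = 0"
    and expand: "\<And>\<beta> x. (\<And>\<rho>. \<rho> \<in> rels \<Longrightarrow> lin_ext \<beta> \<rho> = 0) \<Longrightarrow> x \<in> S \<Longrightarrow> \<beta> x = (\<Sum>j\<in>J. \<beta> (s j) * \<delta> j x)"
  shows "has_dim (presented_space S rels) (card J)"
proof -
  have span_free: "fun_vs.span rels \<subseteq> free_space S"
    by (rule fun_vs.span_minimal[OF rels free_space_subspace])
  have bs: "fscale a (basis_vec (s j)) \<in> free_space S" if "j \<in> J" for a j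
    by (intro fun_vs.subspace_scale[OF free_space_subspace] basis_vec_free s that)
  have kills': "lin_ext (\<delta> j) \<rho> = 0" if "j \<in> J" "\<rho> \<in> fun_vs.span rels" for j \<rho>
  proof -
    have "\<rho> \<in> {\<phi> \<in> free_space S. lin_ext (\<delta> j) \<phi> = 0}"
    proof (rule subsetD[OF fun_vs.span_minimal that(2)])
      show "rels \<subseteq> {\<phi> \<in> free_space S. lin_ext (\<delta> j) \<phi> = 0}" using rels kills that by auto
      show "fun_vs.subspace {\<phi> \<in> free_space S. lin_ext (\<delta> j) \<phi> = 0}"
        by (rule fun_vs.subspaceI)
          (auto simp: lin_ext_add[of _ S] lin_ext_fscale[of _ S] fun_vs.subspace_0[OF free_space_subspace]
            fun_vs.subspace_add[OF free_space_subspace] fun_vs.subspace_scale[OF free_space_subspace],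
           simp add: lin_ext_def)
    qed
    then show ?thesis by simp
  qed
  have "fun_scaled.quotient_dim (free_space S) (fun_vs.span rels) (card J)"
  proof (rule fun_scaled.quotient_dimI[where c = "\<lambda>j. basis_vec (s j)"])
    show "\<exists>a. \<phi> - (\<Sum>j\<in>J. fscale (a j) (basis_vec (s j))) \<in> fun_vs.span rels"
      if \<phi>: "\<phi> \<in> free_space S" for \<phi>
    proof (rule ccontr)
      \<comment> \<open>If \<psi>, the vector minus its expected expansion, lay outside the span of
        the relations, some \<open>g\<close> would separate it. But \<open>g\<close> kills the
        relations, so it is a combination of the \<delta> j, and these vanish on \<psi>.\<close>
      assume neg: "\<nexists>a. \<phi> - (\<Sum>j\<in>J. fscale (a j) (basis_vec (s j))) \<in> fun_vs.span rels"
      define \<psi> where "\<psi> = \<phi> - (\<Sum>j\<in>J. fscale (lin_ext (\<delta> j) \<phi>) (basis_vec (s j)))"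
      have "\<psi> \<notin> fun_vs.span rels" using neg by (auto simp: \<psi>_def)
      then obtain g where g: "Vector_Spaces.linear fscale (*) g" and g0: "\<And>\<rho>. \<rho> \<in> fun_vs.span rels \<Longrightarrow> g \<rho> = 0"
        and g1: "g \<psi> = (1::'k)" by (rule separating_functional) blast
      interpret g: Vector_Spaces.linear fscale "(*)" g by (rule g)
      define \<beta> where "\<beta> x = g (basis_vec x)" for x
      have g_ext: "g \<chi> = lin_ext \<beta> \<chi>" if "\<chi> \<in> free_space S" for \<chi>
      proof -
        have "g \<chi> = g (\<Sum>x | \<chi> x \<noteq> 0. fscale (\<chi> x) (basis_vec x))"
          by (subst free_space_expand[OF that]) (rule refl)
        then show ?thesis by (simp add: g.sum g.scale lin_ext_def \<beta>_def)
      qed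
      have \<beta>: "\<beta> x = (\<Sum>j\<in>J. \<beta> (s j) * \<delta> j x)" if "x \<in> S" for x
      proof (rule expand[OF _ that])
        show "lin_ext \<beta> \<rho> = 0" if "\<rho> \<in> rels" for \<rho>
          using g_ext[OF subsetD[OF rels that]] g0[OF fun_vs.span_base[OF that]] by simp
      qed
      have "g \<phi> = (\<Sum>x | \<phi> x \<noteq> 0. \<phi> x * (\<Sum>j\<in>J. \<beta> (s j) * \<delta> j x))"
        unfolding g_ext[OF \<phi>] lin_ext_def
        by (rule sum.cong) (use \<phi> \<beta> in \<open>auto simp: free_space_def\<close>)
      also have "\<dots> = (\<Sum>j\<in>J. lin_ext (\<delta> j) \<phi> * \<beta> (s j))"
        unfolding lin_ext_def sum_distrib_left sum_distrib_right
        by (rule trans[OF sum.swap]) (intro sum.cong refl, simp only: mult_ac)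
      also have "\<dots> = g (\<Sum>j\<in>J. fscale (lin_ext (\<delta> j) \<phi>) (basis_vec (s j)))"
        by (simp add: g.sum g.scale \<beta>_def)
      finally have "g \<psi> = 0" by (simp add: \<psi>_def g.diff)
      with g1 show False by simp
    qed
    show "a i = 0" if "(\<Sum>j\<in>J. fscale (a j) (basis_vec (s j))) \<in> fun_vs.span rels" "i \<in> J" for a i
    proof -
      have "0 = (\<Sum>j\<in>J. a j * \<delta> i (s j))"
        using kills'[OF that(2,1)]
        by (simp add: lin_ext_sum[OF assms(1) bs] lin_ext_fscale[OF basis_vec_free[OF UNIV_I]])
      also have "\<dots> = (\<Sum>j\<in>J. if j = i then a i else 0)"
        by (rule sum.cong) (auto simp: dual that)
      also have "\<dots> = a i" using that assms(1) by simp
      finally show ?thesis by simp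
    qed
  qed (auto intro: assms(1) basis_vec_free s)
  then show ?thesis unfolding presented_space_def
    by (intro fun_scaled.has_dim_quotient free_space_subspace span_free) auto
qed

text \<open>The zero of a quotient record is the submodule itself. Its membership is checked
  separately because \<open>has_dim\<close> says nothing about the zero field, on which the finite
  support condition of \<open>direct_sum\<close> depends.\<close>

lemma presented_space_zero: "rels \<subseteq> free_space S \<Longrightarrow> \<zero>\<^bsub>presented_space S rels\<^esub> \<in> carrier (presented_space S rels)"
  unfolding presented_space_def carrier_quotient
  by (rule image_eqI[of _ _ 0]) (auto simp: quotient_module_def fun_vs.subspace_0[OF free_space_subspace])

section \<open>Tensor products and direct sums\<close>

lemma tensor_rels_free:
  assumes "has_dim V m" and "has_dim W n"
  shows "tensor_rels V W \<subseteq> free_space (carrier V \<times> carrier W)"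
proof -
  obtain p e where V: "\<And>x y. x \<in> carrier V \<Longrightarrow> y \<in> carrier V \<Longrightarrow> x \<oplus>\<^bsub>V\<^esub> y \<in> carrier V"
    "\<And>a x. x \<in> carrier V \<Longrightarrow> a \<odot>\<^bsub>V\<^esub> x \<in> carrier V"
    using assms(1) by (rule has_dim_coordinates) blast
  obtain q f where W: "\<And>x y. x \<in> carrier W \<Longrightarrow> y \<in> carrier W \<Longrightarrow> x \<oplus>\<^bsub>W\<^esub> y \<in> carrier W"
    "\<And>a x. x \<in> carrier W \<Longrightarrow> a \<odot>\<^bsub>W\<^esub> x \<in> carrier W"
    using assms(2) by (rule has_dim_coordinates) blast
  show ?thesis unfolding tensor_rels_def
    by (auto intro!: fun_vs.subspace_diff[OF free_space_subspace] fun_vs.subspace_scale[OF free_space_subspace]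
        basis_vec_free V W)
qed

text \<open>Products of a coordinate on \<open>V\<close> with a coordinate on \<open>W\<close> are
  the dual functionals, and a functional killing the relations is a bilinear map, which is expanded
  in one argument after the other.\<close>

theorem has_dim_tensor:
  fixes V :: "('k::field, 'v) module" and W :: "('k, 'w) module"
  assumes "has_dim V m" and "has_dim W n"
  shows "has_dim (tensor V W) (m * n)"
proof -
  obtain p e where V: "\<And>i. e i \<in> carrier V"
    "\<And>x y. x \<in> carrier V \<Longrightarrow> y \<in> carrier V \<Longrightarrow> x \<oplus>\<^bsub>V\<^esub> y \<in> carrier V"
    "\<And>a x. x \<in> carrier V \<Longrightarrow> a \<odot>\<^bsub>V\<^esub> x \<in> carrier V"
    "\<And>i j. i < m \<Longrightarrow> j < m \<Longrightarrow> p (e j) i = (if j = i then 1 else (0::'k))"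
    "\<And>x y i. x \<in> carrier V \<Longrightarrow> y \<in> carrier V \<Longrightarrow> p (x \<oplus>\<^bsub>V\<^esub> y) i = p x i + p y i"
    "\<And>a x i. x \<in> carrier V \<Longrightarrow> p (a \<odot>\<^bsub>V\<^esub> x) i = a * p x i"
    and V_exp: "\<And>\<beta> x. \<lbrakk>\<And>x y. x \<in> carrier V \<Longrightarrow> y \<in> carrier V \<Longrightarrow> \<beta> (x \<oplus>\<^bsub>V\<^esub> y) = \<beta> x + \<beta> y;
      \<And>a x. x \<in> carrier V \<Longrightarrow> \<beta> (a \<odot>\<^bsub>V\<^esub> x) = a * \<beta> x; x \<in> carrier V\<rbrakk> \<Longrightarrow>
      \<beta> x = (\<Sum>i<m. \<beta> (e i) * p x i)"
    using assms(1) by (rule has_dim_coordinates) blast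
  obtain q f where W: "\<And>i. f i \<in> carrier W"
    "\<And>x y. x \<in> carrier W \<Longrightarrow> y \<in> carrier W \<Longrightarrow> x \<oplus>\<^bsub>W\<^esub> y \<in> carrier W"
    "\<And>a x. x \<in> carrier W \<Longrightarrow> a \<odot>\<^bsub>W\<^esub> x \<in> carrier W"
    "\<And>i j. i < n \<Longrightarrow> j < n \<Longrightarrow> q (f j) i = (if j = i then 1 else (0::'k))"
    "\<And>x y i. x \<in> carrier W \<Longrightarrow> y \<in> carrier W \<Longrightarrow> q (x \<oplus>\<^bsub>W\<^esub> y) i = q x i + q y i"
    "\<And>a x i. x \<in> carrier W \<Longrightarrow> q (a \<odot>\<^bsub>W\<^esub> x) i = a * q x i"
    and W_exp: "\<And>\<beta> x. \<lbrakk>\<And>x y. x \<in> carrier W \<Longrightarrow> y \<in> carrier W \<Longrightarrow> \<beta> (x \<oplus>\<^bsub>W\<^esub> y) = \<beta> x + \<beta> y;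
      \<And>a x. x \<in> carrier W \<Longrightarrow> \<beta> (a \<odot>\<^bsub>W\<^esub> x) = a * \<beta> x; x \<in> carrier W\<rbrakk> \<Longrightarrow>
      \<beta> x = (\<Sum>i<n. \<beta> (f i) * q x i)"
    using assms(2) by (rule has_dim_coordinates) blast
  let ?S = "carrier V \<times> carrier W"
  note free = fun_vs.subspace_diff[OF free_space_subspace[of ?S]] fun_vs.subspace_scale[OF free_space_subspace[of ?S]]
  have ext3: "lin_ext \<beta> (basis_vec x - basis_vec y - basis_vec z) = \<beta> x - \<beta> y - \<beta> z" for \<beta> :: "'v \<times> 'w \<Rightarrow> 'k" and x y z
  proof -
    have b: "basis_vec x \<in> free_space UNIV" for x :: "'v \<times> 'w" by (simp add: basis_vec_free)
    show ?thesis
      unfolding lin_ext_diff[OF fun_vs.subspace_diff[OF free_space_subspace b b] b] lin_ext_diff[OF b b] by simp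
  qed
  have ext2: "lin_ext \<beta> (basis_vec x - fscale a (basis_vec y)) = \<beta> x - a * \<beta> y" for \<beta> :: "'v \<times> 'w \<Rightarrow> 'k" and x y a
  proof -
    have b: "basis_vec x \<in> free_space UNIV" for x :: "'v \<times> 'w" by (simp add: basis_vec_free)
    show ?thesis
      unfolding lin_ext_diff[OF b fun_vs.subspace_scale[OF free_space_subspace b]] lin_ext_fscale[OF b] by simp
  qed
  have "has_dim (presented_space ?S (tensor_rels V W)) (card ({..<m} \<times> {..<n}))"
  proof (rule has_dim_presented[where s = "\<lambda>(i, j). (e i, f j)" and \<delta> = "\<lambda>(i, j) (v, w). p v i * q w j"])
    show "tensor_rels V W \<subseteq> free_space ?S" by (rule tensor_rels_free[OF assms])
    show "lin_ext ((\<lambda>(i, j) (v, w). p v i * q w j) ij) \<rho> = 0" if rho: "\<rho> \<in> tensor_rels V W" for ij \<rho>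
    proof -
      obtain i j where ij: "ij = (i, j)" by (cases ij)
      let ?d = "\<lambda>(v, w). p v i * q w j"
      consider v v' w where "v \<in> carrier V" "v' \<in> carrier V" "w \<in> carrier W"
          "\<rho> = basis_vec (v \<oplus>\<^bsub>V\<^esub> v', w) - basis_vec (v, w) - basis_vec (v', w)"
        | v w w' where "v \<in> carrier V" "w \<in> carrier W" "w' \<in> carrier W"
          "\<rho> = basis_vec (v, w \<oplus>\<^bsub>W\<^esub> w') - basis_vec (v, w) - basis_vec (v, w')"
        | a v w where "v \<in> carrier V" "w \<in> carrier W"
          "\<rho> = basis_vec (a \<odot>\<^bsub>V\<^esub> v, w) - fscale a (basis_vec (v, w))"
        | a v w where "v \<in> carrier V" "w \<in> carrier W"
          "\<rho> = basis_vec (v, a \<odot>\<^bsub>W\<^esub> w) - fscale a (basis_vec (v, w))"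
        using rho unfolding tensor_rels_def by blast
      then have "lin_ext ?d \<rho> = 0"
      proof cases
        case 1
        then show ?thesis by (simp only: ext3 prod.case V(5)) (simp add: distrib_right)
      next
        case 2
        then show ?thesis by (simp only: ext3 prod.case W(5)) (simp add: distrib_left)
      next
        case 3
        then show ?thesis by (simp only: ext2 prod.case V(6)) simp
      next
        case 4
        then show ?thesis by (simp only: ext2 prod.case W(6)) simp
      qed
      then show ?thesis by (simp add: ij)
    qed
    show "\<beta> x = (\<Sum>ij\<in>{..<m} \<times> {..<n}. \<beta> (case ij of (i, j) \<Rightarrow> (e i, f j)) * (case ij of (i, j) \<Rightarrow> \<lambda>(v, w). p v i * q w j) x)"
      if kill: "\<And>\<rho>. \<rho> \<in> tensor_rels V W \<Longrightarrow> lin_ext \<beta> \<rho> = 0" and "x \<in> ?S" for \<beta> x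
    proof -
      obtain v w where x: "x = (v, w)" "v \<in> carrier V" "w \<in> carrier W" using \<open>x \<in> ?S\<close> by auto
      have b1: "\<beta> (v \<oplus>\<^bsub>V\<^esub> v', w) = \<beta> (v, w) + \<beta> (v', w)" if "v \<in> carrier V" "v' \<in> carrier V" "w \<in> carrier W" for v v' w
      proof -
        have "basis_vec (v \<oplus>\<^bsub>V\<^esub> v', w) - basis_vec (v, w) - basis_vec (v', w) \<in> tensor_rels V W"
          using that unfolding tensor_rels_def by blast
        from kill[OF this] show ?thesis unfolding ext3 by (simp add: algebra_simps)
      qed
      have b2: "\<beta> (v, w \<oplus>\<^bsub>W\<^esub> w') = \<beta> (v, w) + \<beta> (v, w')" if "v \<in> carrier V" "w \<in> carrier W" "w' \<in> carrier W" for v w w'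
      proof -
        have "basis_vec (v, w \<oplus>\<^bsub>W\<^esub> w') - basis_vec (v, w) - basis_vec (v, w') \<in> tensor_rels V W"
          using that unfolding tensor_rels_def by blast
        from kill[OF this] show ?thesis unfolding ext3 by (simp add: algebra_simps)
      qed
      have b3: "\<beta> (a \<odot>\<^bsub>V\<^esub> v, w) = a * \<beta> (v, w)" if "v \<in> carrier V" "w \<in> carrier W" for a v w
      proof -
        have "basis_vec (a \<odot>\<^bsub>V\<^esub> v, w) - fscale a (basis_vec (v, w)) \<in> tensor_rels V W"
          using that unfolding tensor_rels_def by blast
        from kill[OF this] show ?thesis unfolding ext2 by simp
      qed
      have b4: "\<beta> (v, a \<odot>\<^bsub>W\<^esub> w) = a * \<beta> (v, w)" if "v \<in> carrier V" "w \<in> carrier W" for a v w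
      proof -
        have "basis_vec (v, a \<odot>\<^bsub>W\<^esub> w) - fscale a (basis_vec (v, w)) \<in> tensor_rels V W"
          using that unfolding tensor_rels_def by blast
        from kill[OF this] show ?thesis unfolding ext2 by simp
      qed
      have Wi: "\<beta> (e i, w) = (\<Sum>j<n. \<beta> (e i, f j) * q w j)" for i
        by (rule W_exp[where \<beta> = "\<lambda>w. \<beta> (e i, w)"]) (use x b2 b4 V(1) in auto)
      have "\<beta> (v, w) = (\<Sum>i<m. \<beta> (e i, w) * p v i)"
        by (rule V_exp[where \<beta> = "\<lambda>v. \<beta> (v, w)"]) (use x b1 b3 in auto)
      also have "\<dots> = (\<Sum>i<m. \<Sum>j<n. \<beta> (e i, f j) * (p v i * q w j))"
        unfolding Wi sum_distrib_right by (intro sum.cong refl) (simp only: mult_ac)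
      also have "\<dots> = (\<Sum>ij\<in>{..<m} \<times> {..<n}. \<beta> (e (fst ij), f (snd ij)) * (p v (fst ij) * q w (snd ij)))"
        by (simp only: sum.cartesian_product case_prod_unfold)
      finally show ?thesis by (simp only: x(1) case_prod_unfold prod.sel)
    qed
  qed (auto simp: V W split: if_splits)
  then show ?thesis by (simp add: tensor_def)
qed

theorem has_dim_direct_sum:
  fixes V :: "int \<Rightarrow> ('k::field, 'v) module"
  assumes "\<And>p. has_dim (V p) (n p)" and "finite P" and "\<And>p. p \<notin> P \<Longrightarrow> n p = 0"
    and zero: "\<And>p. \<zero>\<^bsub>V p\<^esub> \<in> carrier (V p)"
  shows "has_dim (direct_sum V) (\<Sum>p\<in>P. n p)"
proof -
  have "\<forall>p. \<exists>f. bij_betw f (coord_space (n p)) (carrier (V p)) \<and>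
    (\<forall>x\<in>coord_space (n p). \<forall>y\<in>coord_space (n p). f (x + y) = f x \<oplus>\<^bsub>V p\<^esub> f y) \<and>
    (\<forall>a. \<forall>x\<in>coord_space (n p). f (fscale a x) = a \<odot>\<^bsub>V p\<^esub> f x)"
    using assms(1) unfolding has_dim_def module_iso_def subspace_module_def by auto
  then obtain f where f: "\<And>p. bij_betw (f p) (coord_space (n p)) (carrier (V p))"
    and f_add: "\<And>p x y. x \<in> coord_space (n p) \<Longrightarrow> y \<in> coord_space (n p) \<Longrightarrow> f p (x + y) = f p x \<oplus>\<^bsub>V p\<^esub> f p y"
    and f_smult: "\<And>p a x. x \<in> coord_space (n p) \<Longrightarrow> f p (fscale a x) = a \<odot>\<^bsub>V p\<^esub> f p x"
    by metis
  let ?J = "SIGMA p:P. {..<n p}"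
  define F where "F x p = f p (\<lambda>i. x (p, i))" for x :: "int \<times> nat \<Rightarrow> 'k" and p
  have coord: "(\<lambda>i. x (p, i)) \<in> coord_space (n p)" if "\<forall>j. j \<notin> ?J \<longrightarrow> x j = 0" for x :: "int \<times> nat \<Rightarrow> 'k" and p
    using that by (auto simp: coord_space_def)
  \<comment> \<open>Outside \<open>P\<close> the carrier is a single point, and \<open>zero\<close>
    identifies it with the zero element; hence every family built from coordinates has finite
    support.\<close>
  have triv: "x = \<zero>\<^bsub>V p\<^esub>" if "x \<in> carrier (V p)" "p \<notin> P" for x p
  proof -
    have "coord_space (n p) = {0 :: nat \<Rightarrow> 'k}" using assms(3)[OF that(2)] by (auto simp: coord_space_def)
    then have "carrier (V p) = {f p 0}" using f[of p] by (auto simp: bij_betw_def)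
    then show ?thesis using zero[of p] that by auto
  qed
  have "has_dim (direct_sum V) (card ?J)"
  proof (rule has_dim_index[where f = F])
    show "bij_betw F {x. \<forall>j. j \<notin> ?J \<longrightarrow> x j = 0} (carrier (direct_sum V))"
      unfolding bij_betw_def
    proof
      show "inj_on F {x. \<forall>j. j \<notin> ?J \<longrightarrow> x j = 0}"
      proof (rule inj_onI)
        fix x y assume xy: "x \<in> {x. \<forall>j. j \<notin> ?J \<longrightarrow> x j = 0}" "y \<in> {x. \<forall>j. j \<notin> ?J \<longrightarrow> x j = 0}" "F x = F y"
        have "(\<lambda>i. x (p, i)) = (\<lambda>i. y (p, i))" for p
        proof (rule inj_onD[of "f p" "coord_space (n p)"])
          show "inj_on (f p) (coord_space (n p))" using f[of p] by (simp add: bij_betw_def)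
          show "f p (\<lambda>i. x (p, i)) = f p (\<lambda>i. y (p, i))" using fun_cong[OF xy(3), of p] by (simp add: F_def)
        qed (use xy coord in auto)
        then have "x (p, i) = y (p, i)" for p i by (meson fun_cong)
        then show "x = y" by (simp add: fun_eq_iff)
      qed
      show "F ` {x. \<forall>j. j \<notin> ?J \<longrightarrow> x j = 0} = carrier (direct_sum V)"
      proof
        show "F ` {x. \<forall>j. j \<notin> ?J \<longrightarrow> x j = 0} \<subseteq> carrier (direct_sum V)"
        proof
          fix g assume "g \<in> F ` {x. \<forall>j. j \<notin> ?J \<longrightarrow> x j = 0}"
          then obtain x where x: "\<forall>j. j \<notin> ?J \<longrightarrow> x j = 0" "g = F x" by auto
          have g: "g p \<in> carrier (V p)" for p
            using f[of p] coord[OF x(1), of p] by (auto simp: bij_betw_def x F_def)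
          then have "{p. g p \<noteq> \<zero>\<^bsub>V p\<^esub>} \<subseteq> P" using triv by blast
          with g show "g \<in> carrier (direct_sum V)"
            using assms(2) by (auto simp: direct_sum_def dest: finite_subset)
        qed
        show "carrier (direct_sum V) \<subseteq> F ` {x. \<forall>j. j \<notin> ?J \<longrightarrow> x j = 0}"
        proof
          fix g assume "g \<in> carrier (direct_sum V)"
          then have g: "g p \<in> carrier (V p)" for p by (simp add: direct_sum_def)
          then have "\<forall>p. \<exists>x\<in>coord_space (n p). g p = f p x"
            using f by (auto simp: bij_betw_def image_iff set_eq_iff)
          then obtain x where x: "\<And>p. x p \<in> coord_space (n p)" "\<And>p. g p = f p (x p)" by metis
          have "\<forall>j. j \<notin> ?J \<longrightarrow> (\<lambda>(p, i). x p i) j = 0"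
            using x(1) assms(3) unfolding coord_space_def
            by (auto simp: not_less)
          moreover have "g = F (\<lambda>(p, i). x p i)" by (rule ext) (simp add: F_def x)
          ultimately show "g \<in> F ` {x. \<forall>j. j \<notin> ?J \<longrightarrow> x j = 0}" by blast
        qed
      qed
    qed
    show "F (x + y) = F x \<oplus>\<^bsub>direct_sum V\<^esub> F y" if "\<forall>j. j \<notin> ?J \<longrightarrow> x j = 0" "\<forall>j. j \<notin> ?J \<longrightarrow> y j = 0" for x y
    proof
      fix p
      have "(\<lambda>i. (x + y) (p, i)) = (\<lambda>i. x (p, i)) + (\<lambda>i. y (p, i))" by (simp add: fun_eq_iff)
      then show "F (x + y) p = (F x \<oplus>\<^bsub>direct_sum V\<^esub> F y) p"
        unfolding F_def direct_sum_def using coord[OF that(1), of p] coord[OF that(2), of p] by (simp add: f_add)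
    qed
    show "F (fscale a x) = a \<odot>\<^bsub>direct_sum V\<^esub> F x" if "\<forall>j. j \<notin> ?J \<longrightarrow> x j = 0" for a x
    proof
      fix p
      have "(\<lambda>i. fscale a x (p, i)) = fscale a (\<lambda>i. x (p, i))" by (simp add: fscale_def)
      then show "F (fscale a x) p = (a \<odot>\<^bsub>direct_sum V\<^esub> F x) p"
        unfolding F_def direct_sum_def using coord[OF that(1), of p] by (simp add: f_smult)
    qed
  qed (use assms(2) in auto)
  then show ?thesis using assms(2) by (simp add: card_SigmaI)
qed

section \<open>Alternating maps and dual bases\<close>

text \<open>The interior product with \<open>x\<close>. Since arguments come as a list, filling the
  first slot is the step by which the operators on forms recurse.\<close>

definition contract :: "'v \<Rightarrow> ('v list \<Rightarrow> 'w) \<Rightarrow> 'v list \<Rightarrow> 'w"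
  where "contract x \<omega> = (\<lambda>xs. \<omega> (x # xs))"

lemma contract_apply [simp]: "contract x \<omega> xs = \<omega> (x # xs)"
  by (simp add: contract_def)

lemma contract_add: "contract x (\<omega> + \<eta>) = contract x \<omega> + contract x \<eta>"
  and contract_diff: "contract x (\<omega>1 - \<eta>1) = contract x \<omega>1 - contract x \<eta>1"
  and contract_0 [simp]: "contract x 0 = 0"
  for \<omega> \<eta> :: "'v list \<Rightarrow> 'w::monoid_add" and \<omega>1 \<eta>1 :: "'v list \<Rightarrow> 'u::group_add"
  by (simp_all add: fun_eq_iff)

lemma tuples_int: "xs \<in> tuples A (int n) \<longleftrightarrow> length xs = n \<and> set xs \<subseteq> A"
  by (auto simp: tuples_def)

locale alternating = dom: vector_space sL + cod: vector_space sM
  for sL :: "'k::field \<Rightarrow> 'v::ab_group_add \<Rightarrow> 'v" and sM :: "'k \<Rightarrow> 'w::ab_group_add \<Rightarrow> 'w" +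
  fixes L :: "'v set" and M :: "'w set"
  assumes subL: "dom.subspace L" and subM: "cod.subspace M"
begin

definition fsc :: "'k \<Rightarrow> ('v list \<Rightarrow> 'w) \<Rightarrow> 'v list \<Rightarrow> 'w"
  where "fsc a \<omega> = (\<lambda>xs. sM a (\<omega> xs))"

lemma fsc_apply [simp]: "fsc a \<omega> xs = sM a (\<omega> xs)"
  by (simp add: fsc_def)

lemma contract_fsc: "contract x (fsc a \<omega>) = fsc a (contract x \<omega>)"
  by (simp add: fun_eq_iff)

sublocale fn: scaled_space fsc
  by unfold_locales (auto simp: fun_eq_iff cod.scale_right_distrib cod.scale_left_distrib)

text \<open>Alternating n-linear maps by recursion on the degree. Linearity is imposed on the first
  slot and vanishing on two equal leading entries; contraction carries both to the other slots, and
  induction on the degree replaces bookkeeping with positions.\<close>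

primrec alt :: "nat \<Rightarrow> ('v list \<Rightarrow> 'w) \<Rightarrow> bool" where
  "alt 0 \<omega> = (\<omega> [] \<in> M \<and> (\<forall>x xs. \<omega> (x # xs) = 0))"
| "alt (Suc n) \<omega> = (\<omega> [] = 0 \<and> (\<forall>x xs. x \<notin> L \<longrightarrow> \<omega> (x # xs) = 0) \<and> (\<forall>x\<in>L. alt n (contract x \<omega>)) \<and>
    (\<forall>x\<in>L. \<forall>y\<in>L. \<forall>xs. \<omega> ((x + y) # xs) = \<omega> (x # xs) + \<omega> (y # xs)) \<and>
    (\<forall>a. \<forall>x\<in>L. \<forall>xs. \<omega> (sL a x # xs) = sM a (\<omega> (x # xs))) \<and>
    (\<forall>x\<in>L. \<forall>xs. \<omega> (x # x # xs) = 0))"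

lemma alt_contract: "alt (Suc n) \<omega> \<Longrightarrow> x \<in> L \<Longrightarrow> alt n (contract x \<omega>)"
  unfolding alt.simps by blast

lemma alt_SucI:
  assumes "\<omega> [] = 0" and "\<And>x xs. x \<notin> L \<Longrightarrow> \<omega> (x # xs) = 0"
    and "\<And>x. x \<in> L \<Longrightarrow> alt n (contract x \<omega>)"
    and "\<And>x y xs. x \<in> L \<Longrightarrow> y \<in> L \<Longrightarrow> \<omega> ((x + y) # xs) = \<omega> (x # xs) + \<omega> (y # xs)"
    and "\<And>a x xs. x \<in> L \<Longrightarrow> \<omega> (sL a x # xs) = sM a (\<omega> (x # xs))"
    and "\<And>x xs. x \<in> L \<Longrightarrow> \<omega> (x # x # xs) = 0"
  shows "alt (Suc n) \<omega>"
  using assms unfolding alt.simps by blast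

lemma alt_SucD:
  assumes "alt (Suc n) \<omega>"
  shows "\<omega> [] = 0" and "x \<notin> L \<Longrightarrow> \<omega> (x # xs) = 0"
    and "x \<in> L \<Longrightarrow> y \<in> L \<Longrightarrow> \<omega> ((x + y) # xs) = \<omega> (x # xs) + \<omega> (y # xs)"
    and "x \<in> L \<Longrightarrow> \<omega> (sL a x # xs) = sM a (\<omega> (x # xs))"
    and "x \<in> L \<Longrightarrow> \<omega> (x # x # xs) = 0"
  using assms unfolding alt.simps by blast+

lemma alt_0: "alt n 0"
proof (induction n)
  case 0
  then show ?case using cod.subspace_0[OF subM] by simp
next
  case (Suc n)
  show ?case by (rule alt_SucI) (simp_all add: Suc del: zero_fun_apply, simp_all)
qed

lemma alt_add: "alt n \<omega> \<Longrightarrow> alt n \<eta> \<Longrightarrow> alt n (\<omega> + \<eta>)"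
proof (induction n arbitrary: \<omega> \<eta>)
  case 0
  then show ?case using cod.subspace_add[OF subM] by simp
next
  case (Suc n)
  note D = alt_SucD[OF Suc.prems(1)] alt_SucD[OF Suc.prems(2)]
  show ?case
  proof (rule alt_SucI)
    show "alt n (contract x (\<omega> + \<eta>))" if "x \<in> L" for x
      unfolding contract_add using alt_contract Suc.prems that by (intro Suc.IH) blast+
  qed (simp_all add: D cod.scale_right_distrib)
qed

lemma alt_fsc: "alt n \<omega> \<Longrightarrow> alt n (fsc a \<omega>)"
proof (induction n arbitrary: \<omega>)
  case 0
  then show ?case using cod.subspace_scale[OF subM] by simp
next
  case (Suc n)
  note D = alt_SucD[OF Suc.prems]
  show ?case
  proof (rule alt_SucI)
    show "alt n (contract x (fsc a \<omega>))" if "x \<in> L" for x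
      unfolding contract_fsc using alt_contract Suc.prems that by (intro Suc.IH) blast+
  qed (simp_all add: D cod.scale_right_distrib cod.scale_left_commute)
qed

lemma alt_subspace: "fn.subspace {\<omega>. alt n \<omega>}"
  by (rule fn.subspaceI) (auto simp: alt_0 alt_add alt_fsc simp del: plus_fun_apply)

lemma alt_diff: "alt n \<omega> \<Longrightarrow> alt n \<eta> \<Longrightarrow> alt n (\<omega> - \<eta>)"
  using fn.subspace_diff[OF alt_subspace[of n], of \<omega> \<eta>] by simp

lemma alt_first_add: "alt (Suc n) \<omega> \<Longrightarrow> x \<in> L \<Longrightarrow> y \<in> L \<Longrightarrow> \<omega> ((x + y) # xs) = \<omega> (x # xs) + \<omega> (y # xs)"
  and alt_first_scale: "alt (Suc n) \<omega> \<Longrightarrow> x \<in> L \<Longrightarrow> \<omega> (sL a x # xs) = sM a (\<omega> (x # xs))"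
  and alt_twice: "alt n \<omega> \<Longrightarrow> x \<in> L \<Longrightarrow> \<omega> (x # x # xs) = 0"
  and alt_outside: "alt n \<omega> \<Longrightarrow> x \<notin> L \<Longrightarrow> \<omega> (x # xs) = 0"
  and alt_zero_cons: "alt 0 \<omega> \<Longrightarrow> \<omega> (x # xs) = 0"
  by (cases n; simp)+

lemma alt_first_sum:
  assumes "alt (Suc n) \<omega>" and "finite A" and "\<And>b. b \<in> A \<Longrightarrow> v b \<in> L"
  shows "\<omega> ((\<Sum>b\<in>A. sL (c b) (v b)) # xs) = (\<Sum>b\<in>A. sM (c b) (\<omega> (v b # xs)))"
  using assms(2,3)
proof (induction A)
  case empty
  then show ?case
    using alt_first_scale[OF assms(1), of 0 0 xs] dom.subspace_0[OF subL] by simp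
next
  case (insert b A)
  have "(\<Sum>b\<in>A. sL (c b) (v b)) \<in> L"
    using insert by (intro dom.subspace_sum[OF subL] dom.subspace_scale[OF subL]) auto
  then show ?case
    using insert alt_first_add[OF assms(1), of "sL (c b) (v b)" "\<Sum>b\<in>A. sL (c b) (v b)" xs]
    by (simp add: alt_first_scale[OF assms(1)] dom.subspace_scale[OF subL])
qed

text \<open>Polarisation: expand the vanishing value at two leading entries \<open>x + y\<close>. No
  division by 2 occurs, so characteristic 2 is covered.\<close>

lemma alt_swap:
  assumes "alt n \<omega>" and "x \<in> L" and "y \<in> L"
  shows "\<omega> (x # y # xs) = - \<omega> (y # x # xs)"
proof (cases n)
  case 0
  then show ?thesis using assms by simp
next
  case n: (Suc m)
  show ?thesis
  proof (cases m)
    case 0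
    \<comment> \<open>A form of degree 1 contracts to degree 0, and such a form vanishes on nonempty
      lists.\<close>
    have "contract x \<omega> (y # xs) = 0" "contract y \<omega> (x # xs) = 0"
      using alt_zero_cons alt_contract assms n 0 by blast+
    then show ?thesis by simp
  next
    case (Suc k)
    have c: "alt (Suc k) (contract z \<omega>)" if "z \<in> L" for z
      using alt_contract[of m \<omega> z] assms(1) n Suc that by simp
    have xy: "x + y \<in> L" using assms dom.subspace_add[OF subL] by blast
    have w: "alt (Suc m) \<omega>" using assms(1) n by simp
    have sec: "\<omega> (z # (x + y) # xs) = \<omega> (z # x # xs) + \<omega> (z # y # xs)" if "z \<in> L" for z
      using alt_first_add[OF c[OF that] assms(2,3), of xs] by simp
    have "0 = \<omega> ((x + y) # (x + y) # xs)" using alt_twice[OF w xy] by simp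
    also have "\<dots> = \<omega> (x # (x + y) # xs) + \<omega> (y # (x + y) # xs)"
      by (rule alt_first_add[OF w assms(2,3)])
    also have "\<dots> = \<omega> (x # y # xs) + \<omega> (y # x # xs)"
      unfolding sec[OF assms(2)] sec[OF assms(3)] alt_twice[OF w assms(2)] alt_twice[OF w assms(3)] by simp
    finally show ?thesis by (simp add: eq_neg_iff_add_eq_0)
  qed
qed

text \<open>An entry \<open>y\<close> standing between the two copies of \<open>x\<close> is swapped
  to the front and contracted away, which brings them closer.\<close>

lemma alt_repeated:
  assumes "alt n \<omega>" and "x \<in> L" and "x \<in> set xs"
  shows "\<omega> (x # xs) = 0"
  using assms(1,3)
proof (induction n arbitrary: \<omega> xs)
  case 0
  then show ?case by simp
next
  case (Suc n)
  show ?case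
  proof (cases xs)
    case (Cons y ys)
    consider "y = x" | "y \<notin> L" | "y \<in> L" "x \<in> set ys" using Suc.prems Cons by auto
    then show ?thesis
    proof cases
      case 1
      then show ?thesis using alt_twice[OF Suc.prems(1) assms(2)] Cons by simp
    next
      case 2
      have "contract x \<omega> (y # ys) = 0"
        using alt_outside alt_contract[OF Suc.prems(1) assms(2)] 2 by blast
      then show ?thesis using Cons by simp
    next
      case 3
      have "contract y \<omega> (x # ys) = 0"
        using Suc.IH[OF alt_contract[OF Suc.prems(1) 3(1)] 3(2)] .
      then show ?thesis using alt_swap[OF Suc.prems(1) assms(2) 3(1)] Cons by simp
    qed
  qed (use Suc.prems in simp)
qed

lemma alt_support: "alt n \<omega> \<Longrightarrow> \<not> (length xs = n \<and> set xs \<subseteq> L) \<Longrightarrow> \<omega> xs = 0"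
proof (induction n arbitrary: \<omega> xs)
  case 0
  then show ?case by (cases xs) auto
next
  case (Suc n)
  show ?case
  proof (cases xs)
    case (Cons x ys)
    show ?thesis
    proof (cases "x \<in> L")
      case True
      then have "contract x \<omega> ys = 0" using Suc Cons by (intro Suc.IH alt_contract) auto
      then show ?thesis using Cons by simp
    qed (use Suc.prems Cons in simp)
  qed (use Suc.prems in simp)
qed

lemma alt_closed: "alt n \<omega> \<Longrightarrow> \<omega> xs \<in> M"
proof (induction n arbitrary: \<omega> xs)
  case 0
  then show ?case using cod.subspace_0[OF subM] by (cases xs) auto
next
  case (Suc n)
  show ?case
  proof (cases xs)
    case (Cons x ys)
    show ?thesis
    proof (cases "x \<in> L")
      case True
      then have "contract x \<omega> ys \<in> M" using Suc by (intro Suc.IH alt_contract) auto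
      then show ?thesis using Cons by simp
    qed (use Suc.prems Cons cod.subspace_0[OF subM] in simp)
  qed (use Suc.prems cod.subspace_0[OF subM] in simp)
qed

section \<open>Alternating maps and Chevalley-Eilenberg cochains\<close>

lemma alt_update_add:
  assumes "alt n \<omega>" and "set xs \<subseteq> L" and "i < length xs" and "x \<in> L" and "y \<in> L" and "length xs = n"
  shows "\<omega> (xs[i := x + y]) = \<omega> (xs[i := x]) + \<omega> (xs[i := y])"
  using assms
proof (induction n arbitrary: \<omega> xs i)
  case (Suc n)
  obtain z zs where xs: "xs = z # zs" using Suc.prems by (cases xs) auto
  show ?case
  proof (cases i)
    case 0
    then show ?thesis using Suc.prems xs by simp
  next
    case (Suc j)
    have "contract z \<omega> (zs[j := x + y]) = contract z \<omega> (zs[j := x]) + contract z \<omega> (zs[j := y])"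
      using Suc.prems xs \<open>i = Suc j\<close> by (intro Suc.IH alt_contract) auto
    then show ?thesis using xs Suc by simp
  qed
qed simp

lemma alt_update_scale:
  assumes "alt n \<omega>" and "set xs \<subseteq> L" and "i < length xs" and "x \<in> L" and "length xs = n"
  shows "\<omega> (xs[i := sL a x]) = sM a (\<omega> (xs[i := x]))"
  using assms
proof (induction n arbitrary: \<omega> xs i)
  case (Suc n)
  obtain z zs where xs: "xs = z # zs" using Suc.prems by (cases xs) auto
  show ?case
  proof (cases i)
    case 0
    then show ?thesis using Suc.prems xs by simp
  next
    case (Suc j)
    have "contract z \<omega> (zs[j := sL a x]) = sM a (contract z \<omega> (zs[j := x]))"
      using Suc.prems xs \<open>i = Suc j\<close> by (intro Suc.IH alt_contract) auto
    then show ?thesis using xs Suc by simp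
  qed
qed simp

lemma alt_not_distinct:
  assumes "alt n \<omega>" and "\<not> distinct xs"
  shows "\<omega> xs = 0"
  using assms
proof (induction n arbitrary: \<omega> xs)
  case 0
  then show ?case by (cases xs) auto
next
  case (Suc n)
  obtain z zs where xs: "xs = z # zs" using Suc.prems by (cases xs) auto
  show ?case
  proof (cases "z \<in> L")
    case z: True
    show ?thesis
    proof (cases "z \<in> set zs")
      case True
      then show ?thesis using alt_repeated[OF Suc.prems(1) z] xs by simp
    next
      case False
      then have "contract z \<omega> zs = 0"
        using Suc.prems xs z by (intro Suc.IH alt_contract) auto
      then show ?thesis using xs by simp
    qed
  qed (use Suc.prems xs in simp)
qed

text \<open>Contraction lowers the degree of a cochain by one: the conditions at later positions
  feed the induction, and those at position 0 give the clauses of \<open>alt\<close>.\<close>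

lemma ce_cochains_imp_alt: "\<omega> \<in> ce_cochains sL L sM M (int n) \<Longrightarrow> alt n \<omega>"
proof (induction n arbitrary: \<omega>)
  case 0
  have t: "xs \<in> tuples L 0 \<longleftrightarrow> xs = []" for xs by (auto simp: tuples_def)
  from 0 show ?case unfolding ce_cochains_def by (simp add: t)
next
  case (Suc n)
  have M: "\<And>xs. length xs = Suc n \<Longrightarrow> set xs \<subseteq> L \<Longrightarrow> \<omega> xs \<in> M"
    and out: "\<And>xs. \<not> (length xs = Suc n \<and> set xs \<subseteq> L) \<Longrightarrow> \<omega> xs = 0"
    and add: "\<And>xs i x y. \<lbrakk>length xs = Suc n; set xs \<subseteq> L; i < length xs; x \<in> L; y \<in> L\<rbrakk> \<Longrightarrow>
      \<omega> (xs[i := x + y]) = \<omega> (xs[i := x]) + \<omega> (xs[i := y])"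
    and scale: "\<And>xs i a x. \<lbrakk>length xs = Suc n; set xs \<subseteq> L; i < length xs; x \<in> L\<rbrakk> \<Longrightarrow>
      \<omega> (xs[i := sL a x]) = sM a (\<omega> (xs[i := x]))"
    and dist: "\<And>xs. length xs = Suc n \<Longrightarrow> set xs \<subseteq> L \<Longrightarrow> \<not> distinct xs \<Longrightarrow> \<omega> xs = 0"
    using Suc.prems unfolding ce_cochains_def mem_Collect_eq Ball_def tuples_int by (elim conjE; simp)+
  have c: "contract x \<omega> \<in> ce_cochains sL L sM M (int n)" if x: "x \<in> L" for x
    unfolding ce_cochains_def mem_Collect_eq
  proof (intro conjI ballI allI impI)
    show "contract x \<omega> xs \<in> M" if "xs \<in> tuples L (int n)" for xs
      using M[of "x # xs"] x that by (simp add: tuples_int)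
    show "contract x \<omega> xs = 0" if "xs \<notin> tuples L (int n)" for xs
      using out[of "x # xs"] x that by (auto simp: tuples_int)
    show "contract x \<omega> (xs[i := y + z]) = contract x \<omega> (xs[i := y]) + contract x \<omega> (xs[i := z])"
      if "xs \<in> tuples L (int n)" "i < length xs" "y \<in> L" "z \<in> L" for xs i y z
      using add[of "x # xs" "Suc i" y z] x that by (simp add: tuples_int)
    show "contract x \<omega> (xs[i := sL a y]) = sM a (contract x \<omega> (xs[i := y]))"
      if "xs \<in> tuples L (int n)" "i < length xs" "y \<in> L" for xs i a y
      using scale[of "x # xs" "Suc i" y a] x that by (simp add: tuples_int)
    show "contract x \<omega> xs = 0" if "xs \<in> tuples L (int n)" "\<not> distinct xs" for xs
      using dist[of "x # xs"] x that by (simp add: tuples_int)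
  qed
  show ?case
  proof (rule alt_SucI)
    show "alt n (contract x \<omega>)" if "x \<in> L" for x by (rule Suc.IH[OF c[OF that]])
    show "\<omega> [] = 0" by (rule out) simp
    show "\<omega> (x # xs) = 0" if "x \<notin> L" for x xs by (rule out) (use that in simp)
    show "\<omega> ((x + y) # xs) = \<omega> (x # xs) + \<omega> (y # xs)" if "x \<in> L" "y \<in> L" for x y xs
    proof (cases "length xs = n \<and> set xs \<subseteq> L")
      case True
      then show ?thesis using add[of "x # xs" 0 x y] that by simp
    next
      case False
      then show ?thesis using out[of "(x + y) # xs"] out[of "x # xs"] out[of "y # xs"] by auto
    qed
    show "\<omega> (sL a x # xs) = sM a (\<omega> (x # xs))" if "x \<in> L" for a x xs
    proof (cases "length xs = n \<and> set xs \<subseteq> L")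
      case True
      then show ?thesis using scale[of "x # xs" 0 x a] that by simp
    next
      case False
      then have "\<omega> (sL a x # xs) = 0" "\<omega> (x # xs) = 0" by (intro out; force)+
      then show ?thesis by simp
    qed
    show "\<omega> (x # x # xs) = 0" if "x \<in> L" for x xs
    proof (cases "length (x # x # xs) = Suc n \<and> set (x # x # xs) \<subseteq> L")
      case True
      then show ?thesis by (intro dist) auto
    next
      case False
      then show ?thesis by (rule out)
    qed
  qed
qed

lemma ce_cochains_eq: "ce_cochains sL L sM M (int n) = {\<omega>. alt n \<omega>}"
proof (intro equalityI subsetI)
  fix \<omega> assume "\<omega> \<in> {\<omega>. alt n \<omega>}"
  then have w: "alt n \<omega>" by simp
  then show "\<omega> \<in> ce_cochains sL L sM M (int n)"
    unfolding ce_cochains_def mem_Collect_eq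
    by (intro conjI ballI allI impI)
      (simp_all add: tuples_int alt_closed[OF w] alt_support[OF w] alt_update_add[OF w] alt_update_scale[OF w] alt_not_distinct[OF w])
qed (simp add: ce_cochains_imp_alt)

lemma ce_cochains_neg: "n < 0 \<Longrightarrow> ce_cochains sL L sM M n = {0}"
  unfolding ce_cochains_def tuples_def by (auto simp: fun_eq_iff)

text \<open>Exterior multiplication by a 1-form, defined by the antiderivation rule \<iota>_x
  (\<theta> \<and> \<omega>) = \<theta>(x) \<omega> - \<theta> \<and> \<iota>_x \<omega>. No
  factorials appear, so it makes sense in every characteristic.\<close>

primrec wedge :: "('v \<Rightarrow> 'k) \<Rightarrow> ('v list \<Rightarrow> 'w) \<Rightarrow> 'v list \<Rightarrow> 'w" where
  "wedge \<theta> \<omega> [] = 0"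
| "wedge \<theta> \<omega> (x # xs) = (if x \<in> L then sM (\<theta> x) (\<omega> xs) - wedge \<theta> (contract x \<omega>) xs else 0)"

lemma contract_wedge: "x \<in> L \<Longrightarrow> contract x (wedge \<theta> \<omega>) = fsc (\<theta> x) \<omega> - wedge \<theta> (contract x \<omega>)"
  by (simp add: fun_eq_iff)

lemma wedge_add: "wedge \<theta> (\<omega> + \<eta>) = wedge \<theta> \<omega> + wedge \<theta> \<eta>"
proof
  fix xs show "wedge \<theta> (\<omega> + \<eta>) xs = (wedge \<theta> \<omega> + wedge \<theta> \<eta>) xs"
    by (induction xs arbitrary: \<omega> \<eta>) (simp_all add: contract_add cod.scale_right_distrib)
qed

lemma wedge_fsc: "wedge \<theta> (fsc a \<omega>) = fsc a (wedge \<theta> \<omega>)"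
proof
  fix xs show "wedge \<theta> (fsc a \<omega>) xs = fsc a (wedge \<theta> \<omega>) xs"
    by (induction xs arbitrary: \<omega>) (simp_all add: contract_fsc cod.scale_right_diff_distrib cod.scale_left_commute)
qed

lemma wedge_0 [simp]: "wedge \<theta> 0 = 0"
proof -
  have "wedge \<theta> 0 + wedge \<theta> 0 = wedge \<theta> 0" unfolding wedge_add[symmetric] by (simp only: add_0_left)
  then show ?thesis by (simp only: add_cancel_left_right)
qed

lemma wedge_diff: "wedge \<theta> (\<omega> - \<eta>) = wedge \<theta> \<omega> - wedge \<theta> \<eta>"
proof -
  have "wedge \<theta> (\<omega> - \<eta>) + wedge \<theta> \<eta> = wedge \<theta> \<omega>"
    unfolding wedge_add[symmetric] by (simp only: diff_add_cancel)
  then show ?thesis by (simp only: eq_diff_eq)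
qed

lemma wedge_sum: "wedge \<theta> (\<Sum>i\<in>A. f i) = (\<Sum>i\<in>A. wedge \<theta> (f i))"
  by (induction A rule: infinite_finite_induct) (simp_all add: wedge_add del: plus_fun_apply zero_fun_apply)

lemma contract_first_add: "alt (Suc n) \<omega> \<Longrightarrow> x \<in> L \<Longrightarrow> y \<in> L \<Longrightarrow> contract (x + y) \<omega> = contract x \<omega> + contract y \<omega>"
  by (rule ext) (simp add: alt_first_add)

lemma contract_first_scale: "alt (Suc n) \<omega> \<Longrightarrow> x \<in> L \<Longrightarrow> contract (sL a x) \<omega> = fsc a (contract x \<omega>)"
  by (rule ext) (simp add: alt_first_scale)

lemma contract_twice: "alt n \<omega> \<Longrightarrow> x \<in> L \<Longrightarrow> contract x (contract x \<omega>) = 0"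
  by (rule ext) (simp add: alt_twice)

lemma contract_alt_0: "alt 0 \<omega> \<Longrightarrow> contract x \<omega> = 0"
  by (rule ext) (simp add: alt_zero_cons)

lemma contract_contract:
  "alt n \<omega> \<Longrightarrow> x \<in> L \<Longrightarrow> y \<in> L \<Longrightarrow> contract x (contract y \<omega>) = - contract y (contract x \<omega>)"
  by (rule ext) (simp add: alt_swap[of n \<omega> y x])

definition functional :: "('v \<Rightarrow> 'k) \<Rightarrow> bool"
  where "functional \<theta> \<longleftrightarrow> (\<forall>x\<in>L. \<forall>y\<in>L. \<theta> (x + y) = \<theta> x + \<theta> y) \<and> (\<forall>a. \<forall>x\<in>L. \<theta> (sL a x) = a * \<theta> x)"

lemma alt_wedge:
  assumes "functional \<theta>"
  shows "alt n \<omega> \<Longrightarrow> alt (Suc n) (wedge \<theta> \<omega>)"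
proof (induction n arbitrary: \<omega>)
  case 0
  have "alt 0 (contract x (wedge \<theta> \<omega>))" if "x \<in> L" for x
    unfolding contract_wedge[OF that] contract_alt_0[OF 0] using alt_fsc[OF 0] by simp
  moreover have "\<omega> (x # xs) = 0" for x xs using 0 by simp
  ultimately show ?case using assms unfolding functional_def
    by (auto simp: dom.subspace_add[OF subL] dom.subspace_scale[OF subL] contract_alt_0[OF 0] cod.scale_left_distrib)
next
  case (Suc n)
  have w: "alt (Suc n) \<omega>" by fact
  show ?case
  proof (rule alt_SucI)
    show "alt (Suc n) (contract x (wedge \<theta> \<omega>))" if "x \<in> L" for x
      unfolding contract_wedge[OF that] by (intro alt_diff alt_fsc w Suc.IH alt_contract[OF w that])
    show "wedge \<theta> \<omega> ((x + y) # xs) = wedge \<theta> \<omega> (x # xs) + wedge \<theta> \<omega> (y # xs)" if "x \<in> L" "y \<in> L" for x y xs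
      using that assms unfolding functional_def
      by (simp add: dom.subspace_add[OF subL] contract_first_add[OF w] wedge_add cod.scale_left_distrib)
    show "wedge \<theta> \<omega> (sL a x # xs) = sM a (wedge \<theta> \<omega> (x # xs))" if "x \<in> L" for a x xs
      using that assms unfolding functional_def
      by (simp add: dom.subspace_scale[OF subL] contract_first_scale[OF w] wedge_fsc cod.scale_right_diff_distrib)
    show "wedge \<theta> \<omega> (x # x # xs) = 0" if "x \<in> L" for x xs
      using that contract_twice[OF w that] by simp
  qed simp_all
qed

lemma wedge_vanishing_functional: "(\<And>x. x \<in> set xs \<Longrightarrow> \<theta> x = 0) \<Longrightarrow> wedge \<theta> \<omega> xs = 0"
  by (induction xs arbitrary: \<omega>) auto

lemma wedge_vanishing_form: "(\<And>ys. set ys \<subseteq> set xs \<Longrightarrow> \<omega> ys = 0) \<Longrightarrow> wedge \<theta> \<omega> xs = 0"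
proof (induction xs arbitrary: \<omega>)
  case (Cons x xs)
  have "\<omega> xs = 0" by (rule Cons.prems) auto
  moreover have "wedge \<theta> (contract x \<omega>) xs = 0"
  proof (rule Cons.IH)
    show "contract x \<omega> ys = 0" if "set ys \<subseteq> set xs" for ys
      unfolding contract_apply by (rule Cons.prems) (use that in auto)
  qed
  ultimately show ?case by simp
qed simp

end

section \<open>Increasing multi-indices and exterior monomials\<close>

definition subseqs_of_length :: "'b list \<Rightarrow> nat \<Rightarrow> 'b list set"
  where "subseqs_of_length bs n = {ss \<in> set (subseqs bs). length ss = n}"

lemma subseqs_of_length_subset: "ss \<in> subseqs_of_length bs n \<Longrightarrow> set ss \<subseteq> set bs"
  using subseqs_powset[of bs] by (auto simp: subseqs_of_length_def)

lemma subseqs_of_length_distinct: "distinct bs \<Longrightarrow> ss \<in> subseqs_of_length bs n \<Longrightarrow> distinct ss"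
  by (auto simp: subseqs_of_length_def intro: subseqs_distinctD)

lemma finite_subseqs_of_length [simp]: "finite (subseqs_of_length bs n)"
  by (simp add: subseqs_of_length_def)

lemma subseqs_of_length_0: "subseqs_of_length bs 0 = {[]}"
proof -
  have "[] \<in> set (subseqs bs)" by (induction bs) (auto simp: Let_def)
  then show ?thesis by (auto simp: subseqs_of_length_def)
qed

lemma subseqs_of_length_Cons:
  "subseqs_of_length (b # bs) (Suc n) = (#) b ` subseqs_of_length bs n \<union> subseqs_of_length bs (Suc n)"
  by (auto simp: subseqs_of_length_def Let_def)

lemma subseqs_set_eqD:
  assumes "distinct bs" and "ss \<in> subseqs_of_length bs n" and "tt \<in> subseqs_of_length bs n" and "set ss = set tt"
  shows "ss = tt"
proof -
  have "inj_on set (set (subseqs bs))"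
    using distinct_set_subseqs[OF assms(1)] by (simp add: distinct_map)
  then show ?thesis using assms by (auto simp: subseqs_of_length_def dest: inj_onD)
qed

text \<open>Sublists of a distinct list correspond to subsets of its entries through
  \<open>set\<close>.\<close>

lemma card_subseqs_of_length:
  assumes "distinct bs"
  shows "card (subseqs_of_length bs n) = length bs choose n"
proof -
  have inj: "inj_on set (set (subseqs bs))"
    using distinct_set_subseqs[OF assms] by (simp add: distinct_map)
  have "set ` subseqs_of_length bs n = {A. A \<subseteq> set bs \<and> card A = n}"
  proof (intro equalityI subsetI)
    fix A assume "A \<in> set ` subseqs_of_length bs n"
    then obtain ss where ss: "ss \<in> subseqs_of_length bs n" "A = set ss" by blast
    have "length ss = n" using ss(1) by (simp add: subseqs_of_length_def)
    then show "A \<in> {A. A \<subseteq> set bs \<and> card A = n}"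
      using subseqs_of_length_subset[OF ss(1)] distinct_card[OF subseqs_of_length_distinct[OF assms ss(1)]] ss(2)
      by simp
  next
    fix A assume A: "A \<in> {A. A \<subseteq> set bs \<and> card A = n}"
    then have "A \<in> set ` set (subseqs bs)" unfolding subseqs_powset by simp
    then obtain ss where ss: "ss \<in> set (subseqs bs)" "A = set ss" by blast
    then have "length ss = n" using A subseqs_distinctD[OF ss(1) assms] by (simp add: distinct_card)
    then show "A \<in> set ` subseqs_of_length bs n" using ss by (auto simp: subseqs_of_length_def)
  qed
  moreover have "inj_on set (subseqs_of_length bs n)"
    using inj by (rule inj_on_subset) (auto simp: subseqs_of_length_def)
  ultimately have "card (subseqs_of_length bs n) = card {A. A \<subseteq> set bs \<and> card A = n}"
    using card_image by metis
  then show ?thesis using n_subsets[of "set bs" n] assms by (simp add: distinct_card)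
qed

text \<open>A basis of \<open>L\<close> with its dual functionals. The indices form a list, because
  its order selects one representative among the rearrangements of an exterior monomial.\<close>

locale dual_basis = alternating sL sM L M
  for sL :: "'k::field \<Rightarrow> 'v::ab_group_add \<Rightarrow> 'v" and sM :: "'k \<Rightarrow> 'w::ab_group_add \<Rightarrow> 'w" and L M +
  fixes bs :: "'b list" and e :: "'b \<Rightarrow> 'v" and \<theta> :: "'b \<Rightarrow> 'v \<Rightarrow> 'k"
  assumes dist_bs: "distinct bs"
    and eL: "b \<in> set bs \<Longrightarrow> e b \<in> L"
    and functional_\<theta>: "b \<in> set bs \<Longrightarrow> functional (\<theta> b)"
    and \<theta>_e: "b \<in> set bs \<Longrightarrow> c \<in> set bs \<Longrightarrow> \<theta> b (e c) = (if b = c then 1 else 0)"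
    and expand: "x \<in> L \<Longrightarrow> x = (\<Sum>b\<in>set bs. sL (\<theta> b x) (e b))"
begin

text \<open>The exterior product of the 1-forms \<theta> b along the list, with coefficient
  \<open>c\<close> in the module.\<close>

primrec mono_form :: "'w \<Rightarrow> 'b list \<Rightarrow> 'v list \<Rightarrow> 'w" where
  "mono_form c [] = (\<lambda>xs. if xs = [] then c else 0)"
| "mono_form c (b # ss) = wedge (\<theta> b) (mono_form c ss)"

lemma alt_mono_form: "c \<in> M \<Longrightarrow> set ss \<subseteq> set bs \<Longrightarrow> alt (length ss) (mono_form c ss)"
  by (induction ss) (simp_all add: alt_wedge functional_\<theta> del: alt.simps(2))

lemma mono_form_add: "mono_form (c + d) ss = mono_form c ss + mono_form d ss"
  by (induction ss) (simp_all add: wedge_add del: plus_fun_apply, simp add: fun_eq_iff)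

lemma mono_form_scale: "mono_form (sM a c) ss = fsc a (mono_form c ss)"
  by (induction ss) (simp_all add: wedge_fsc del: fsc_apply, simp add: fun_eq_iff)

lemma mono_form_self: "distinct ss \<Longrightarrow> set ss \<subseteq> set bs \<Longrightarrow> mono_form c ss (map e ss) = c"
proof (induction ss)
  case (Cons b ss)
  have "wedge (\<theta> b) (contract (e b) (mono_form c ss)) (map e ss) = 0"
    by (rule wedge_vanishing_functional) (use Cons.prems \<theta>_e in auto)
  then show ?case using Cons by (simp add: eL \<theta>_e)
qed simp

lemma mono_form_vanish:
  "b \<in> set ss \<Longrightarrow> (\<And>x. x \<in> set xs \<Longrightarrow> \<theta> b x = 0) \<Longrightarrow> mono_form c ss xs = 0"
proof (induction ss arbitrary: xs)
  case (Cons a ss)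
  show ?case
  proof (cases "a = b")
    case True
    then show ?thesis using Cons.prems by (simp add: wedge_vanishing_functional)
  next
    case False
    then have "mono_form c ss ys = 0" if "set ys \<subseteq> set xs" for ys
      using Cons that by auto
    then show ?thesis by (simp add: wedge_vanishing_form)
  qed
qed simp

text \<open>A factor \<theta> b with \<open>b\<close> outside \<open>tt\<close> would vanish on all
  arguments, and with it the monomial.\<close>

lemma mono_form_map_nonzero:
  assumes "mono_form c ss (map e tt) \<noteq> 0" and "set ss \<subseteq> set bs" and "set tt \<subseteq> set bs"
  shows "set ss \<subseteq> set tt"
proof
  fix b assume b: "b \<in> set ss"
  show "b \<in> set tt"
  proof (rule ccontr)
    assume "b \<notin> set tt"
    then have "\<theta> b x = 0" if "x \<in> set (map e tt)" for x
      using that assms(3) \<theta>_e[OF subsetD[OF assms(2) b]] by auto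
    then show False using mono_form_vanish[OF b] assms(1) by blast
  qed
qed

text \<open>An inclusion between index sets of equal size is an equality, and the sublist is
  determined by its set.\<close>

lemma mono_form_eval:
  assumes "ss \<in> subseqs_of_length bs n" and "tt \<in> subseqs_of_length bs n"
  shows "mono_form c ss (map e tt) = (if ss = tt then c else 0)"
proof -
  note sub = subseqs_of_length_subset[OF assms(1)] subseqs_of_length_subset[OF assms(2)]
  note dis = subseqs_of_length_distinct[OF dist_bs assms(1)] subseqs_of_length_distinct[OF dist_bs assms(2)]
  have "ss = tt" if nz: "mono_form c ss (map e tt) \<noteq> 0"
  proof (rule subseqs_set_eqD[OF dist_bs assms])
    have "card (set ss) = card (set tt)"
      using assms dis by (simp add: distinct_card subseqs_of_length_def)
    then show "set ss = set tt"
      using mono_form_map_nonzero[OF nz sub] by (simp add: card_subset_eq)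
  qed
  then show ?thesis using mono_form_self[OF dis(1) sub(1)] by auto
qed

lemma alt_eq_0:
  assumes "alt (Suc n) \<omega>" and "\<And>b. b \<in> set bs \<Longrightarrow> contract (e b) \<omega> = 0"
  shows "\<omega> = 0"
proof
  fix xs show "\<omega> xs = 0 xs"
  proof (cases xs)
    case (Cons x ys)
    show ?thesis
    proof (cases "x \<in> L")
      case True
      have "\<omega> (e b # ys) = 0" if "b \<in> set bs" for b
        using fun_cong[OF assms(2)[OF that], of ys] by simp
      then have "\<omega> ((\<Sum>b\<in>set bs. sL (\<theta> b x) (e b)) # ys) = 0"
        by (subst alt_first_sum[OF assms(1)]) (auto simp: eL)
      then show ?thesis using expand[OF True] Cons by simp
    qed (use alt_outside[OF assms(1)] Cons in simp)
  qed (use assms(1) in simp)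
qed

lemma alt_0_eq:
  assumes "alt 0 \<omega>"
  shows "\<omega> = mono_form (\<omega> []) []"
proof
  fix xs show "\<omega> xs = mono_form (\<omega> []) [] xs"
    using alt_zero_cons[OF assms] by (cases xs) simp_all
qed

text \<open>Induction over the basis elements whose contraction may be nonzero: \<omega> splits as
  \<theta>_b \<and> \<iota>_b \<omega> plus a form \<zeta> killed by \<open>e b\<close>, and both
  \<iota>_b \<omega> and \<zeta> are governed by the remaining list \<open>ts\<close>.\<close>

lemma alt_expand_aux:
  "distinct ts \<Longrightarrow> set ts \<subseteq> set bs \<Longrightarrow> alt n \<omega> \<Longrightarrow> (\<And>b. b \<in> set bs - set ts \<Longrightarrow> contract (e b) \<omega> = 0) \<Longrightarrow>
    \<omega> = (\<Sum>ss\<in>subseqs_of_length ts n. mono_form (\<omega> (map e ss)) ss)"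
proof (induction ts arbitrary: n \<omega>)
  case Nil
  show ?case
  proof (cases n)
    case 0
    have 1: "(\<Sum>ss\<in>subseqs_of_length [] n. mono_form (\<omega> (map e ss)) ss) = mono_form (\<omega> []) []"
      unfolding 0 subseqs_of_length_0 by simp
    have 2: "\<omega> = mono_form (\<omega> []) []" using Nil.prems(3) unfolding 0 by (rule alt_0_eq)
    show ?thesis by (rule trans[OF 2 1[symmetric]])
  next
    case (Suc m)
    have 1: "\<omega> = 0"
    proof (rule alt_eq_0)
      show "alt (Suc m) \<omega>" using Nil.prems(3) unfolding Suc .
      show "contract (e b) \<omega> = 0" if "b \<in> set bs" for b by (rule Nil.prems(4)) (use that in simp)
    qed
    have "subseqs_of_length ([] :: 'b list) (Suc m) = {}" by (auto simp: subseqs_of_length_def)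
    then show ?thesis unfolding Suc 1 by simp
  qed
next
  case (Cons b ts)
  show ?case
  proof (cases n)
    case 0
    have 1: "(\<Sum>ss\<in>subseqs_of_length (b # ts) n. mono_form (\<omega> (map e ss)) ss) = mono_form (\<omega> []) []"
      unfolding 0 subseqs_of_length_0 by simp
    have 2: "\<omega> = mono_form (\<omega> []) []" using Cons.prems(3) unfolding 0 by (rule alt_0_eq)
    show ?thesis by (rule trans[OF 2 1[symmetric]])
  next
    case (Suc m)
    have w: "alt (Suc m) \<omega>" using Cons.prems(3) Suc by simp
    have b: "b \<in> set bs" "b \<notin> set ts" using Cons.prems by auto
    have eb: "e b \<in> L" by (rule eL[OF b(1)])
    define \<eta> where "\<eta> = contract (e b) \<omega>"
    define \<zeta> where "\<zeta> = \<omega> - wedge (\<theta> b) \<eta>"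
    have \<eta>: "alt m \<eta>" unfolding \<eta>_def by (rule alt_contract[OF w eb])
    have \<zeta>: "alt (Suc m) \<zeta>"
      unfolding \<zeta>_def by (intro alt_diff w alt_wedge[OF functional_\<theta>[OF b(1)] \<eta>])
    have cb\<eta>: "contract (e b) \<eta> = 0" unfolding \<eta>_def by (rule contract_twice[OF w eb])
    have c\<eta>: "contract (e c) \<eta> = 0" if "c \<in> set bs - set ts" for c
    proof (cases "c = b")
      case False
      have 1: "contract (e c) \<omega> = 0" by (rule Cons.prems(4)) (use False that in simp)
      have "e c \<in> L" using eL that by simp
      then show ?thesis unfolding \<eta>_def contract_contract[OF w \<open>e c \<in> L\<close> eb] 1 contract_0 by (simp only: minus_zero)
    qed (simp only: cb\<eta>)
    \<comment> \<open>For \<open>c = b\<close> the two copies of \<eta> cancel, since \<theta> b is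
      1 on \<open>e b\<close> and a repeated contraction is zero.\<close>
    have c\<zeta>: "contract (e c) \<zeta> = 0" if c: "c \<in> set bs - set ts" for c
    proof (cases "c = b")
      case True
      then show ?thesis
        unfolding \<zeta>_def contract_diff True contract_wedge[OF eb] cb\<eta> wedge_0 \<theta>_e[OF b(1) b(1)]
        by (simp add: \<eta>_def fun_eq_iff)
    next
      case False
      have ec: "e c \<in> L" using eL c by simp
      have 1: "contract (e c) \<omega> = 0" by (rule Cons.prems(4)) (use False c in simp)
      have 2: "\<theta> b (e c) = 0" using \<theta>_e[OF b(1), of c] c False by simp
      show ?thesis
        unfolding \<zeta>_def contract_diff contract_wedge[OF ec] c\<eta>[OF c] 1 2 wedge_0 by (simp add: fun_eq_iff)
    qed
    have "\<eta> = (\<Sum>ss\<in>subseqs_of_length ts m. mono_form (\<eta> (map e ss)) ss)"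
      by (rule Cons.IH[OF _ _ \<eta> c\<eta>]) (use Cons.prems in auto)
    then have "wedge (\<theta> b) \<eta> = wedge (\<theta> b) (\<Sum>ss\<in>subseqs_of_length ts m. mono_form (\<eta> (map e ss)) ss)"
      by (rule arg_cong)
    also have "\<dots> = (\<Sum>ss\<in>subseqs_of_length ts m. mono_form (\<omega> (map e (b # ss))) (b # ss))"
      unfolding wedge_sum by (simp add: \<eta>_def)
    also have "\<dots> = (\<Sum>ss\<in>(#) b ` subseqs_of_length ts m. mono_form (\<omega> (map e ss)) ss)"
      by (subst sum.reindex) (auto simp: inj_on_def)
    finally have 1: "wedge (\<theta> b) \<eta> = (\<Sum>ss\<in>(#) b ` subseqs_of_length ts m. mono_form (\<omega> (map e ss)) ss)" .
    \<comment> \<open>On sublists of \<open>ts\<close> the subtracted part vanishes, so \<zeta> and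
      \<omega> have the same coefficients there.\<close>
    have \<zeta>\<omega>: "\<zeta> (map e ss) = \<omega> (map e ss)" if "ss \<in> subseqs_of_length ts (Suc m)" for ss
    proof -
      have "\<theta> b (e c) = 0" if c: "c \<in> set ss" for c
      proof -
        have "c \<in> set ts" using c subseqs_of_length_subset[OF \<open>ss \<in> _\<close>] by blast
        then show ?thesis using \<theta>_e[OF b(1), of c] b(2) Cons.prems(2) by auto
      qed
      then have "\<theta> b x = 0" if "x \<in> set (map e ss)" for x using that by auto
      then have "wedge (\<theta> b) \<eta> (map e ss) = 0" by (rule wedge_vanishing_functional)
      then show ?thesis by (simp add: \<zeta>_def)
    qed
    have "\<zeta> = (\<Sum>ss\<in>subseqs_of_length ts (Suc m). mono_form (\<zeta> (map e ss)) ss)"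
      by (rule Cons.IH[OF _ _ \<zeta> c\<zeta>]) (use Cons.prems in auto)
    also have "\<dots> = (\<Sum>ss\<in>subseqs_of_length ts (Suc m). mono_form (\<omega> (map e ss)) ss)"
      by (rule sum.cong) (simp_all only: \<zeta>\<omega>)
    finally have 2: "\<zeta> = (\<Sum>ss\<in>subseqs_of_length ts (Suc m). mono_form (\<omega> (map e ss)) ss)" .
    have "\<omega> = wedge (\<theta> b) \<eta> + \<zeta>" unfolding \<zeta>_def by (simp add: fun_eq_iff)
    also have "\<dots> = (\<Sum>ss\<in>(#) b ` subseqs_of_length ts m. mono_form (\<omega> (map e ss)) ss) +
        (\<Sum>ss\<in>subseqs_of_length ts (Suc m). mono_form (\<omega> (map e ss)) ss)"
      by (rule arg_cong2[OF 1 2])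
    also have "\<dots> = (\<Sum>ss\<in>subseqs_of_length (b # ts) (Suc m). mono_form (\<omega> (map e ss)) ss)"
      unfolding subseqs_of_length_Cons
    proof (rule sum.union_disjoint[symmetric])
      have "b # ss \<notin> subseqs_of_length ts (Suc m)" for ss
        using subseqs_of_length_subset[of "b # ss" ts "Suc m"] b(2) by auto
      then show "(#) b ` subseqs_of_length ts m \<inter> subseqs_of_length ts (Suc m) = {}" by blast
    qed simp_all
    finally show ?thesis unfolding Suc .
  qed
qed

theorem alt_expand:
  "alt n \<omega> \<Longrightarrow> \<omega> = (\<Sum>ss\<in>subseqs_of_length bs n. mono_form (\<omega> (map e ss)) ss)"
  by (rule alt_expand_aux) (auto simp: dist_bs)

end

section \<open>Exterior powers by generators and relations\<close>

lemma has_dim_exterior_neg: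
  assumes "n < 0"
  shows "has_dim (exterior V n :: ('k::field, ('v list \<Rightarrow> 'k) set) module) 0"
proof -
  have t: "tuples (carrier V) n = {}" using assms by (auto simp: tuples_def)
  have "has_dim (presented_space (tuples (carrier V) n) (exterior_rels V n) :: ('k, ('v list \<Rightarrow> 'k) set) module) (card ({} :: nat set))"
    by (rule has_dim_presented) (auto simp: exterior_rels_def t)
  then show ?thesis by (simp add: exterior_def)
qed

lemma exterior_rels_free:
  "exterior_rels (subspace_module sL L) n \<subseteq> free_space (tuples L n)"
  if "\<And>x y. x \<in> L \<Longrightarrow> y \<in> L \<Longrightarrow> x + y \<in> L" and "\<And>a x. x \<in> L \<Longrightarrow> sL a x \<in> L"
proof -
  have upd: "xs[i := v] \<in> tuples L n" if "xs \<in> tuples L n" "v \<in> L" for xs i v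
    using that set_update_subset_insert[of xs i v] by (auto simp: tuples_def)
  show ?thesis
    unfolding exterior_rels_def subspace_module_def
    by (auto intro!: fun_vs.subspace_diff[OF free_space_subspace] fun_vs.subspace_scale[OF free_space_subspace]
        basis_vec_free upd that)
qed

lemma lin_ext_rel3:
  fixes \<beta> :: "'a \<Rightarrow> 'k::field"
  shows "lin_ext \<beta> (basis_vec x - basis_vec y - basis_vec z) = \<beta> x - \<beta> y - \<beta> z"
proof -
  have b: "(basis_vec x :: 'a \<Rightarrow> 'k) \<in> free_space UNIV" for x by (simp add: basis_vec_free)
  show ?thesis
    unfolding lin_ext_diff[OF fun_vs.subspace_diff[OF free_space_subspace b b] b] lin_ext_diff[OF b b] by simp
qed

lemma lin_ext_rel2:
  fixes \<beta> :: "'a \<Rightarrow> 'k::field"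
  shows "lin_ext \<beta> (basis_vec x - fscale a (basis_vec y)) = \<beta> x - a * \<beta> y"
proof -
  have b: "(basis_vec x :: 'a \<Rightarrow> 'k) \<in> free_space UNIV" for x by (simp add: basis_vec_free)
  show ?thesis
    unfolding lin_ext_diff[OF b fun_vs.subspace_scale[OF free_space_subspace b]] lin_ext_fscale[OF b] by simp
qed

text \<open>Forms with values in the field: they are the functionals on exterior powers and also the
  cochains with trivial coefficients.\<close>

locale scalar_dual_basis = dual_basis sL "(*)" L UNIV bs e \<theta>
  for sL :: "'k::field \<Rightarrow> 'v::ab_group_add \<Rightarrow> 'v" and L and bs :: "'b list" and e \<theta>
begin

lemma mono_form_scalar: "mono_form c ss xs = c * mono_form 1 ss xs"
  using fun_cong[OF mono_form_scale[of c 1 ss], of xs] by simp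

lemma alt_expand_scalar:
  assumes "alt n \<omega>"
  shows "\<omega> xs = (\<Sum>ss\<in>subseqs_of_length bs n. \<omega> (map e ss) * mono_form 1 ss xs)"
proof -
  have "\<omega> xs = (\<Sum>ss\<in>subseqs_of_length bs n. mono_form (\<omega> (map e ss)) ss xs)"
    using fun_cong[OF alt_expand[OF assms], of xs] unfolding sum_fun_apply .
  then show ?thesis unfolding mono_form_scalar[of "\<omega> _"] .
qed

text \<open>A functional that kills the exterior relations is an alternating form on tuples, so the
  expansion of forms into monomials supplies the dual side of \<open>has_dim_presented\<close>, with
  the increasing index lists as basis.\<close>

theorem has_dim_exterior:
  "has_dim (exterior (subspace_module sL L) (int n)) (length bs choose n)"
proof -
  let ?V = "subspace_module sL L" and ?J = "subseqs_of_length bs n"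
  have V: "carrier ?V = L" "x \<oplus>\<^bsub>?V\<^esub> y = x + y" "a \<odot>\<^bsub>?V\<^esub> x = sL a x" for x y a
    by (simp_all add: subspace_module_def)
  have altJ: "alt n (mono_form 1 ss)" if "ss \<in> ?J" for ss
    using alt_mono_form[of 1 ss] subseqs_of_length_subset[OF that] that by (simp add: subseqs_of_length_def)
  have "has_dim (presented_space (tuples L (int n)) (exterior_rels ?V (int n))) (card ?J)"
  proof (rule has_dim_presented[where s = "map e" and \<delta> = "mono_form 1"])
    show "exterior_rels ?V (int n) \<subseteq> free_space (tuples L (int n))"
      by (rule exterior_rels_free) (auto intro: dom.subspace_add[OF subL] dom.subspace_scale[OF subL])
    show "map e ss \<in> tuples L (int n)" if "ss \<in> ?J" for ss
      using subseqs_of_length_subset[OF that] that eL by (auto simp: tuples_int subseqs_of_length_def)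
    show "mono_form 1 tt (map e ss) = (if ss = tt then 1 else 0)" if "ss \<in> ?J" "tt \<in> ?J" for ss tt
      using mono_form_eval[OF that(2,1), of 1] by auto
    show "lin_ext (mono_form 1 ss) \<rho> = 0" if ss: "ss \<in> ?J" and \<rho>: "\<rho> \<in> exterior_rels ?V (int n)" for ss \<rho>
    proof -
      consider xs i v w where "xs \<in> tuples L (int n)" "i < length xs" "v \<in> L" "w \<in> L"
          "\<rho> = basis_vec (xs[i := v + w]) - basis_vec (xs[i := v]) - basis_vec (xs[i := w])"
        | xs i a v where "xs \<in> tuples L (int n)" "i < length xs" "v \<in> L"
          "\<rho> = basis_vec (xs[i := sL a v]) - fscale a (basis_vec (xs[i := v]))"
        | xs where "xs \<in> tuples L (int n)" "\<not> distinct xs" "\<rho> = basis_vec xs"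
        using \<rho> unfolding exterior_rels_def V by blast
      then show ?thesis
      proof cases
        case 1
        then show ?thesis
          unfolding 1(5) lin_ext_rel3 by (subst alt_update_add[OF altJ[OF ss]]) (auto simp: tuples_int)
      next
        case 2
        then show ?thesis
          unfolding 2(4) lin_ext_rel2 by (subst alt_update_scale[OF altJ[OF ss]]) (auto simp: tuples_int)
      next
        case 3
        then show ?thesis
          unfolding 3(3) lin_ext_basis_vec by (intro alt_not_distinct[OF altJ[OF ss]])
      qed
    qed
    show "\<beta> xs = (\<Sum>ss\<in>?J. \<beta> (map e ss) * mono_form 1 ss xs)"
      if kill: "\<And>\<rho>. \<rho> \<in> exterior_rels ?V (int n) \<Longrightarrow> lin_ext \<beta> \<rho> = 0" and xs: "xs \<in> tuples L (int n)" for \<beta> xs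
    proof -
      \<comment> \<open>\<beta> is unconstrained off the tuples, whereas cochains must vanish
        there.\<close>
      define \<omega> where "\<omega> xs = (if xs \<in> tuples L (int n) then \<beta> xs else 0)" for xs
      have upd: "xs[i := v] \<in> tuples L (int n)" if "xs \<in> tuples L (int n)" "v \<in> L" for xs i v
        using that set_update_subset_insert[of xs i v] by (auto simp: tuples_def)
      have "\<omega> \<in> ce_cochains sL L (*) UNIV (int n)"
        unfolding ce_cochains_def mem_Collect_eq
      proof (intro conjI ballI allI impI)
        show "\<omega> (xs[i := x + y]) = \<omega> (xs[i := x]) + \<omega> (xs[i := y])"
          if "xs \<in> tuples L (int n)" "i < length xs" "x \<in> L" "y \<in> L" for xs i x y
        proof -
          have "basis_vec (xs[i := x + y]) - basis_vec (xs[i := x]) - basis_vec (xs[i := y]) \<in> exterior_rels ?V (int n)"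
            using that unfolding exterior_rels_def V by blast
          from kill[OF this] have "\<beta> (xs[i := x + y]) = \<beta> (xs[i := x]) + \<beta> (xs[i := y])"
            unfolding lin_ext_rel3 by (simp add: algebra_simps)
          then show ?thesis
            using that dom.subspace_add[OF subL] by (simp add: \<omega>_def upd)
        qed
        show "\<omega> (xs[i := sL a x]) = a * \<omega> (xs[i := x])"
          if "xs \<in> tuples L (int n)" "i < length xs" "x \<in> L" for xs i a x
        proof -
          have "basis_vec (xs[i := sL a x]) - fscale a (basis_vec (xs[i := x])) \<in> exterior_rels ?V (int n)"
            using that unfolding exterior_rels_def V by blast
          from kill[OF this] have "\<beta> (xs[i := sL a x]) = a * \<beta> (xs[i := x])"
            unfolding lin_ext_rel2 by simp
          then show ?thesis
            using that dom.subspace_scale[OF subL] by (simp add: \<omega>_def upd)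
        qed
        show "\<omega> xs = 0" if "xs \<in> tuples L (int n)" "\<not> distinct xs" for xs
        proof -
          have "basis_vec xs \<in> exterior_rels ?V (int n)"
            using that unfolding exterior_rels_def V by blast
          from kill[OF this] show ?thesis using that by (simp add: \<omega>_def)
        qed
      qed (simp_all add: \<omega>_def)
      then have "alt n \<omega>" by (rule ce_cochains_imp_alt)
      then have "\<omega> xs = (\<Sum>ss\<in>?J. \<omega> (map e ss) * mono_form 1 ss xs)" by (rule alt_expand_scalar)
      also have "\<dots> = (\<Sum>ss\<in>?J. \<beta> (map e ss) * mono_form 1 ss xs)"
      proof (rule sum.cong[OF refl])
        fix ss assume "ss \<in> ?J"
        then have "map e ss \<in> tuples L (int n)"
          using subseqs_of_length_subset[of ss bs n] eL by (auto simp: tuples_int subseqs_of_length_def)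
        then show "\<omega> (map e ss) * mono_form 1 ss xs = \<beta> (map e ss) * mono_form 1 ss xs" by (simp add: \<omega>_def)
      qed
      finally show ?thesis using xs by (simp add: \<omega>_def)
    qed
  qed simp
  then show ?thesis by (simp add: exterior_def V card_subseqs_of_length[OF dist_bs])
qed

section \<open>Cohomology of an Abelian algebra with trivial coefficients\<close>

lemma quotient_dim_alt: "fn.quotient_dim {\<omega>. alt n \<omega>} {0} (length bs choose n)"
proof -
  let ?J = "subseqs_of_length bs n"
  have altJ: "alt n (mono_form 1 ss)" if "ss \<in> ?J" for ss
    using alt_mono_form[of 1 ss] subseqs_of_length_subset[OF that] that by (simp add: subseqs_of_length_def)
  have "fn.quotient_dim {\<omega>. alt n \<omega>} {0} (card ?J)"
  proof (rule fn.quotient_dimI[where c = "mono_form 1"])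
    show "\<exists>a. \<omega> - (\<Sum>ss\<in>?J. fsc (a ss) (mono_form 1 ss)) \<in> {0}" if "\<omega> \<in> {\<omega>. alt n \<omega>}" for \<omega>
    proof (intro exI[of _ "\<lambda>ss. \<omega> (map e ss)"] singletonI[THEN back_subst[of "\<lambda>x. x \<in> {0}"]] ext)
      fix xs
      show "0 xs = (\<omega> - (\<Sum>ss\<in>?J. fsc (\<omega> (map e ss)) (mono_form 1 ss))) xs"
        using alt_expand_scalar[of n \<omega> xs] that by (simp add: sum_fun_apply)
    qed
    show "a ss = 0" if "(\<Sum>ss\<in>?J. fsc (a ss) (mono_form 1 ss)) \<in> {0}" "ss \<in> ?J" for a ss
    proof -
      have "0 = (\<Sum>tt\<in>?J. fsc (a tt) (mono_form 1 tt)) (map e ss)"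
        using that(1) by (metis singletonD zero_fun_apply)
      also have "\<dots> = (\<Sum>tt\<in>?J. if tt = ss then a ss else 0)"
        unfolding sum_fun_apply by (rule sum.cong) (auto simp: mono_form_eval[OF _ that(2)])
      also have "\<dots> = a ss" using that(2) by simp
      finally show ?thesis by simp
    qed
  qed (simp_all add: altJ)
  then show ?thesis by (simp add: card_subseqs_of_length[OF dist_bs])
qed

text \<open>One sum of the differential carries the zero action, the other has a zero bracket among
  its arguments.\<close>

lemma ce_diff_trivial:
  assumes br: "\<And>x y. x \<in> L \<Longrightarrow> y \<in> L \<Longrightarrow> br x y = 0" and w: "\<omega> \<in> ce_cochains sL L (*) UNIV n"
  shows "ce_diff L br (*) (\<lambda>_ _. 0) n \<omega> = 0"
proof
  fix xs
  have "\<omega> (0 # ys) = 0" for ys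
  proof (cases n)
    case (nonneg m)
    then have a: "alt m \<omega>" using w by (simp add: ce_cochains_imp_alt)
    show ?thesis
    proof (cases m)
      case 0
      then show ?thesis using a by simp
    next
      case (Suc k)
      then have "\<omega> (sL 0 0 # ys) = 0 * \<omega> (0 # ys)"
        using a dom.subspace_0[OF subL] by (intro alt_first_scale[of k]) simp_all
      then show ?thesis by simp
    qed
  next
    case (neg m)
    then show ?thesis using w ce_cochains_neg[of n] by simp
  qed
  then have "\<omega> (br (xs ! i) (xs ! j) # ys) = 0" if "xs \<in> tuples L (n + 1)" "j < length xs" "i < j" for i j ys
  proof -
    have "xs ! i \<in> L" "xs ! j \<in> L" using that by (auto simp: tuples_def subset_iff)
    then show ?thesis using \<open>\<And>ys. \<omega> (0 # ys) = 0\<close> by (simp add: br)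
  qed
  then show "ce_diff L br (*) (\<lambda>_ _. 0) n \<omega> xs = 0 xs"
    unfolding ce_diff_def by (auto intro!: sum.neutral)
qed

lemma ce_cochains_0: "0 \<in> ce_cochains sL L (*) UNIV n"
proof (cases n)
  case (nonneg m)
  then show ?thesis using alt_0[of m] by (simp add: ce_cochains_eq)
next
  case (neg m)
  then show ?thesis using ce_cochains_neg[of n] by simp
qed

text \<open>The differential vanishes, so cohomology and cochains coincide and the monomials count
  them; negative degrees hold only the zero cochain.\<close>

theorem has_dim_trivial_cohomology:
  assumes "\<And>x y. x \<in> L \<Longrightarrow> y \<in> L \<Longrightarrow> br x y = 0"
  shows "has_dim (trivial_cohomology sL L br n) (if n < 0 then 0 else length bs choose nat n)"
proof -
  let ?C = "ce_cochains sL L (*) UNIV"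
  have Z: "{\<omega> \<in> ?C n. ce_diff L br (*) (\<lambda>_ _. 0) n \<omega> = 0} = ?C n"
    using ce_diff_trivial[where br = br, OF assms] by blast
  have B: "ce_diff L br (*) (\<lambda>_ _. 0) (n - 1) ` ?C (n - 1) = {0}"
    using ce_diff_trivial[where br = br, OF assms] ce_cochains_0[of "n - 1"] by force
  have fsc: "(\<lambda>a \<omega> xs. a * \<omega> xs) = fsc" by (simp add: fun_eq_iff)
  have sub0: "fn.subspace {0}" by (rule fn.subspace_single_0)
  show ?thesis
  proof (cases n)
    case (nonneg m)
    have "has_dim (quotient_module (subspace_module fsc {\<omega>. alt m \<omega>}) {0}) (length bs choose m)"
      by (rule fn.has_dim_quotient[OF alt_subspace sub0 _ quotient_dim_alt]) (simp add: alt_0)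
    then show ?thesis
      unfolding trivial_cohomology_def ce_cohomology_def Z B fsc using nonneg by (simp add: ce_cochains_eq)
  next
    case (neg m)
    have "fn.quotient_dim {0} {0} 0" unfolding fn.quotient_dim_def by simp
    then have "has_dim (quotient_module (subspace_module fsc {0}) {0}) 0"
      by (intro fn.has_dim_quotient[OF sub0 sub0]) simp_all
    then show ?thesis
      unfolding trivial_cohomology_def ce_cohomology_def Z B fsc using neg ce_cochains_neg[of n] by simp
  qed
qed

end

section \<open>The Chevalley--Eilenberg complex of the adjoint module\<close>

text \<open>These rules split off the first entry, by which alternating sums over omitted positions
  turn into recursions on the list.\<close>

lemma nths_Cons_omit:
  "nths (x # xs) (- {0}) = xs" "nths (x # xs) (- {Suc i}) = x # nths xs (- {i})"
  "nths (x # xs) (- {0, Suc i}) = nths xs (- {i})"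
  "nths (x # xs) (- {Suc i, Suc j}) = x # nths xs (- {i, j})"
proof -
  have s: "{j. Suc j \<in> - {Suc i}} = - {i}" "{j. Suc j \<in> - {0 :: nat}} = UNIV" "{j. Suc j \<in> - {0, Suc i}} = - {i}"
    "{k. Suc k \<in> - {Suc i, Suc j}} = - {i, j}" by auto
  show "nths (x # xs) (- {0}) = xs" "nths (x # xs) (- {Suc i}) = x # nths xs (- {i})"
    "nths (x # xs) (- {0, Suc i}) = nths xs (- {i})"
    "nths (x # xs) (- {Suc i, Suc j}) = x # nths xs (- {i, j})"
    unfolding nths_Cons s by (simp_all add: nths_all)
qed

text \<open>The bracket laws are asked on the ambient type, where commutators of arbitrary
  coefficient families satisfy them; closure is relative to \<open>L\<close>. The Jacobi identity
  says that \<open>br x\<close> is a derivation, the form in which Lie derivatives use it.\<close>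

locale lie_forms = alternating sc sc L L
  for sc :: "'k::field \<Rightarrow> 'v::ab_group_add \<Rightarrow> 'v" and L +
  fixes br :: "'v \<Rightarrow> 'v \<Rightarrow> 'v"
  assumes br_add_left: "br (x + y) z = br x z + br y z"
    and br_add_right: "br x (y + z) = br x y + br x z"
    and br_scale_left: "br (sc a x) y = sc a (br x y)"
    and br_scale_right: "br x (sc a y) = sc a (br x y)"
    and br_self: "br x x = 0"
    and jacobi: "br x (br y z) = br (br x y) z + br y (br x z)"
    and br_L: "x \<in> L \<Longrightarrow> y \<in> L \<Longrightarrow> br x y \<in> L"
begin

lemma br_0_right [simp]: "br x 0 = 0"
  using br_scale_right[of x 0 0] by simp

text \<open>The Lie derivative of forms with values in the adjoint module, through the rule
  \<iota>_y L_x = L_x \<iota>_y - \<iota>_[x,y].\<close>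

primrec lieD :: "'v \<Rightarrow> ('v list \<Rightarrow> 'v) \<Rightarrow> 'v list \<Rightarrow> 'v" where
  "lieD x \<omega> [] = br x (\<omega> [])"
| "lieD x \<omega> (y # ys) = (if y \<in> L then lieD x (contract y \<omega>) ys - \<omega> (br x y # ys) else 0)"

text \<open>The Chevalley-Eilenberg differential, defined by Cartan's formula \<iota>_x d = L_x - d
  \<iota>_x; its agreement with the alternating sum is \<open>ce_diff_eq_dd\<close>.\<close>

primrec dd :: "('v list \<Rightarrow> 'v) \<Rightarrow> 'v list \<Rightarrow> 'v" where
  "dd \<omega> [] = 0"
| "dd \<omega> (x # xs) = (if x \<in> L then lieD x \<omega> xs - dd (contract x \<omega>) xs else 0)"

lemma contract_lieD: "y \<in> L \<Longrightarrow> contract y (lieD x \<omega>) = lieD x (contract y \<omega>) - contract (br x y) \<omega>"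
  by (rule ext) simp

lemma contract_dd: "x \<in> L \<Longrightarrow> contract x (dd \<omega>) = lieD x \<omega> - dd (contract x \<omega>)"
  by (rule ext) simp

section \<open>Cartan calculus by induction on the degree\<close>

lemma lieD_add: "lieD x (\<omega> + \<eta>) = lieD x \<omega> + lieD x \<eta>"
proof
  fix ys show "lieD x (\<omega> + \<eta>) ys = (lieD x \<omega> + lieD x \<eta>) ys"
    by (induction ys arbitrary: \<omega> \<eta>) (simp_all add: contract_add br_add_right)
qed

lemma lieD_fsc: "lieD x (fsc a \<omega>) = fsc a (lieD x \<omega>)"
proof
  fix ys show "lieD x (fsc a \<omega>) ys = fsc a (lieD x \<omega>) ys"
    by (induction ys arbitrary: \<omega>) (simp_all add: contract_fsc br_scale_right dom.scale_right_diff_distrib)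
qed

lemma lieD_0: "lieD x 0 = 0"
proof -
  have "lieD x 0 + lieD x 0 = lieD x 0" unfolding lieD_add[symmetric] by (simp only: add_0_left)
  then show ?thesis by (simp only: add_cancel_left_right)
qed

lemma lieD_diff: "lieD x (\<omega> - \<eta>) = lieD x \<omega> - lieD x \<eta>"
proof -
  have "lieD x (\<omega> - \<eta>) + lieD x \<eta> = lieD x \<omega>" unfolding lieD_add[symmetric] by (simp only: diff_add_cancel)
  then show ?thesis by (simp only: eq_diff_eq)
qed

lemma lieD_sum: "lieD x (\<Sum>i\<in>A. f i) = (\<Sum>i\<in>A. lieD x (f i))"
  by (induction A rule: infinite_finite_induct) (simp_all only: sum.infinite sum.empty sum.insert lieD_add lieD_0 if_False not_False_eq_True)

lemma dd_add: "dd (\<omega> + \<eta>) = dd \<omega> + dd \<eta>"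
proof
  fix ys show "dd (\<omega> + \<eta>) ys = (dd \<omega> + dd \<eta>) ys"
    by (induction ys arbitrary: \<omega> \<eta>) (simp_all add: contract_add lieD_add)
qed

lemma dd_fsc: "dd (fsc a \<omega>) = fsc a (dd \<omega>)"
proof
  fix ys show "dd (fsc a \<omega>) ys = fsc a (dd \<omega>) ys"
    by (induction ys arbitrary: \<omega>) (simp_all add: contract_fsc lieD_fsc dom.scale_right_diff_distrib)
qed

lemma dd_0: "dd 0 = 0"
proof -
  have "dd 0 + dd 0 = dd 0" unfolding dd_add[symmetric] by (simp only: add_0_left)
  then show ?thesis by (simp only: add_cancel_left_right)
qed

lemma dd_diff: "dd (\<omega> - \<eta>) = dd \<omega> - dd \<eta>"
proof -
  have "dd (\<omega> - \<eta>) + dd \<eta> = dd \<omega>" unfolding dd_add[symmetric] by (simp only: diff_add_cancel)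
  then show ?thesis by (simp only: eq_diff_eq)
qed

text \<open>The contraction of a form of degree 0 is zero and so has every degree. Hence the
  truncated \<open>n - 1\<close> is harmless, which saves case distinctions.\<close>

lemma alt_contract_pred: "alt n \<omega> \<Longrightarrow> x \<in> L \<Longrightarrow> alt (n - 1) (contract x \<omega>)"
proof (cases n)
  case 0
  assume "alt n \<omega>"
  then have "contract x \<omega> = 0" unfolding 0 by (rule contract_alt_0)
  then show ?thesis by (simp only: 0 diff_0_eq_0 alt_0)
next
  case (Suc m)
  assume "alt n \<omega>" "x \<in> L"
  then show ?thesis unfolding Suc by (simp only: diff_Suc_1 alt_contract)
qed

lemma alt_zero_first: "alt n \<omega> \<Longrightarrow> \<omega> (0 # xs) = 0"
proof (cases n)
  case 0
  assume "alt n \<omega>"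
  then show ?thesis unfolding 0 by (rule alt_zero_cons)
next
  case (Suc m)
  assume "alt n \<omega>"
  then show ?thesis
    using alt_first_scale[of m \<omega> 0 0 xs] dom.subspace_0[OF subL] unfolding Suc by simp
qed

text \<open>The reduction to lower degree on which the inductive proofs of operator identities
  rest.\<close>

lemma alt_extI:
  assumes "alt (Suc n) \<omega>" and "alt (Suc n) \<eta>" and "\<And>x. x \<in> L \<Longrightarrow> contract x \<omega> = contract x \<eta>"
  shows "\<omega> = \<eta>"
proof
  fix xs show "\<omega> xs = \<eta> xs"
  proof (cases xs)
    case Nil
    then show ?thesis using alt_SucD(1)[OF assms(1)] alt_SucD(1)[OF assms(2)] by simp
  next
    case (Cons x ys)
    show ?thesis
    proof (cases "x \<in> L")
      case True
      then show ?thesis using fun_cong[OF assms(3)[OF True], of ys] Cons by simp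
    next
      case False
      then show ?thesis using alt_outside[OF assms(1) False] alt_outside[OF assms(2) False] Cons by simp
    qed
  qed
qed

lemma alt_lieD: "alt n \<omega> \<Longrightarrow> x \<in> L \<Longrightarrow> alt n (lieD x \<omega>)"
proof (induction n arbitrary: \<omega>)
  case 0
  have "lieD x \<omega> (y # ys) = 0" for y ys
    by (simp add: contract_alt_0[OF 0(1)] lieD_0 alt_zero_cons[OF 0(1)])
  moreover have "lieD x \<omega> [] \<in> L" using 0 by (simp add: br_L)
  ultimately show ?case by (simp del: lieD.simps)
next
  case (Suc n)
  have w: "alt (Suc n) \<omega>" and x: "x \<in> L" by fact+
  show ?case
  proof (rule alt_SucI)
    show "lieD x \<omega> [] = 0" using alt_SucD(1)[OF w] by simp
    show "alt n (contract y (lieD x \<omega>))" if y: "y \<in> L" for y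
      unfolding contract_lieD[OF y] by (intro alt_diff Suc.IH alt_contract[OF w] y br_L x)
    show "lieD x \<omega> ((y + z) # xs) = lieD x \<omega> (y # xs) + lieD x \<omega> (z # xs)" if yz: "y \<in> L" "z \<in> L" for y z xs
      using dom.subspace_add[OF subL yz] yz
      by (simp add: contract_first_add[OF w yz] lieD_add br_add_right alt_first_add[OF w] br_L x)
    show "lieD x \<omega> (sc a y # xs) = sc a (lieD x \<omega> (y # xs))" if y: "y \<in> L" for a y xs
      using dom.subspace_scale[OF subL y] y
      by (simp add: contract_first_scale[OF w y] lieD_fsc br_scale_right alt_first_scale[OF w] br_L x dom.scale_right_diff_distrib)
    \<comment> \<open>The term that brackets the first \<open>y\<close> cancels the one that
      brackets the second, by antisymmetry.\<close>
    show "lieD x \<omega> (y # y # ys) = 0" if y: "y \<in> L" for y ys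
      using y by (simp add: contract_twice[OF w y] lieD_0 alt_swap[OF w y br_L[OF x y]])
  qed simp
qed

lemma lieD_add_left: "alt n \<omega> \<Longrightarrow> x \<in> L \<Longrightarrow> y \<in> L \<Longrightarrow> lieD (x + y) \<omega> zs = lieD x \<omega> zs + lieD y \<omega> zs"
proof (induction zs arbitrary: n \<omega>)
  case Nil
  then show ?case by (simp add: br_add_left)
next
  case (Cons z zs)
  show ?case
  proof (cases "z \<in> L")
    case True
    have "\<omega> ((br x z + br y z) # zs) = \<omega> (br x z # zs) + \<omega> (br y z # zs)"
      using Cons.prems True by (cases n) (simp_all add: br_L)
    moreover have "lieD (x + y) (contract z \<omega>) zs = lieD x (contract z \<omega>) zs + lieD y (contract z \<omega>) zs"
      by (rule Cons.IH[OF alt_contract_pred[OF Cons.prems(1) True] Cons.prems(2,3)])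
    ultimately show ?thesis
      using True by (simp add: br_add_left)
  qed simp
qed

lemma lieD_scale_left: "alt n \<omega> \<Longrightarrow> x \<in> L \<Longrightarrow> lieD (sc a x) \<omega> zs = sc a (lieD x \<omega> zs)"
proof (induction zs arbitrary: n \<omega>)
  case Nil
  then show ?case by (simp add: br_scale_left)
next
  case (Cons z zs)
  show ?case
  proof (cases "z \<in> L")
    case True
    have "\<omega> (sc a (br x z) # zs) = sc a (\<omega> (br x z # zs))"
      using Cons.prems True by (cases n) (simp_all add: br_L)
    moreover have "lieD (sc a x) (contract z \<omega>) zs = sc a (lieD x (contract z \<omega>) zs)"
      by (rule Cons.IH[OF alt_contract_pred[OF Cons.prems(1) True] Cons.prems(2)])
    ultimately show ?thesis
      using True by (simp add: br_scale_left dom.scale_right_diff_distrib)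
  qed simp
qed

text \<open>Shared by both cases of \<open>alt_dd\<close>, which differ in the reason why the
  contracted form has a differential of the right degree.\<close>

lemma alt_dd_step:
  assumes w: "alt n \<omega>" and IH: "\<And>x. x \<in> L \<Longrightarrow> alt n (dd (contract x \<omega>))"
  shows "alt (Suc n) (dd \<omega>)"
proof (rule alt_SucI)
  show "alt n (contract x (dd \<omega>))" if "x \<in> L" for x
    unfolding contract_dd[OF that] by (intro alt_diff alt_lieD w that IH)
  show "dd \<omega> ((x + y) # xs) = dd \<omega> (x # xs) + dd \<omega> (y # xs)" if xy: "x \<in> L" "y \<in> L" for x y xs
  proof -
    have "contract (x + y) \<omega> = contract x \<omega> + contract y \<omega>"
      using w xy by (cases n) (auto simp: contract_first_add fun_eq_iff)
    then show ?thesis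
      using xy by (simp add: dom.subspace_add[OF subL] lieD_add_left[OF w] dd_add)
  qed
  show "dd \<omega> (sc a x # xs) = sc a (dd \<omega> (x # xs))" if x: "x \<in> L" for a x xs
  proof -
    have "contract (sc a x) \<omega> = fsc a (contract x \<omega>)"
      using w x by (cases n) (auto simp: contract_first_scale fun_eq_iff)
    then show ?thesis
      using x by (simp add: dom.subspace_scale[OF subL] lieD_scale_left[OF w] dd_fsc dom.scale_right_diff_distrib)
  qed
  show "dd \<omega> (x # x # xs) = 0" if "x \<in> L" for x xs
    using that by (simp add: contract_twice[OF w that] dd_0 br_self alt_zero_first[OF w])
qed simp_all

lemma alt_dd: "alt n \<omega> \<Longrightarrow> alt (Suc n) (dd \<omega>)"
proof (induction n arbitrary: \<omega>)
  case 0
  show ?case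
    by (rule alt_dd_step[OF 0]) (simp only: contract_alt_0[OF 0] dd_0 alt_0)
next
  case (Suc n)
  show ?case
    by (rule alt_dd_step[OF Suc.prems]) (intro Suc.IH alt_contract[OF Suc.prems])
qed

text \<open>The Jacobi identity enters twice: on the value in degree 0, and on the contracted
  argument in the induction step.\<close>

lemma lieD_br:
  assumes x: "x \<in> L" and y: "y \<in> L"
  shows "alt n \<omega> \<Longrightarrow> lieD (br x y) \<omega> = lieD x (lieD y \<omega>) - lieD y (lieD x \<omega>)"
proof (induction n arbitrary: \<omega>)
  case 0
  have a: "alt 0 (lieD (br x y) \<omega>)" "alt 0 (lieD x (lieD y \<omega>) - lieD y (lieD x \<omega>))"
    by (intro alt_diff alt_lieD 0 x y br_L)+
  show ?case
  proof
    fix zs show "lieD (br x y) \<omega> zs = (lieD x (lieD y \<omega>) - lieD y (lieD x \<omega>)) zs"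
    proof (cases zs)
      case Nil
      then show ?thesis using jacobi[of x y "\<omega> []"] by (simp add: algebra_simps)
    next
      case (Cons z zs')
      then show ?thesis using alt_zero_cons[OF a(1)] alt_zero_cons[OF a(2)] by metis
    qed
  qed
next
  case (Suc n)
  have w: "alt (Suc n) \<omega>" by fact
  show ?case
  proof (rule alt_extI)
    show "alt (Suc n) (lieD (br x y) \<omega>)" "alt (Suc n) (lieD x (lieD y \<omega>) - lieD y (lieD x \<omega>))"
      by (intro alt_diff alt_lieD w x y br_L)+
    fix z assume z: "z \<in> L"
    have IH: "lieD (br x y) (contract z \<omega>) = lieD x (lieD y (contract z \<omega>)) - lieD y (lieD x (contract z \<omega>))"
      by (rule Suc.IH[OF alt_contract[OF w z]])
    have J: "contract (br x (br y z)) \<omega> = contract (br (br x y) z) \<omega> + contract (br y (br x z)) \<omega>"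
      unfolding jacobi[of x y z] by (rule contract_first_add[OF w]) (intro br_L x y z)+
    note c = contract_lieD[OF z] contract_lieD[OF br_L[OF x z]] contract_lieD[OF br_L[OF y z]]
    show "contract z (lieD (br x y) \<omega>) = contract z (lieD x (lieD y \<omega>) - lieD y (lieD x \<omega>))"
      unfolding contract_diff c lieD_diff IH J by (rule ext) simp
  qed
qed

text \<open>Contraction with \<open>y\<close> reduces the claim to the one for \<iota>_y \<omega>
  together with the bracket rule \<open>lieD_br\<close>.\<close>

lemma lieD_dd: "alt n \<omega> \<Longrightarrow> x \<in> L \<Longrightarrow> lieD x (dd \<omega>) = dd (lieD x \<omega>)"
proof (induction n arbitrary: \<omega>)
  case 0
  show ?case
  proof (rule alt_extI)
    show "alt (Suc 0) (lieD x (dd \<omega>))" "alt (Suc 0) (dd (lieD x \<omega>))"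
      by (intro alt_lieD alt_dd 0)+
    fix y assume y: "y \<in> L"
    note c = contract_alt_0[OF 0(1)]
    show "contract y (lieD x (dd \<omega>)) = contract y (dd (lieD x \<omega>))"
      unfolding contract_lieD[OF y] contract_dd[OF y] contract_dd[OF br_L[OF 0(2) y]] lieD_diff dd_diff c dd_0 lieD_0
        lieD_br[OF 0(2) y 0(1)]
      by (rule ext) simp
  qed
next
  case (Suc n)
  show ?case
  proof (rule alt_extI)
    show "alt (Suc (Suc n)) (lieD x (dd \<omega>))" "alt (Suc (Suc n)) (dd (lieD x \<omega>))"
      by (intro alt_lieD alt_dd Suc.prems)+
    fix y assume y: "y \<in> L"
    have IH: "lieD x (dd (contract y \<omega>)) = dd (lieD x (contract y \<omega>))"
      by (rule Suc.IH[OF alt_contract[OF Suc.prems(1) y] Suc.prems(2)])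
    show "contract y (lieD x (dd \<omega>)) = contract y (dd (lieD x \<omega>))"
      unfolding contract_lieD[OF y] contract_dd[OF y] contract_dd[OF br_L[OF Suc.prems(2) y]] lieD_diff dd_diff IH
        lieD_br[OF Suc.prems(2) y Suc.prems(1)]
      by (rule ext) simp
  qed
qed

text \<open>By Cartan's formula \<iota>_x d d \<omega> = L_x d \<omega> - d L_x \<omega> + d d
  \<iota>_x \<omega>; the first two terms cancel and the last has lower degree.\<close>

lemma dd_dd: "alt n \<omega> \<Longrightarrow> dd (dd \<omega>) = 0"
proof (induction n arbitrary: \<omega>)
  case 0
  show ?case
  proof (rule alt_extI)
    show "alt (Suc (Suc 0)) (dd (dd \<omega>))" by (intro alt_dd 0)
    show "alt (Suc (Suc 0)) 0" by (rule alt_0)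
    fix x assume x: "x \<in> L"
    have d: "dd (contract x \<omega>) = 0" unfolding contract_alt_0[OF 0] by (rule dd_0)
    show "contract x (dd (dd \<omega>)) = contract x 0"
      unfolding contract_dd[OF x] dd_diff lieD_dd[OF 0 x] d dd_0 contract_0 by (simp only: diff_self diff_zero)
  qed
next
  case (Suc n)
  show ?case
  proof (rule alt_extI)
    show "alt (Suc (Suc (Suc n))) (dd (dd \<omega>))" by (intro alt_dd Suc.prems)
    show "alt (Suc (Suc (Suc n))) 0" by (rule alt_0)
    fix x assume x: "x \<in> L"
    have d: "dd (dd (contract x \<omega>)) = 0" by (rule Suc.IH[OF alt_contract[OF Suc.prems x]])
    show "contract x (dd (dd \<omega>)) = contract x 0"
      unfolding contract_dd[OF x] dd_diff lieD_dd[OF Suc.prems x] d contract_0 by (simp only: diff_self diff_zero)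
  qed
qed

text \<open>The Leibniz rule, where the 1-form moves by the coadjoint action L_x \<theta> = -
  \<theta> \<circ> ad x.\<close>

lemma lieD_wedge:
  assumes x: "x \<in> L"
  shows "lieD x (wedge \<theta> \<omega>) = wedge \<theta> (lieD x \<omega>) - wedge (\<lambda>y. \<theta> (br x y)) \<omega>"
proof
  fix ys show "lieD x (wedge \<theta> \<omega>) ys = (wedge \<theta> (lieD x \<omega>) - wedge (\<lambda>y. \<theta> (br x y)) \<omega>) ys"
  proof (induction ys arbitrary: \<omega>)
    case (Cons y ys)
    show ?case
    proof (cases "y \<in> L")
      case y: True
      have f1: "lieD x (contract y (wedge \<theta> \<omega>)) ys = sc (\<theta> y) (lieD x \<omega> ys) - lieD x (wedge \<theta> (contract y \<omega>)) ys"
        unfolding contract_wedge[OF y] lieD_diff lieD_fsc by simp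
      have f2: "wedge \<theta> (contract y (lieD x \<omega>)) ys =
          wedge \<theta> (lieD x (contract y \<omega>)) ys - wedge \<theta> (contract (br x y) \<omega>) ys"
        unfolding contract_lieD[OF y] wedge_diff by simp
      have f3: "lieD x (wedge \<theta> (contract y \<omega>)) ys =
          (wedge \<theta> (lieD x (contract y \<omega>)) - wedge (\<lambda>y. \<theta> (br x y)) (contract y \<omega>)) ys"
        by (rule Cons.IH)
      show ?thesis
        using y br_L[OF x y] by (simp add: f1 f2 f3)
    qed simp
  qed simp
qed

lemma wedge_zero_functional:
  assumes "\<And>x. x \<in> L \<Longrightarrow> \<theta> x = 0"
  shows "wedge \<theta> \<omega> = 0"
proof
  fix xs show "wedge \<theta> \<omega> xs = 0 xs"
    by (induction xs arbitrary: \<omega>) (simp_all add: assms)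
qed

text \<open>A 1-form that vanishes on brackets is closed and invariant, so the differential passes
  it with a sign.\<close>

lemma dd_wedge:
  assumes closed: "\<And>x y. x \<in> L \<Longrightarrow> y \<in> L \<Longrightarrow> \<theta> (br x y) = 0"
  shows "dd (wedge \<theta> \<omega>) = - wedge \<theta> (dd \<omega>)"
proof
  fix xs show "dd (wedge \<theta> \<omega>) xs = (- wedge \<theta> (dd \<omega>)) xs"
  proof (induction xs arbitrary: \<omega>)
    case (Cons x xs)
    show ?case
    proof (cases "x \<in> L")
      case x: True
      have "wedge (\<lambda>y. \<theta> (br x y)) \<omega> = 0"
        by (rule wedge_zero_functional) (rule closed[OF x])
      then have "lieD x (wedge \<theta> \<omega>) xs = wedge \<theta> (lieD x \<omega>) xs"
        unfolding lieD_wedge[OF x] by simp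
      moreover have "dd (contract x (wedge \<theta> \<omega>)) xs = sc (\<theta> x) (dd \<omega> xs) - dd (wedge \<theta> (contract x \<omega>)) xs"
        unfolding contract_wedge[OF x] dd_diff dd_fsc by simp
      moreover have "wedge \<theta> (contract x (dd \<omega>)) xs = wedge \<theta> (lieD x \<omega>) xs - wedge \<theta> (dd (contract x \<omega>)) xs"
        unfolding contract_dd[OF x] wedge_diff by simp
      moreover have "dd (wedge \<theta> (contract x \<omega>)) xs = (- wedge \<theta> (dd (contract x \<omega>))) xs"
        by (rule Cons.IH)
      ultimately show ?thesis
        using x by (simp add: algebra_simps)
    qed simp
  qed simp
qed

text \<open>The recursion leaves the bracket with the entry at position \<open>j\<close> in its
  place; moving it to the front past j entries gives the sign.\<close>

lemma lieD_eq_sum: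
  assumes x: "x \<in> L"
  shows "alt n \<omega> \<Longrightarrow> set ys \<subseteq> L \<Longrightarrow>
    lieD x \<omega> ys = br x (\<omega> ys) - (\<Sum>j<length ys. sc ((-1) ^ j) (\<omega> (br x (ys ! j) # nths ys (- {j}))))"
proof (induction ys arbitrary: n \<omega>)
  case (Cons y ys)
  have y: "y \<in> L" using Cons.prems by simp
  have "(\<Sum>j<length (y # ys). sc ((-1) ^ j) (\<omega> (br x ((y # ys) ! j) # nths (y # ys) (- {j})))) =
      \<omega> (br x y # ys) + (\<Sum>j<length ys. sc ((-1) ^ Suc j) (\<omega> (br x (ys ! j) # y # nths ys (- {j}))))"
    unfolding length_Cons sum.lessThan_Suc_shift by (simp add: nths_Cons_omit)
  also have "(\<Sum>j<length ys. sc ((-1) ^ Suc j) (\<omega> (br x (ys ! j) # y # nths ys (- {j})))) =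
      (\<Sum>j<length ys. sc ((-1) ^ j) (contract y \<omega> (br x (ys ! j) # nths ys (- {j}))))"
  proof (rule sum.cong[OF refl])
    fix j assume "j \<in> {..<length ys}"
    then have "br x (ys ! j) \<in> L" using Cons.prems(2) by (auto intro!: br_L x)
    then show "sc ((-1) ^ Suc j) (\<omega> (br x (ys ! j) # y # nths ys (- {j}))) =
        sc ((-1) ^ j) (contract y \<omega> (br x (ys ! j) # nths ys (- {j})))"
      using alt_swap[OF Cons.prems(1) _ y, of "br x (ys ! j)"] by simp
  qed
  finally have T: "(\<Sum>j<length (y # ys). sc ((-1) ^ j) (\<omega> (br x ((y # ys) ! j) # nths (y # ys) (- {j})))) =
      \<omega> (br x y # ys) + (\<Sum>j<length ys. sc ((-1) ^ j) (contract y \<omega> (br x (ys ! j) # nths ys (- {j}))))" .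
  have IH: "lieD x (contract y \<omega>) ys = br x (contract y \<omega> ys) -
      (\<Sum>j<length ys. sc ((-1) ^ j) (contract y \<omega> (br x (ys ! j) # nths ys (- {j}))))"
    by (rule Cons.IH[OF alt_contract_pred[OF Cons.prems(1) y]]) (use Cons.prems(2) in simp)
  have "lieD x \<omega> (y # ys) = lieD x (contract y \<omega>) ys - \<omega> (br x y # ys)" using y by simp
  then show ?case unfolding T IH by (simp add: algebra_simps)
qed simp

text \<open>Pairs that involve the first position give the bracket terms of L_x, and the remaining
  terms belong to d of the contraction. The minus sign of the latter comes from the shift of
  positions in the first sum, and from exchanging \<open>x\<close> with the bracket in the
  second.\<close>

lemma dd_eq_sum:
  "alt n \<omega> \<Longrightarrow> set xs \<subseteq> L \<Longrightarrow> dd \<omega> xs =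
    (\<Sum>i<length xs. sc ((-1) ^ i) (br (xs ! i) (\<omega> (nths xs (- {i}))))) +
    (\<Sum>j<length xs. \<Sum>i<j. sc ((-1) ^ (i + j)) (\<omega> (br (xs ! i) (xs ! j) # nths xs (- {i, j}))))"
proof (induction xs arbitrary: n \<omega>)
  case (Cons x xs)
  have x: "x \<in> L" and xs: "set xs \<subseteq> L" using Cons.prems by simp_all
  let ?S1 = "\<lambda>\<omega> xs. (\<Sum>i<length xs. sc ((-1) ^ i) (br (xs ! i) (\<omega> (nths xs (- {i})))))"
  let ?S2 = "\<lambda>\<omega> xs. (\<Sum>j<length xs. \<Sum>i<j. sc ((-1) ^ (i + j)) (\<omega> (br (xs ! i) (xs ! j) # nths xs (- {i, j}))))"
  let ?T = "\<Sum>j<length xs. sc ((-1) ^ j) (\<omega> (br x (xs ! j) # nths xs (- {j})))"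
  have S1: "?S1 \<omega> (x # xs) = br x (\<omega> xs) - ?S1 (contract x \<omega>) xs"
    unfolding length_Cons sum.lessThan_Suc_shift by (simp add: nths_Cons_omit sum_negf)
  have "?S2 \<omega> (x # xs) = (\<Sum>j<length xs. - sc ((-1) ^ j) (\<omega> (br x (xs ! j) # nths xs (- {j}))) +
      (\<Sum>i<j. sc ((-1) ^ (i + j)) (\<omega> (br (xs ! i) (xs ! j) # x # nths xs (- {i, j})))))"
    unfolding length_Cons sum.lessThan_Suc_shift by (simp add: nths_Cons_omit)
  also have "\<dots> = - ?T + (\<Sum>j<length xs. \<Sum>i<j. sc ((-1) ^ (i + j)) (\<omega> (br (xs ! i) (xs ! j) # x # nths xs (- {i, j}))))"
    by (simp only: sum.distrib sum_negf)
  also have "(\<Sum>j<length xs. \<Sum>i<j. sc ((-1) ^ (i + j)) (\<omega> (br (xs ! i) (xs ! j) # x # nths xs (- {i, j})))) =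
      - ?S2 (contract x \<omega>) xs"
    unfolding sum_negf[symmetric]
  proof (intro sum.cong refl)
    fix i j assume "j \<in> {..<length xs}" "i \<in> {..<j}"
    then have "br (xs ! i) (xs ! j) \<in> L" using xs by (intro br_L) auto
    then show "sc ((-1) ^ (i + j)) (\<omega> (br (xs ! i) (xs ! j) # x # nths xs (- {i, j}))) =
        - sc ((-1) ^ (i + j)) (contract x \<omega> (br (xs ! i) (xs ! j) # nths xs (- {i, j})))"
      using alt_swap[OF Cons.prems(1) _ x, of "br (xs ! i) (xs ! j)"] by simp
  qed
  finally have S2: "?S2 \<omega> (x # xs) = - ?T - ?S2 (contract x \<omega>) xs" by simp
  have "dd \<omega> (x # xs) = lieD x \<omega> xs - dd (contract x \<omega>) xs" using x by simp
  also have "\<dots> = br x (\<omega> xs) - ?T - (?S1 (contract x \<omega>) xs + ?S2 (contract x \<omega>) xs)"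
    unfolding lieD_eq_sum[OF x Cons.prems(1) xs] Cons.IH[OF alt_contract_pred[OF Cons.prems(1) x] xs] ..
  also have "\<dots> = ?S1 \<omega> (x # xs) + ?S2 \<omega> (x # xs)"
    unfolding S1 S2 by (simp only: diff_conv_add_uminus minus_add_distrib add_ac)
  finally show ?case .
qed simp

lemma ce_diff_eq_dd:
  assumes "alt n \<omega>"
  shows "ce_diff L br sc br (int n) \<omega> = dd \<omega>"
proof
  fix xs
  have t: "xs \<in> tuples L (int n + 1) \<longleftrightarrow> length xs = Suc n \<and> set xs \<subseteq> L"
    by (auto simp: tuples_def)
  show "ce_diff L br sc br (int n) \<omega> xs = dd \<omega> xs"
  proof (cases "length xs = Suc n \<and> set xs \<subseteq> L")
    case True
    then show ?thesis unfolding ce_diff_def t using dd_eq_sum[OF assms, of xs] by simp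
  next
    case False
    then show ?thesis unfolding ce_diff_def t using alt_support[OF alt_dd[OF assms] False] by (simp only: if_False)
  qed
qed

end

section \<open>Invariant forms and the action of a torus\<close>

context lie_forms
begin

text \<open>Indexed by integers like the given cochains, so that degree \<open>n - 1\<close> makes
  sense at \<open>n = 0\<close> and is zero there.\<close>

definition forms :: "int \<Rightarrow> ('v list \<Rightarrow> 'v) set"
  where "forms n = (if n < 0 then {0} else {\<omega>. alt (nat n) \<omega>})"

lemma forms_subspace: "fn.subspace (forms n)"
  unfolding forms_def using alt_subspace fn.subspace_single_0 by simp

lemma forms_cases:
  assumes "\<omega> \<in> forms n"
  obtains "n < 0" "\<omega> = 0" | m where "n = int m" "alt m \<omega>"
  using assms that(1) that(2)[of "nat n"] unfolding forms_def by (cases "n < 0") simp_all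

lemma forms_0: "0 \<in> forms n"
  by (rule fn.subspace_0[OF forms_subspace])

lemma alt_forms: "alt m \<omega> \<Longrightarrow> \<omega> \<in> forms (int m)"
  by (simp add: forms_def)

lemma dd_forms: "\<omega> \<in> forms n \<Longrightarrow> dd \<omega> \<in> forms (n + 1)"
proof (erule forms_cases)
  fix m assume m: "n = int m" "alt m \<omega>"
  have e: "int (Suc m) = n + 1" using m(1) by simp
  show ?thesis using alt_forms[OF alt_dd[OF m(2)]] unfolding e .
qed (simp only: dd_0 forms_0)

lemma wedge_forms: "functional \<theta> \<Longrightarrow> \<omega> \<in> forms (n - 1) \<Longrightarrow> wedge \<theta> \<omega> \<in> forms n"
proof (erule forms_cases)
  fix m assume m: "functional \<theta>" "n - 1 = int m" "alt m \<omega>"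
  have "int (Suc m) = n" using m(2) by simp
  then show ?thesis using alt_forms[OF alt_wedge[OF m(1,3)]] by simp
qed (simp only: wedge_0 forms_0)

lemma contract_forms: "\<omega> \<in> forms n \<Longrightarrow> x \<in> L \<Longrightarrow> contract x \<omega> \<in> forms (n - 1)"
proof (erule forms_cases)
  fix m assume m: "n = int m" "alt m \<omega>" "x \<in> L"
  show ?thesis
  proof (cases m)
    case 0
    have "contract x \<omega> = 0" using m(2) unfolding 0 by (rule contract_alt_0)
    then show ?thesis by (simp only: forms_0)
  next
    case (Suc k)
    have "int k = n - 1" using m(1) Suc by simp
    then show ?thesis using alt_forms[OF alt_contract[OF m(2)[unfolded Suc] m(3)]] by simp
  qed
qed (simp only: contract_0 forms_0)

lemma dd_dd_forms: "\<omega> \<in> forms n \<Longrightarrow> dd (dd \<omega>) = 0"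
  by (erule forms_cases) (simp_all only: dd_0 dd_dd)

section \<open>Homotopy formula and projection onto the invariants\<close>

lemma homotopy: "x \<in> L \<Longrightarrow> lieD x \<omega> = contract x (dd \<omega>) + dd (contract x \<omega>)"
  unfolding contract_dd by (simp only: diff_add_cancel)

text \<open>The product of the operators 1 - a^-1 L_h over the listed \<open>a\<close>: it kills
  eigenvectors with a listed nonzero eigenvalue, fixes the invariants and, as a polynomial in L_h,
  commutes with d.\<close>

primrec eigen_proj :: "'v \<Rightarrow> 'k list \<Rightarrow> ('v list \<Rightarrow> 'v) \<Rightarrow> 'v list \<Rightarrow> 'v" where
  "eigen_proj h [] \<omega> = \<omega>"
| "eigen_proj h (a # as) \<omega> = eigen_proj h as (\<omega> - fsc (inverse a) (lieD h \<omega>))"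

lemma eigen_proj_add: "eigen_proj h as (\<omega> + \<eta>) = eigen_proj h as \<omega> + eigen_proj h as \<eta>"
proof (induction as arbitrary: \<omega> \<eta>)
  case (Cons a as)
  have "\<omega> + \<eta> - fsc (inverse a) (lieD h (\<omega> + \<eta>)) =
      (\<omega> - fsc (inverse a) (lieD h \<omega>)) + (\<eta> - fsc (inverse a) (lieD h \<eta>))"
    unfolding lieD_add by (rule ext) (simp add: dom.scale_right_distrib)
  then show ?case using Cons.IH by (simp only: eigen_proj.simps)
qed simp

lemma eigen_proj_0: "eigen_proj h as 0 = 0"
proof -
  have "eigen_proj h as 0 + eigen_proj h as 0 = eigen_proj h as 0"
    unfolding eigen_proj_add[symmetric] by (simp only: add_0_left)
  then show ?thesis by (simp only: add_cancel_left_right)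
qed

lemma eigen_proj_sum: "eigen_proj h as (\<Sum>i\<in>A. f i) = (\<Sum>i\<in>A. eigen_proj h as (f i))"
  by (induction A rule: infinite_finite_induct)
    (simp_all only: sum.infinite sum.empty sum.insert eigen_proj_add eigen_proj_0 if_False not_False_eq_True)

lemma alt_eigen_proj:
  assumes "h \<in> L" shows "alt n \<omega> \<Longrightarrow> alt n (eigen_proj h as \<omega>)"
proof (induction as arbitrary: \<omega>)
  case (Cons a as)
  have "alt n (\<omega> - fsc (inverse a) (lieD h \<omega>))"
    by (intro alt_diff alt_fsc alt_lieD Cons.prems assms)
  then show ?case unfolding eigen_proj.simps by (rule Cons.IH)
qed simp

text \<open>The scalar \<open>b\<close> is the product of the factors 1 - c/a over the list.\<close>

lemma eigen_proj_eigenvector: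
  assumes "lieD h \<omega> = fsc c \<omega>" and "0 \<notin> set as"
  shows "\<exists>b. eigen_proj h as \<omega> = fsc b \<omega> \<and> (c \<in> set as \<longrightarrow> b = 0) \<and> (c = 0 \<longrightarrow> b = 1)"
proof -
  have scal: "lieD h \<eta> = fsc c \<eta> \<Longrightarrow> 0 \<notin> set as \<Longrightarrow>
      \<exists>b. eigen_proj h as \<eta> = fsc b \<eta> \<and> (c \<in> set as \<longrightarrow> b = 0) \<and> (c = 0 \<longrightarrow> b = 1)" for \<eta>
  proof (induction as arbitrary: \<eta>)
    case Nil
    show ?case by (intro exI[of _ 1]) (simp add: fun_eq_iff)
  next
    case (Cons a as)
    let ?d = "1 - inverse a * c"
    have 1: "\<eta> - fsc (inverse a) (lieD h \<eta>) = fsc ?d \<eta>"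
      unfolding Cons.prems(1) by (rule ext) (simp add: dom.scale_left_diff_distrib)
    have "lieD h (fsc ?d \<eta>) = fsc c (fsc ?d \<eta>)"
      unfolding lieD_fsc Cons.prems(1) by (rule ext) (simp add: mult.commute)
    then have "\<exists>b. eigen_proj h as (fsc ?d \<eta>) = fsc b (fsc ?d \<eta>) \<and> (c \<in> set as \<longrightarrow> b = 0) \<and> (c = 0 \<longrightarrow> b = 1)"
      by (rule Cons.IH) (use Cons.prems(2) in simp)
    then obtain b where b: "eigen_proj h as (fsc ?d \<eta>) = fsc b (fsc ?d \<eta>)" "c \<in> set as \<Longrightarrow> b = 0" "c = 0 \<Longrightarrow> b = 1"
      by blast
    have "eigen_proj h (a # as) \<eta> = fsc (b * ?d) \<eta>"
      unfolding eigen_proj.simps 1 b(1) by (rule ext) simp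
    moreover have "b * ?d = 0" if "c \<in> set (a # as)" using that b(2) Cons.prems(2) by auto
    moreover have "b * ?d = 1" if "c = 0" using that b(3) by simp
    ultimately show ?case by blast
  qed
  show ?thesis by (rule scal[OF assms])
qed

lemma eigen_proj_invariant:
  assumes "lieD h \<omega> = 0" shows "eigen_proj h as \<omega> = \<omega>"
proof (induction as)
  case (Cons a as)
  have "\<omega> - fsc (inverse a) (lieD h \<omega>) = \<omega>" unfolding assms by (rule ext) simp
  then show ?case using Cons.IH by (simp only: eigen_proj.simps)
qed simp

lemma dd_eigen_proj:
  assumes "h \<in> L" shows "alt n \<omega> \<Longrightarrow> dd (eigen_proj h as \<omega>) = eigen_proj h as (dd \<omega>)"
proof (induction as arbitrary: \<omega>)
  case (Cons a as)
  have a: "alt n (\<omega> - fsc (inverse a) (lieD h \<omega>))"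
    by (intro alt_diff alt_fsc alt_lieD Cons.prems assms)
  show ?case
    unfolding eigen_proj.simps Cons.IH[OF a] dd_diff dd_fsc lieD_dd[OF Cons.prems assms] ..
qed simp

text \<open>Projections for commuting elements do not disturb one another, so invariance can be
  reached for one element of the torus after the other.\<close>

lemma lieD_eigen_proj:
  assumes "h \<in> L" and "g \<in> L" and "br g h = 0"
  shows "alt n \<omega> \<Longrightarrow> lieD g \<omega> = 0 \<Longrightarrow> lieD g (eigen_proj h as \<omega>) = 0"
proof (induction as arbitrary: \<omega>)
  case (Cons a as)
  have a: "alt n (\<omega> - fsc (inverse a) (lieD h \<omega>))"
    by (intro alt_diff alt_fsc alt_lieD Cons.prems assms)
  have "lieD (br g h) \<omega> = lieD g (lieD h \<omega>) - lieD h (lieD g \<omega>)"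
    by (rule lieD_br[OF assms(2,1) Cons.prems(1)])
  moreover have "lieD (br g h) \<omega> = 0"
  proof
    fix xs show "lieD (br g h) \<omega> xs = 0 xs"
      using lieD_scale_left[OF Cons.prems(1) assms(1), of 0 xs] by (simp add: assms(3))
  qed
  ultimately have "lieD g (lieD h \<omega>) = 0"
    unfolding Cons.prems(2) lieD_0 by (simp only: diff_0_right)
  then have "lieD g (\<omega> - fsc (inverse a) (lieD h \<omega>)) = 0"
    unfolding lieD_diff lieD_fsc Cons.prems(2) by (simp only: fn.scale_zero_right diff_self)
  then show ?case unfolding eigen_proj.simps by (rule Cons.IH[OF a])
qed simp

text \<open>Each factor subtracts a multiple of the Lie derivative, which for a closed form is the
  differential of its contraction with \<open>h\<close> by Cartan's formula.\<close>

lemma eigen_proj_cohomologous: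
  assumes "h \<in> L"
  shows "alt n \<omega> \<Longrightarrow> dd \<omega> = 0 \<Longrightarrow> \<exists>\<eta>\<in>forms (int n - 1). \<omega> - eigen_proj h as \<omega> = dd \<eta>"
proof (induction as arbitrary: \<omega>)
  case Nil
  show ?case by (intro bexI[of _ 0] forms_0) (simp only: eigen_proj.simps dd_0 diff_self)
next
  case (Cons a as)
  let ?w = "\<omega> - fsc (inverse a) (lieD h \<omega>)"
  have a: "alt n ?w"
    by (intro alt_diff alt_fsc alt_lieD Cons.prems assms)
  have d: "dd ?w = 0"
    unfolding dd_diff dd_fsc lieD_dd[OF Cons.prems(1) assms, symmetric] Cons.prems(2) lieD_0
    by (simp only: fn.scale_zero_right diff_self)
  obtain \<eta> where \<eta>: "\<eta> \<in> forms (int n - 1)" "?w - eigen_proj h as ?w = dd \<eta>"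
    using Cons.IH[OF a d] by blast
  have hw: "lieD h \<omega> = dd (contract h \<omega>)"
    unfolding homotopy[OF assms] Cons.prems(2) by (simp only: contract_0 add_0_left)
  have "\<omega> - eigen_proj h (a # as) \<omega> = (?w - eigen_proj h as ?w) + fsc (inverse a) (lieD h \<omega>)"
    unfolding eigen_proj.simps by (rule ext) simp
  also have "\<dots> = dd \<eta> + fsc (inverse a) (lieD h \<omega>)" unfolding \<eta>(2) ..
  also have "\<dots> = dd (\<eta> + fsc (inverse a) (contract h \<omega>))"
    unfolding hw dd_add dd_fsc ..
  finally have e: "\<omega> - eigen_proj h (a # as) \<omega> = dd (\<eta> + fsc (inverse a) (contract h \<omega>))" .
  have "\<eta> + fsc (inverse a) (contract h \<omega>) \<in> forms (int n - 1)"
    by (intro fn.subspace_add[OF forms_subspace] fn.subspace_scale[OF forms_subspace] \<eta>(1)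
      contract_forms assms alt_forms Cons.prems(1))
  with e show ?case by (rule bexI)
qed

text \<open>On a sum of eigenvectors, dividing out all nonzero eigenvalues projects onto the invariants.\<close>

lemma invariant_representative:
  assumes "h \<in> L" and "alt n \<omega>"
    and eig: "\<omega> = (\<Sum>k\<in>K. \<omega>' k)" "finite K" "\<And>k. k \<in> K \<Longrightarrow> lieD h (\<omega>' k) = fsc (c k) (\<omega>' k)"
  shows "\<exists>\<eta>. alt n \<eta> \<and> lieD h \<eta> = 0 \<and> (\<forall>g\<in>L. br g h = 0 \<longrightarrow> lieD g \<omega> = 0 \<longrightarrow> lieD g \<eta> = 0) \<and>
    (dd \<omega> = 0 \<longrightarrow> dd \<eta> = 0 \<and> (\<exists>\<zeta>\<in>forms (int n - 1). \<omega> - \<eta> = dd \<zeta>)) \<and>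
    (lieD h (dd \<omega>) = 0 \<longrightarrow> dd \<eta> = dd \<omega>)"
proof -
  obtain as where as: "set as = c ` K - {0}" using finite_list[of "c ` K - {0}"] eig(2) by auto
  let ?p = "eigen_proj h as"
  have "lieD h (?p \<omega>) = (\<Sum>k\<in>K. lieD h (?p (\<omega>' k)))"
    by (subst eig(1)) (simp only: eigen_proj_sum lieD_sum)
  also have "\<dots> = (\<Sum>k\<in>K. 0)"
  proof (rule sum.cong[OF refl])
    fix k assume k: "k \<in> K"
    obtain b where b: "?p (\<omega>' k) = fsc b (\<omega>' k)" "c k \<in> set as \<Longrightarrow> b = 0"
      using eigen_proj_eigenvector[OF eig(3)[OF k], of as] as by blast
    have "b * c k = 0" using b(2) as k by auto
    then show "lieD h (?p (\<omega>' k)) = 0"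
      unfolding b(1) lieD_fsc eig(3)[OF k] fn.scale_scale by (simp only: fn.scale_zero_left)
  qed
  also have "\<dots> = 0" by (rule sum.neutral_const)
  finally have 0: "lieD h (?p \<omega>) = 0" .
  note comm = dd_eigen_proj[OF assms(1,2), of as]
  show ?thesis
  proof (intro exI[of _ "?p \<omega>"] conjI impI ballI)
    show "dd (?p \<omega>) = 0" if "dd \<omega> = 0" unfolding comm that by (rule eigen_proj_0)
    show "dd (?p \<omega>) = dd \<omega>" if "lieD h (dd \<omega>) = 0" unfolding comm by (rule eigen_proj_invariant[OF that])
    show "\<exists>\<zeta>\<in>forms (int n - 1). \<omega> - ?p \<omega> = dd \<zeta>" if "dd \<omega> = 0"
      by (rule eigen_proj_cohomologous[OF assms(1,2) that])
    show "lieD g (?p \<omega>) = 0" if "g \<in> L" "br g h = 0" "lieD g \<omega> = 0" for g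
      by (rule lieD_eigen_proj[OF assms(1) that(1,2) assms(2) that(3)])
  qed (use 0 alt_eigen_proj[OF assms(1,2)] in blast)+
qed

text \<open>Forms invariant under \<open>H\<close> and horizontal for \<open>T\<close>. The sets are
  kept apart because horizontality conditions are dropped one by one while invariance stays.\<close>

definition inv_forms :: "'v set \<Rightarrow> 'v set \<Rightarrow> int \<Rightarrow> ('v list \<Rightarrow> 'v) set"
  where "inv_forms H T n = {\<omega> \<in> forms n. (\<forall>h\<in>H. lieD h \<omega> = 0) \<and> (\<forall>t\<in>T. contract t \<omega> = 0)}"

definition inv_cocycles :: "'v set \<Rightarrow> 'v set \<Rightarrow> int \<Rightarrow> ('v list \<Rightarrow> 'v) set"
  where "inv_cocycles H T n = {\<omega> \<in> inv_forms H T n. dd \<omega> = 0}"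

definition inv_coboundaries :: "'v set \<Rightarrow> 'v set \<Rightarrow> int \<Rightarrow> ('v list \<Rightarrow> 'v) set"
  where "inv_coboundaries H T n = dd ` inv_forms H T (n - 1)"

lemma inv_forms_subspace: "fn.subspace (inv_forms H T n)"
proof (rule fn.subspaceI)
  show "0 \<in> inv_forms H T n" unfolding inv_forms_def by (simp only: mem_Collect_eq forms_0 lieD_0 contract_0) simp
  show "\<omega> + \<eta> \<in> inv_forms H T n" if "\<omega> \<in> inv_forms H T n" "\<eta> \<in> inv_forms H T n" for \<omega> \<eta>
    using that fn.subspace_add[OF forms_subspace] unfolding inv_forms_def mem_Collect_eq lieD_add contract_add by simp
  show "fsc a \<omega> \<in> inv_forms H T n" if "\<omega> \<in> inv_forms H T n" for a \<omega>
    using that fn.subspace_scale[OF forms_subspace] fn.scale_zero_right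
    unfolding inv_forms_def mem_Collect_eq lieD_fsc contract_fsc by simp
qed

lemma inv_cocycles_subspace: "fn.subspace (inv_cocycles H T n)"
proof (rule fn.subspaceI)
  note sub = inv_forms_subspace[of H T n]
  show "0 \<in> inv_cocycles H T n" unfolding inv_cocycles_def using fn.subspace_0[OF sub] dd_0 by simp
  show "\<omega> + \<eta> \<in> inv_cocycles H T n" if "\<omega> \<in> inv_cocycles H T n" "\<eta> \<in> inv_cocycles H T n" for \<omega> \<eta>
    using that fn.subspace_add[OF sub] unfolding inv_cocycles_def mem_Collect_eq dd_add by simp
  show "fsc a \<omega> \<in> inv_cocycles H T n" if "\<omega> \<in> inv_cocycles H T n" for a \<omega>
    using that fn.subspace_scale[OF sub] fn.scale_zero_right
    unfolding inv_cocycles_def mem_Collect_eq dd_fsc by simp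
qed

lemma inv_coboundaries_subspace: "fn.subspace (inv_coboundaries H T n)"
proof (rule fn.subspaceI)
  note sub = inv_forms_subspace[of H T "n - 1"]
  show "0 \<in> inv_coboundaries H T n"
    unfolding inv_coboundaries_def by (rule image_eqI[where x = 0]) (simp_all only: dd_0 fn.subspace_0[OF sub])
  show "\<omega> + \<eta> \<in> inv_coboundaries H T n" if prem: "\<omega> \<in> inv_coboundaries H T n" "\<eta> \<in> inv_coboundaries H T n" for \<omega> \<eta>
  proof -
    obtain \<omega>' \<eta>' where "\<omega>' \<in> inv_forms H T (n - 1)" "\<omega> = dd \<omega>'" "\<eta>' \<in> inv_forms H T (n - 1)" "\<eta> = dd \<eta>'"
      using prem unfolding inv_coboundaries_def by blast
    then show ?thesis unfolding inv_coboundaries_def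
      by (intro image_eqI[of _ _ "\<omega>' + \<eta>'"] fn.subspace_add[OF sub]) (simp_all only: dd_add)
  qed
  show "fsc a \<omega> \<in> inv_coboundaries H T n" if prem: "\<omega> \<in> inv_coboundaries H T n" for a \<omega>
  proof -
    obtain \<omega>' where "\<omega>' \<in> inv_forms H T (n - 1)" "\<omega> = dd \<omega>'"
      using prem unfolding inv_coboundaries_def by blast
    then show ?thesis unfolding inv_coboundaries_def
      by (intro image_eqI[of _ _ "fsc a \<omega>'"] fn.subspace_scale[OF sub]) (simp_all only: dd_fsc)
  qed
qed

lemma inv_coboundaries_closed: "\<zeta> \<in> inv_coboundaries H T n \<Longrightarrow> dd \<zeta> = 0"
  unfolding inv_coboundaries_def inv_forms_def by (auto intro: dd_dd_forms)

text \<open>The inclusion of the invariant forms induces a bijection in cohomology: a cocycle is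
  cohomologous to its projection, and an invariant coboundary has an invariant primitive, the
  projection of any primitive. Diagonalisability is a hypothesis, with a free type for the index of
  the eigenvectors.\<close>

lemma quotient_dim_invariants:
  assumes fin: "finite H" and HL: "H \<subseteq> L" and comm: "\<And>g h. g \<in> H \<Longrightarrow> h \<in> H \<Longrightarrow> br g h = 0"
    and eig: "\<And>h m \<omega>. h \<in> H \<Longrightarrow> alt m \<omega> \<Longrightarrow> \<exists>(K :: 'i set) \<omega>' c. finite K \<and> \<omega> = (\<Sum>k\<in>K. \<omega>' k) \<and>
      (\<forall>k\<in>K. lieD h (\<omega>' k) = fsc (c k) (\<omega>' k))"
    and dim: "fn.quotient_dim (inv_cocycles H {} n) (inv_coboundaries H {} n) m"
  shows "fn.quotient_dim (inv_cocycles {} {} n) (inv_coboundaries {} {} n) m"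
proof -
  \<comment> \<open>Projection for the elements of \<open>G\<close> in turn. By the last clause it
    does not change an already invariant differential, which yields the invariant
    primitives.\<close>
  have rep: "\<exists>\<eta>. alt k \<eta> \<and> (\<forall>h\<in>G. lieD h \<eta> = 0) \<and> (\<forall>g\<in>H. lieD g \<omega> = 0 \<longrightarrow> lieD g \<eta> = 0) \<and>
      (dd \<omega> = 0 \<longrightarrow> dd \<eta> = 0 \<and> (\<exists>\<zeta>\<in>forms (int k - 1). \<omega> - \<eta> = dd \<zeta>)) \<and>
      ((\<forall>h\<in>H. lieD h (dd \<omega>) = 0) \<longrightarrow> dd \<eta> = dd \<omega>)"
    if "finite G" "G \<subseteq> H" "alt k \<omega>" for G k \<omega>
    using that
  proof (induction G)
    case empty
    have "\<exists>\<zeta>\<in>forms (int k - 1). \<omega> - \<omega> = dd \<zeta>"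
      by (intro bexI[of _ 0] forms_0) (simp only: dd_0 diff_self)
    then show ?case using empty by (intro exI[of _ \<omega>]) blast
  next
    case (insert h G)
    then obtain \<eta> where \<eta>: "alt k \<eta>" "\<And>g. g \<in> G \<Longrightarrow> lieD g \<eta> = 0" "\<And>g. g \<in> H \<Longrightarrow> lieD g \<omega> = 0 \<Longrightarrow> lieD g \<eta> = 0"
      "dd \<omega> = 0 \<Longrightarrow> dd \<eta> = 0" "dd \<omega> = 0 \<Longrightarrow> \<exists>\<zeta>\<in>forms (int k - 1). \<omega> - \<eta> = dd \<zeta>"
      "\<forall>h\<in>H. lieD h (dd \<omega>) = 0 \<Longrightarrow> dd \<eta> = dd \<omega>" by blast
    have h: "h \<in> H" "h \<in> L" using insert HL by auto
    obtain K :: "'i set" and \<omega>' c where K: "\<eta> = (\<Sum>k\<in>K. \<omega>' k)" "finite K" "\<And>k. k \<in> K \<Longrightarrow> lieD h (\<omega>' k) = fsc (c k) (\<omega>' k)"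
      using eig[OF h(1) \<eta>(1)] by blast
    obtain \<eta>' where \<eta>': "alt k \<eta>'" "lieD h \<eta>' = 0"
      "\<And>g. \<lbrakk>g \<in> L; br g h = 0; lieD g \<eta> = 0\<rbrakk> \<Longrightarrow> lieD g \<eta>' = 0"
      "dd \<eta> = 0 \<Longrightarrow> dd \<eta>' = 0" "dd \<eta> = 0 \<Longrightarrow> \<exists>\<zeta>\<in>forms (int k - 1). \<eta> - \<eta>' = dd \<zeta>"
      "lieD h (dd \<eta>) = 0 \<Longrightarrow> dd \<eta>' = dd \<eta>"
      using invariant_representative[OF h(2) \<eta>(1) K] by blast
    have gh: "g \<in> L" "br g h = 0" if "g \<in> H" for g using that HL comm h(1) by auto
    show ?case
    proof (intro exI[of _ \<eta>'] conjI ballI impI)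
      show "alt k \<eta>'" by (rule \<eta>'(1))
      show "lieD g \<eta>' = 0" if "g \<in> insert h G" for g
        using that \<eta>'(2) \<eta>'(3)[OF gh \<eta>(2)] insert.prems(1) by blast
      show "lieD g \<eta>' = 0" if "g \<in> H" "lieD g \<omega> = 0" for g
        by (rule \<eta>'(3)[OF gh[OF that(1)] \<eta>(3)[OF that]])
      show "dd \<eta>' = 0" if "dd \<omega> = 0" by (rule \<eta>'(4)[OF \<eta>(4)[OF that]])
      show "\<exists>\<zeta>\<in>forms (int k - 1). \<omega> - \<eta>' = dd \<zeta>" if closed: "dd \<omega> = 0"
      proof -
        obtain \<zeta>1 \<zeta>2 where \<zeta>: "\<zeta>1 \<in> forms (int k - 1)" "\<omega> - \<eta> = dd \<zeta>1" "\<zeta>2 \<in> forms (int k - 1)" "\<eta> - \<eta>' = dd \<zeta>2"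
          using \<eta>(5)[OF closed] \<eta>'(5)[OF \<eta>(4)[OF closed]] by blast
        have "\<omega> - \<eta>' = (\<omega> - \<eta>) + (\<eta> - \<eta>')" by (rule ext) simp
        also have "\<dots> = dd (\<zeta>1 + \<zeta>2)" unfolding \<zeta> dd_add ..
        finally show ?thesis using fn.subspace_add[OF forms_subspace \<zeta>(1,3)] by blast
      qed
      show "dd \<eta>' = dd \<omega>" if "\<forall>h\<in>H. lieD h (dd \<omega>) = 0"
        using \<eta>'(6) \<eta>(6)[OF that] that h(1) by (metis (no_types))
    qed
  qed
  have sub: "inv_forms H {} k \<subseteq> inv_forms {} {} k" for k by (auto simp: inv_forms_def)
  show ?thesis
  proof (rule fn.quotient_dim_mono[OF dim inv_coboundaries_subspace])
    show "inv_cocycles H {} n \<subseteq> inv_cocycles {} {} n" using sub by (auto simp: inv_cocycles_def)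
    show "inv_coboundaries H {} n \<subseteq> inv_coboundaries {} {} n" using sub by (auto simp: inv_coboundaries_def)
    show "fn.subspace (inv_cocycles H {} n)" by (rule inv_cocycles_subspace)
    show "inv_coboundaries {} {} n \<inter> inv_cocycles H {} n \<subseteq> inv_coboundaries H {} n"
    proof
      fix \<zeta> assume "\<zeta> \<in> inv_coboundaries {} {} n \<inter> inv_cocycles H {} n"
      then obtain \<omega> where \<omega>: "\<omega> \<in> forms (n - 1)" "\<zeta> = dd \<omega>" and inv: "\<forall>h\<in>H. lieD h (dd \<omega>) = 0"
        by (auto simp: inv_coboundaries_def inv_cocycles_def inv_forms_def)
      from \<omega>(1) show "\<zeta> \<in> inv_coboundaries H {} n"
      proof (cases rule: forms_cases)
        case 1
        then show ?thesis
          unfolding \<omega>(2) 1(2) dd_0 by (intro fn.subspace_0 inv_coboundaries_subspace)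
      next
        case (2 k)
        obtain \<eta> where "alt k \<eta>" "\<forall>h\<in>H. lieD h \<eta> = 0" "dd \<eta> = dd \<omega>"
          using rep[OF fin subset_refl 2(2)] inv by blast
        moreover have "\<eta> \<in> forms (n - 1)" unfolding 2(1) by (rule alt_forms) fact
        ultimately show ?thesis unfolding \<omega>(2) inv_coboundaries_def inv_forms_def
          by (intro image_eqI[of _ _ \<eta>]) simp_all
      qed
    qed
    show "\<exists>w\<in>inv_cocycles H {} n. z - w \<in> inv_coboundaries {} {} n" if z: "z \<in> inv_cocycles {} {} n" for z
    proof -
      have zf: "z \<in> forms n" and dz: "dd z = 0" using z by (auto simp: inv_cocycles_def inv_forms_def)
      from zf show ?thesis
      proof (cases rule: forms_cases)
        case 1
        show ?thesis
        proof (rule bexI[of _ 0])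
          show "z - 0 \<in> inv_coboundaries {} {} n"
            unfolding 1(2) diff_self by (intro fn.subspace_0 inv_coboundaries_subspace)
          show "0 \<in> inv_cocycles H {} n" by (intro fn.subspace_0 inv_cocycles_subspace)
        qed
      next
        case (2 k)
        obtain \<eta> where \<eta>: "alt k \<eta>" "\<forall>h\<in>H. lieD h \<eta> = 0" "dd \<eta> = 0" "\<exists>\<zeta>\<in>forms (int k - 1). z - \<eta> = dd \<zeta>"
          using rep[OF fin subset_refl 2(2)] dz by blast
        have "\<eta> \<in> forms n" unfolding 2(1) by (rule alt_forms[OF \<eta>(1)])
        then have "\<eta> \<in> inv_cocycles H {} n" using \<eta> by (simp add: inv_cocycles_def inv_forms_def)
        moreover have "z - \<eta> \<in> inv_coboundaries {} {} n"
          using \<eta>(4) unfolding 2(1) inv_coboundaries_def inv_forms_def by auto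
        ultimately show ?thesis by blast
      qed
    qed
  qed
qed

end

text \<open>Commuting elements \<open>H\<close>, among them vectors \<open>h i\<close> with dual
  1-forms that vanish on brackets. \<open>H\<close> may be larger than the family of the
  \<open>h i\<close>: for posets it is indexed by all vertices, whereas the \<open>h i\<close> with
  \<open>i\<close> in \<open>D\<close> will be a basis of the diagonal subalgebra.\<close>

locale torus_forms = lie_forms sc L br
  for sc :: "'k::field \<Rightarrow> 'v::ab_group_add \<Rightarrow> 'v" and L br +
  fixes H :: "'v set" and D :: "'i set" and h :: "'i \<Rightarrow> 'v" and \<theta> :: "'i \<Rightarrow> 'v \<Rightarrow> 'k"
  assumes finite_D: "finite D"
    and h_H: "i \<in> D \<Longrightarrow> h i \<in> H" and H_L: "H \<subseteq> L"
    and H_comm: "g \<in> H \<Longrightarrow> g' \<in> H \<Longrightarrow> br g g' = 0"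
    and \<theta>_functional: "i \<in> D \<Longrightarrow> functional (\<theta> i)"
    and \<theta>_h: "i \<in> D \<Longrightarrow> j \<in> D \<Longrightarrow> \<theta> i (h j) = (if i = j then 1 else 0)"
    and \<theta>_br: "i \<in> D \<Longrightarrow> x \<in> L \<Longrightarrow> y \<in> L \<Longrightarrow> \<theta> i (br x y) = 0"
begin

section \<open>Splitting off one dimension of the torus at a time\<close>

lemma h_L: "i \<in> D \<Longrightarrow> h i \<in> L"
  using h_H H_L by blast

lemma lieD_wedge_\<theta>:
  assumes "i \<in> D" and "x \<in> L"
  shows "lieD x (wedge (\<theta> i) \<omega>) = wedge (\<theta> i) (lieD x \<omega>)"
proof -
  have "wedge (\<lambda>y. \<theta> i (br x y)) \<omega> = 0"
    by (rule wedge_zero_functional) (rule \<theta>_br[OF assms])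
  then show ?thesis unfolding lieD_wedge[OF assms(2)] by (simp only: diff_0_right)
qed

lemma dd_wedge_\<theta>: "i \<in> D \<Longrightarrow> dd (wedge (\<theta> i) \<omega>) = - wedge (\<theta> i) (dd \<omega>)"
  by (intro dd_wedge \<theta>_br)

text \<open>The 1-form \<theta> t is invariant, being zero on brackets, and it vanishes on the other
  \<open>h i\<close>.\<close>

lemma wedge_inv_forms:
  assumes t: "t \<in> D" and S: "S \<subseteq> D" "t \<notin> S" and w: "\<omega> \<in> inv_forms H (h ` insert t S) (n - 1)"
  shows "wedge (\<theta> t) \<omega> \<in> inv_forms H (h ` S) n"
  unfolding inv_forms_def
proof (intro CollectI conjI ballI)
  show "wedge (\<theta> t) \<omega> \<in> forms n"
    using w by (intro wedge_forms \<theta>_functional t) (simp add: inv_forms_def)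
  fix g assume "g \<in> H"
  then have "lieD g \<omega> = 0" "g \<in> L" using w H_L by (auto simp: inv_forms_def)
  then show "lieD g (wedge (\<theta> t) \<omega>) = 0" unfolding lieD_wedge_\<theta>[OF t \<open>g \<in> L\<close>] by (simp only: wedge_0)
next
  fix s assume "s \<in> h ` S"
  then obtain i where i: "i \<in> S" "s = h i" by blast
  have 1: "contract s \<omega> = 0" using w i by (auto simp: inv_forms_def)
  have 2: "\<theta> t s = 0" using \<theta>_h[OF t, of i] i S by auto
  have sL: "s \<in> L" using i S h_L by auto
  show "contract s (wedge (\<theta> t) \<omega>) = 0"
    unfolding contract_wedge[OF sL] 1 2 wedge_0 by (simp only: fn.scale_zero_left diff_self)
qed

text \<open>Invariance survives because \<open>h t\<close> commutes with \<open>H\<close>,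
  horizontality because contractions anticommute and square to zero.\<close>

lemma contract_inv_forms:
  assumes t: "t \<in> D" and S: "S \<subseteq> D" and w: "\<omega> \<in> inv_forms H (h ` S) n"
  shows "contract (h t) \<omega> \<in> inv_forms H (h ` insert t S) (n - 1)"
  unfolding inv_forms_def
proof (intro CollectI conjI ballI)
  have wf: "\<omega> \<in> forms n" using w by (simp add: inv_forms_def)
  show "contract (h t) \<omega> \<in> forms (n - 1)" by (intro contract_forms wf h_L t)
  from wf obtain m where a: "alt m \<omega>"
  proof (cases rule: forms_cases)
    case 1
    have "alt 0 \<omega>" unfolding 1(2) by (rule alt_0)
    then show ?thesis by (rule that)
  qed (rule that)
  show "lieD g (contract (h t) \<omega>) = 0" if g: "g \<in> H" for g
  proof -
    have "contract (br g (h t)) \<omega> = 0"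
      unfolding H_comm[OF g h_H[OF t]] by (rule ext) (simp add: alt_zero_first[OF a])
    moreover have "contract (h t) (lieD g \<omega>) = 0" using w g contract_0 by (simp add: inv_forms_def)
    ultimately show ?thesis using contract_lieD[OF h_L[OF t], of g \<omega>] by (simp only: diff_0_right)
  qed
  show "contract s (contract (h t) \<omega>) = 0" if "s \<in> h ` insert t S" for s
  proof (cases "s = h t")
    case True
    show ?thesis unfolding True by (rule contract_twice[OF a h_L[OF t]])
  next
    case False
    then have s: "s \<in> h ` S" using that by auto
    then have "contract s \<omega> = 0" using w unfolding inv_forms_def by blast
    moreover have "s \<in> L" using s S h_L by auto
    ultimately show ?thesis
      using contract_contract[OF a _ h_L[OF t], of s] by (simp only: contract_0 minus_zero)
  qed
qed

lemma contract_wedge_inv: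
  assumes t: "t \<in> D" and y: "contract (h t) y = 0"
  shows "contract (h t) (wedge (\<theta> t) y) = y"
proof -
  have "\<theta> t (h t) = 1" using \<theta>_h[OF t t] by simp
  then show ?thesis
    unfolding contract_wedge[OF h_L[OF t]] y wedge_0 by (simp only: fn.scale_one diff_0_right)
qed

text \<open>The subtracted term has the same contraction with \<open>h t\<close> as \<omega>, since
  \<theta> t is 1 there.\<close>

lemma remainder_inv_forms:
  assumes t: "t \<in> D" and S: "S \<subseteq> D" "t \<notin> S" and w: "\<omega> \<in> inv_forms H (h ` S) n"
  shows "\<omega> - wedge (\<theta> t) (contract (h t) \<omega>) \<in> inv_forms H (h ` insert t S) n"
proof -
  let ?y = "contract (h t) \<omega>"
  have y: "?y \<in> inv_forms H (h ` insert t S) (n - 1)" by (rule contract_inv_forms[OF t S(1) w])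
  have "wedge (\<theta> t) ?y \<in> inv_forms H (h ` S) n" by (rule wedge_inv_forms[OF t S y])
  then have d: "\<omega> - wedge (\<theta> t) ?y \<in> inv_forms H (h ` S) n" by (rule fn.subspace_diff[OF inv_forms_subspace w])
  have "contract (h t) ?y = 0" using y by (simp add: inv_forms_def)
  then have "contract (h t) (\<omega> - wedge (\<theta> t) ?y) = 0"
    unfolding contract_diff by (simp only: contract_wedge_inv[OF t] diff_self)
  then show ?thesis using d by (auto simp: inv_forms_def)
qed

text \<open>The forms horizontal for \<open>S\<close> are the direct sum of those horizontal for
  \<open>insert t S\<close> and of \<theta>_t times such forms of degree one less. The differential
  respects this: \<theta>_t is closed, and on invariant forms Cartan's formula says that d
  anticommutes with contraction.\<close>

lemma quotient_dim_insert:
  assumes t: "t \<in> D" and S: "S \<subseteq> D" "t \<notin> S"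
    and d0: "fn.quotient_dim (inv_cocycles H (h ` insert t S) n) (inv_coboundaries H (h ` insert t S) n) a"
    and d1: "fn.quotient_dim (inv_cocycles H (h ` insert t S) (n - 1)) (inv_coboundaries H (h ` insert t S) (n - 1)) b"
  shows "fn.quotient_dim (inv_cocycles H (h ` S) n) (inv_coboundaries H (h ` S) n) (a + b)"
proof (rule fn.quotient_dim_unique_sum[OF d0 d1, where T = "wedge (\<theta> t)"])
  let ?T = "h ` insert t S"
  have sub: "inv_forms H ?T k \<subseteq> inv_forms H (h ` S) k" for k by (auto simp: inv_forms_def)
  show "wedge (\<theta> t) (x + y) = wedge (\<theta> t) x + wedge (\<theta> t) y" for x y by (rule wedge_add)
  show "wedge (\<theta> t) (fsc c x) = fsc c (wedge (\<theta> t) x)" for c x by (rule wedge_fsc)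
  show "fn.subspace (inv_coboundaries H (h ` S) n)" by (rule inv_coboundaries_subspace)
  show "fn.subspace (inv_cocycles H ?T n)" "fn.subspace (inv_cocycles H ?T (n - 1))"
    by (rule inv_cocycles_subspace)+
  show "inv_cocycles H ?T n \<subseteq> inv_cocycles H (h ` S) n" using sub by (auto simp: inv_cocycles_def)
  show "inv_coboundaries H ?T n \<subseteq> inv_coboundaries H (h ` S) n" using sub by (auto simp: inv_coboundaries_def)
  show "wedge (\<theta> t) ` inv_cocycles H ?T (n - 1) \<subseteq> inv_cocycles H (h ` S) n"
  proof
    fix z assume "z \<in> wedge (\<theta> t) ` inv_cocycles H ?T (n - 1)"
    then obtain y where y: "z = wedge (\<theta> t) y" "y \<in> inv_forms H ?T (n - 1)" "dd y = 0"
      by (auto simp: inv_cocycles_def)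
    have "dd z = 0" unfolding y(1) dd_wedge_\<theta>[OF t] y(3) wedge_0 by (rule minus_zero)
    then show "z \<in> inv_cocycles H (h ` S) n"
      using wedge_inv_forms[OF t S y(2)] y(1) by (simp add: inv_cocycles_def)
  qed
  show "wedge (\<theta> t) ` inv_coboundaries H ?T (n - 1) \<subseteq> inv_coboundaries H (h ` S) n"
  proof
    fix z assume "z \<in> wedge (\<theta> t) ` inv_coboundaries H ?T (n - 1)"
    then obtain y where y: "z = wedge (\<theta> t) (dd y)" "y \<in> inv_forms H ?T (n - 1 - 1)"
      by (auto simp: inv_coboundaries_def)
    have "dd (wedge (\<theta> t) y) \<in> inv_coboundaries H (h ` S) n"
      unfolding inv_coboundaries_def by (rule imageI) (rule wedge_inv_forms[OF t S y(2)])
    from fn.subspace_neg[OF inv_coboundaries_subspace this] show "z \<in> inv_coboundaries H (h ` S) n"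
      unfolding y(1) dd_wedge_\<theta>[OF t] by (simp only: minus_minus)
  qed
  show "\<exists>x\<in>inv_cocycles H ?T n. \<exists>y\<in>inv_cocycles H ?T (n - 1). z = x + wedge (\<theta> t) y"
    if z: "z \<in> inv_cocycles H (h ` S) n" for z
  proof -
    have zf: "z \<in> inv_forms H (h ` S) n" and dz: "dd z = 0" using z by (auto simp: inv_cocycles_def)
    let ?y = "contract (h t) z"
    have "lieD (h t) z = 0" using zf h_H[OF t] by (simp add: inv_forms_def)
    then have dy: "dd ?y = 0"
      using homotopy[OF h_L[OF t], of z] unfolding dz contract_0 by (simp only: add_0_left)
    have "dd (z - wedge (\<theta> t) ?y) = 0"
      unfolding dd_diff dz dd_wedge_\<theta>[OF t] dy wedge_0 by (simp only: minus_zero diff_self)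
    then have "z - wedge (\<theta> t) ?y \<in> inv_cocycles H ?T n"
      using remainder_inv_forms[OF t S zf] by (simp add: inv_cocycles_def)
    moreover have "?y \<in> inv_cocycles H ?T (n - 1)"
      using contract_inv_forms[OF t S(1) zf] dy by (simp add: inv_cocycles_def)
    moreover have "z = (z - wedge (\<theta> t) ?y) + wedge (\<theta> t) ?y" by (simp only: diff_add_cancel)
    ultimately show ?thesis by blast
  qed
  show "x \<in> inv_coboundaries H ?T n \<and> y \<in> inv_coboundaries H ?T (n - 1)"
    if x: "x \<in> inv_cocycles H ?T n" and y: "y \<in> inv_cocycles H ?T (n - 1)"
      and xy: "x + wedge (\<theta> t) y \<in> inv_coboundaries H (h ` S) n" for x y
  proof -
    obtain \<eta> where \<eta>: "\<eta> \<in> inv_forms H (h ` S) (n - 1)" "x + wedge (\<theta> t) y = dd \<eta>"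
      using xy by (auto simp: inv_coboundaries_def)
    let ?c = "contract (h t) \<eta>"
    have cx: "contract (h t) x = 0" and cy: "contract (h t) y = 0"
      using x y by (auto simp: inv_cocycles_def inv_forms_def)
    \<comment> \<open>Contraction with \<open>h t\<close> isolates \<open>y\<close>, whose primitive
      is thus minus the contraction of \<eta>.\<close>
    have "y = contract (h t) (x + wedge (\<theta> t) y)"
      unfolding contract_add cx contract_wedge_inv[OF t cy] by (simp only: add_0_left)
    also have "\<dots> = lieD (h t) \<eta> - dd ?c" unfolding \<eta>(2) by (rule contract_dd[OF h_L[OF t]])
    also have "lieD (h t) \<eta> = 0" using \<eta>(1) h_H[OF t] by (simp add: inv_forms_def)
    finally have y_eq: "y = - dd ?c" by (simp only: diff_0)
    have "dd ?c \<in> inv_coboundaries H ?T (n - 1)"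
      unfolding inv_coboundaries_def by (rule imageI) (rule contract_inv_forms[OF t S(1) \<eta>(1)])
    then have "y \<in> inv_coboundaries H ?T (n - 1)"
      unfolding y_eq by (rule fn.subspace_neg[OF inv_coboundaries_subspace])
    moreover have "x = dd \<eta> - wedge (\<theta> t) y" unfolding \<eta>(2)[symmetric] by (simp only: add_diff_cancel_right')
    then have "x = dd (\<eta> - wedge (\<theta> t) ?c)"
      unfolding y_eq dd_diff dd_wedge_\<theta>[OF t] using wedge_diff[of "\<theta> t" 0 "dd ?c"] by (simp only: diff_0 wedge_0)
    then have "x \<in> inv_coboundaries H ?T n"
      unfolding inv_coboundaries_def using remainder_inv_forms[OF t S \<eta>(1)] by blast
    ultimately show ?thesis by blast
  qed
qed

text \<open>Pascal's rule, as multiplication of a generating series by one more factor 1 +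
  t.\<close>

lemma pascal_convolution:
  fixes s :: "int \<Rightarrow> nat"
  shows "(\<Sum>p\<le>k. (k choose p) * s (n - int p)) + (\<Sum>p\<le>k. (k choose p) * s (n - 1 - int p)) =
    (\<Sum>p\<le>Suc k. (Suc k choose p) * s (n - int p))"
proof -
  have "(\<Sum>p\<le>Suc k. (Suc k choose p) * s (n - int p)) =
      s n + (\<Sum>p\<le>k. (Suc k choose Suc p) * s (n - int (Suc p)))"
    unfolding sum.atMost_Suc_shift by simp
  also have "\<dots> = s n + (\<Sum>p\<le>k. (k choose Suc p) * s (n - int (Suc p))) + (\<Sum>p\<le>k. (k choose p) * s (n - 1 - int p))"
    by (simp add: algebra_simps sum.distrib)
  also have "s n + (\<Sum>p\<le>k. (k choose Suc p) * s (n - int (Suc p))) = (\<Sum>p\<le>Suc k. (k choose p) * s (n - int p))"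
    unfolding sum.atMost_Suc_shift by simp
  also have "\<dots> = (\<Sum>p\<le>k. (k choose p) * s (n - int p))" by simp
  finally show ?thesis by simp
qed

theorem quotient_dim_torus:
  assumes base: "\<And>n. fn.quotient_dim (inv_cocycles H (h ` D) n) (inv_coboundaries H (h ` D) n) (s n)"
  shows "fn.quotient_dim (inv_cocycles H {} n) (inv_coboundaries H {} n) (\<Sum>p\<le>card D. (card D choose p) * s (n - int p))"
proof -
  \<comment> \<open>Induction on the set \<open>S\<close> of indices whose horizontality condition
    has been lifted; those in \<open>D - S\<close> are still in force.\<close>
  have "fn.quotient_dim (inv_cocycles H (h ` (D - S)) n) (inv_coboundaries H (h ` (D - S)) n)
      (\<Sum>p\<le>card S. (card S choose p) * s (n - int p))" if "finite S" "S \<subseteq> D" for S n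
    using that
  proof (induction S arbitrary: n)
    case empty
    have 1: "(\<Sum>p\<le>card {}. (card {} choose p) * s (n - int p)) = s n" by simp
    show ?case unfolding Diff_empty 1 by (rule base)
  next
    case (insert t S)
    have eq: "insert t (D - insert t S) = D - S" using insert by auto
    have S: "S \<subseteq> D" using insert.prems by simp
    have "fn.quotient_dim (inv_cocycles H (h ` (D - insert t S)) n) (inv_coboundaries H (h ` (D - insert t S)) n)
        ((\<Sum>p\<le>card S. (card S choose p) * s (n - int p)) + (\<Sum>p\<le>card S. (card S choose p) * s (n - 1 - int p)))"
    proof (rule quotient_dim_insert[where t = t and S = "D - insert t S", unfolded eq])
      show "fn.quotient_dim (inv_cocycles H (h ` (D - S)) n) (inv_coboundaries H (h ` (D - S)) n)
        (\<Sum>p\<le>card S. (card S choose p) * s (n - int p))" by (rule insert.IH[OF S])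
      show "fn.quotient_dim (inv_cocycles H (h ` (D - S)) (n - 1)) (inv_coboundaries H (h ` (D - S)) (n - 1))
        (\<Sum>p\<le>card S. (card S choose p) * s (n - 1 - int p))" by (rule insert.IH[OF S])
    qed (use insert in auto)
    moreover have "card (insert t S) = Suc (card S)" using insert.hyps by simp
    ultimately show ?case by (simp only: pascal_convolution)
  qed
  from this[OF finite_D subset_refl] show ?thesis by (simp only: Diff_cancel image_empty)
qed

end

section \<open>Chains and the simplicial complex\<close>

text \<open>The alternating sum over faces, on arbitrary lists, as a recursion parallel to that of
  \<open>dd\<close>: deletion of the first vertex takes the place of the Lie derivative. The
  parallel makes the comparison with forms an induction.\<close>

primrec cob :: "('a list \<Rightarrow> 'k::field) \<Rightarrow> 'a list \<Rightarrow> 'k" where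
  "cob c [] = 0"
| "cob c (x # xs) = c xs - cob (contract x c) xs"

lemma cob_eq_sum: "cob c xs = (\<Sum>i<length xs. (-1) ^ i * c (nths xs (- {i})))"
proof (induction xs arbitrary: c)
  case (Cons x xs)
  show ?case
    unfolding length_Cons sum.lessThan_Suc_shift cob.simps Cons.IH by (simp add: nths_Cons_omit sum_negf)
qed simp

lemma cob_diff: "cob (c - d) xs = cob c xs - cob d xs"
  by (simp add: cob_eq_sum algebra_simps sum_subtractf)

text \<open>The argument of \<open>dd_dd\<close>, with the cochain itself in place of its Lie
  derivative.\<close>

lemma cob_cob: "cob (cob c) xs = 0"
proof (induction xs arbitrary: c)
  case (Cons x xs)
  have "contract x (cob c) = c - cob (contract x c)" by (rule ext) simp
  then have "cob (contract x (cob c)) xs = cob c xs - cob (cob (contract x c)) xs" by (simp only: cob_diff)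
  then show ?case using Cons.IH[of "contract x c"] by simp
qed simp

lemma coboundary_eq_cob: "coboundary K n c xs = (if xs \<in> simplices K (n + 1) then cob c xs else 0)"
  by (simp add: coboundary_def cob_eq_sum)

lemma length_nths_omit: "i < length xs \<Longrightarrow> length (nths xs (- {i})) = length xs - 1"
proof (induction xs arbitrary: i)
  case (Cons x xs)
  then show ?case by (cases i) (auto simp: nths_Cons_omit)
qed simp

text \<open>All faces of a simplex are simplices, so on simplices the cut-off in
  \<open>coboundary\<close> is invisible and \<open>cob_cob\<close> applies.\<close>

lemma coboundary_coboundary:
  fixes c :: "'a list \<Rightarrow> 'b::field"
  assumes closed: "\<And>xs i. xs \<in> K \<Longrightarrow> nths xs (- {i}) \<in> K"
  shows "coboundary K (n + 1) (coboundary K n c) = 0"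
proof
  fix xs
  show "coboundary K (n + 1) (coboundary K n c) xs = 0 xs"
  proof (cases "xs \<in> simplices K (n + 1 + 1)")
    case True
    have "coboundary K (n + 1) d xs = (\<Sum>i<length xs. (-1) ^ i * d (nths xs (- {i})))" for d :: "'a list \<Rightarrow> 'b"
      using True by (simp only: coboundary_def if_True)
    then have "coboundary K (n + 1) (coboundary K n c) xs = (\<Sum>i<length xs. (-1) ^ i * coboundary K n c (nths xs (- {i})))" .
    also have "\<dots> = (\<Sum>i<length xs. (-1) ^ i * cob c (nths xs (- {i})))"
    proof (rule sum.cong[OF refl])
      fix i assume "i \<in> {..<length xs}"
      then have "length (nths xs (- {i})) = length xs - 1" "length xs > 0" by (auto simp: length_nths_omit)
      moreover have "xs \<in> K" "int (length xs) = n + 1 + 1 + 1" using True unfolding simplices_def by blast+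
      moreover have "nths xs (- {i}) \<in> K" by (rule closed) fact
      ultimately have "nths xs (- {i}) \<in> simplices K (n + 1)"
        unfolding simplices_def mem_Collect_eq by linarith
      then show "(-1) ^ i * coboundary K n c (nths xs (- {i})) = (-1) ^ i * cob c (nths xs (- {i}))"
        by (simp add: coboundary_eq_cob)
    qed
    also have "\<dots> = 0" unfolding cob_eq_sum[symmetric] by (rule cob_cob)
    finally show ?thesis by simp
  qed (simp add: coboundary_def)
qed

lemma cob_add: "cob (c + d) xs = cob c xs + cob d xs"
  by (simp add: cob_eq_sum algebra_simps sum.distrib)

lemma cob_fscale: "cob (fscale a c) xs = a * cob c xs"
  unfolding cob_eq_sum sum_distrib_left by (rule sum.cong) (simp_all add: fscale_def)

lemma cob_0: "cob 0 xs = 0"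
  by (simp add: cob_eq_sum)

lemma coboundary_add: "coboundary K n (c + d) = coboundary K n c + coboundary K n d"
  by (rule ext) (simp add: coboundary_eq_cob cob_add)

lemma coboundary_fscale: "coboundary K n (fscale a c) = fscale a (coboundary K n c)"
  by (rule ext) (simp add: coboundary_eq_cob cob_fscale, simp add: fscale_def coboundary_eq_cob)

lemma coboundary_0: "coboundary K n 0 = 0"
  by (rule ext) (simp add: coboundary_eq_cob cob_0)

lemma coboundary_diff: "coboundary K n (c - d) = coboundary K n c - coboundary K n d"
  by (rule ext) (simp add: coboundary_eq_cob cob_diff)

lemma coboundary_cochain: "coboundary K n c \<in> simplicial_cochains K (n + 1)"
  by (simp add: simplicial_cochains_def coboundary_def)

lemma simplicial_cochains_subspace: "fun_vs.subspace (simplicial_cochains K n)"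
  by (rule fun_vs.subspaceI) (auto simp: simplicial_cochains_def fscale_def)

section \<open>Simplicial cocycles and coboundaries as subspaces\<close>

definition simplicial_cocycles :: "'a list set \<Rightarrow> int \<Rightarrow> ('a list \<Rightarrow> 'k::field) set"
  where "simplicial_cocycles K n = {c \<in> simplicial_cochains K n. coboundary K n c = 0}"

definition simplicial_coboundaries :: "'a list set \<Rightarrow> int \<Rightarrow> ('a list \<Rightarrow> 'k::field) set"
  where "simplicial_coboundaries K n = coboundary K (n - 1) ` simplicial_cochains K (n - 1)"

lemma simplicial_cocycles_subspace: "fun_vs.subspace (simplicial_cocycles K n)"
proof (rule fun_vs.subspaceI)
  note sub = simplicial_cochains_subspace[of K n]
  show "0 \<in> simplicial_cocycles K n" unfolding simplicial_cocycles_def using fun_vs.subspace_0[OF sub] coboundary_0 by blast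
  show "c + d \<in> simplicial_cocycles K n" if "c \<in> simplicial_cocycles K n" "d \<in> simplicial_cocycles K n" for c d
    using that fun_vs.subspace_add[OF sub, of c d] unfolding simplicial_cocycles_def mem_Collect_eq coboundary_add by simp
  show "fscale a c \<in> simplicial_cocycles K n" if "c \<in> simplicial_cocycles K n" for a c
    using that fun_vs.subspace_scale[OF sub, of c a] fun_vs.scale_zero_right
    unfolding simplicial_cocycles_def mem_Collect_eq coboundary_fscale by simp
qed

lemma simplicial_coboundaries_subspace: "fun_vs.subspace (simplicial_coboundaries K n)"
proof (rule fun_vs.subspaceI)
  note sub = simplicial_cochains_subspace[of K "n - 1"]
  show "0 \<in> simplicial_coboundaries K n" unfolding simplicial_coboundaries_def
    by (rule image_eqI[where x = 0]) (simp_all only: coboundary_0 fun_vs.subspace_0[OF sub])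
  show "c + d \<in> simplicial_coboundaries K n" if prem: "c \<in> simplicial_coboundaries K n" "d \<in> simplicial_coboundaries K n" for c d
  proof -
    obtain c' d' where "c' \<in> simplicial_cochains K (n - 1)" "c = coboundary K (n - 1) c'"
      "d' \<in> simplicial_cochains K (n - 1)" "d = coboundary K (n - 1) d'"
      using prem unfolding simplicial_coboundaries_def by blast
    then show ?thesis unfolding simplicial_coboundaries_def
      by (intro image_eqI[of _ _ "c' + d'"] fun_vs.subspace_add[OF sub]) (simp_all only: coboundary_add)
  qed
  show "fscale a c \<in> simplicial_coboundaries K n" if prem: "c \<in> simplicial_coboundaries K n" for a c
  proof -
    obtain c' where "c' \<in> simplicial_cochains K (n - 1)" "c = coboundary K (n - 1) c'"
      using prem unfolding simplicial_coboundaries_def by blast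
    then show ?thesis unfolding simplicial_coboundaries_def
      by (intro image_eqI[of _ _ "fscale a c'"] fun_vs.subspace_scale[OF sub]) (simp_all only: coboundary_fscale)
  qed
qed

lemma simplicial_coboundaries_cocycles:
  assumes "\<And>xs i. xs \<in> K \<Longrightarrow> nths xs (- {i}) \<in> K"
  shows "simplicial_coboundaries K n \<subseteq> simplicial_cocycles K n"
proof
  fix c assume "c \<in> simplicial_coboundaries K n"
  then obtain d where d: "c = coboundary K (n - 1) d" unfolding simplicial_coboundaries_def by blast
  have e: "n - 1 + 1 = n" by simp
  have "coboundary K (n - 1 + 1) (coboundary K (n - 1) d) = 0"
    by (rule coboundary_coboundary) (rule assms)
  moreover have "coboundary K (n - 1) d \<in> simplicial_cochains K (n - 1 + 1)" by (rule coboundary_cochain)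
  ultimately show "c \<in> simplicial_cocycles K n" unfolding simplicial_cocycles_def d e by blast
qed

lemma simplicial_cochains_span:
  assumes "finite (simplices K n)"
  shows "simplicial_cochains K n \<subseteq> fun_vs.span (basis_vec ` simplices K n)"
proof
  fix c :: "'a list \<Rightarrow> 'k::field" assume c: "c \<in> simplicial_cochains K n"
  have "{x. c x \<noteq> 0} \<subseteq> simplices K n" using c by (auto simp: simplicial_cochains_def)
  then have "c \<in> free_space (simplices K n)" using assms by (auto simp: free_space_def intro: finite_subset)
  then have e: "c = (\<Sum>x | c x \<noteq> 0. fscale (c x) (basis_vec x))" by (rule free_space_expand)
  have "(\<Sum>x | c x \<noteq> 0. fscale (c x) (basis_vec x)) \<in> fun_vs.span (basis_vec ` simplices K n)"
    using \<open>{x. c x \<noteq> 0} \<subseteq> _\<close> by (intro fun_vs.span_sum fun_vs.span_scale fun_vs.span_base) auto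
  then show "c \<in> fun_vs.span (basis_vec ` simplices K n)" unfolding e[symmetric] .
qed

lemma has_dim_simplicial_cohomology:
  assumes closed: "\<And>xs i. xs \<in> K \<Longrightarrow> nths xs (- {i}) \<in> K"
    and "fun_scaled.quotient_dim (simplicial_cocycles K n :: ('a list \<Rightarrow> 'k::field) set) (simplicial_coboundaries K n) m"
  shows "has_dim (simplicial_cohomology K n :: ('k::field, ('a list \<Rightarrow> 'k) set) module) m"
proof -
  have "simplicial_coboundaries K n \<subseteq> (simplicial_cocycles K n :: ('a list \<Rightarrow> 'k) set)"
    by (rule simplicial_coboundaries_cocycles) (rule closed)
  from fun_scaled.has_dim_quotient[OF simplicial_cocycles_subspace simplicial_coboundaries_subspace this assms(2)]
  show ?thesis
    unfolding simplicial_cohomology_def simplicial_cocycles_def simplicial_coboundaries_def .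
qed

lemma quotient_dim_simplicial_exists:
  assumes closed: "\<And>xs i. xs \<in> K \<Longrightarrow> nths xs (- {i}) \<in> K" and fin: "finite (simplices K n)"
  shows "\<exists>m. fun_scaled.quotient_dim (simplicial_cocycles K n :: ('a list \<Rightarrow> 'k::field) set) (simplicial_coboundaries K n) m"
proof (rule fun_scaled.quotient_dim_exists[OF simplicial_cocycles_subspace simplicial_coboundaries_subspace])
  show "simplicial_coboundaries K n \<subseteq> (simplicial_cocycles K n :: ('a list \<Rightarrow> 'k) set)"
    by (rule simplicial_coboundaries_cocycles) (rule closed)
  show "finite (basis_vec ` simplices K n :: ('a list \<Rightarrow> 'k) set)" using fin by simp
  show "simplicial_cocycles K n \<subseteq> fun_vs.span (basis_vec ` simplices K n :: ('a list \<Rightarrow> 'k) set)"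
    using simplicial_cochains_span[OF fin] unfolding simplicial_cocycles_def by blast
qed

section \<open>Edges of vertex lists\<close>

fun chain_edges :: "'a list \<Rightarrow> ('a \<times> 'a) list" where
  "chain_edges (a # b # vs) = (a, b) # chain_edges (b # vs)"
| "chain_edges _ = []"

lemma length_chain_edges: "length (chain_edges vs) = length vs - 1"
  by (induction vs rule: chain_edges.induct) auto

lemma chain_edges_subset: "set (chain_edges vs) \<subseteq> set vs \<times> set vs"
  by (induction vs rule: chain_edges.induct) auto

text \<open>A single vertex has no edges, hence the bound on the length.\<close>

lemma set_eq_chain_edges: "length vs \<ge> 2 \<Longrightarrow> set vs = fst ` set (chain_edges vs) \<union> snd ` set (chain_edges vs)"
proof (induction vs rule: chain_edges.induct)
  case (1 a b vs)
  show ?case by (cases vs) (use 1 in auto)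
qed auto

text \<open>Applied to indicator functions it says that the weights of the edges of a chain add up
  to the weight of the pair of its end points.\<close>

lemma sum_list_telescope:
  fixes f :: "'a \<Rightarrow> 'b::ab_group_add"
  shows "vs \<noteq> [] \<Longrightarrow> (\<Sum>p\<leftarrow>chain_edges vs. f (fst p) - f (snd p)) = f (hd vs) - f (last vs)"
  by (induction vs rule: chain_edges.induct) auto

lemma sorted_wrt_nths: "sorted_wrt P xs \<Longrightarrow> sorted_wrt P (nths xs A)"
proof (induction xs arbitrary: A)
  case (Cons x xs)
  then show ?case using set_nths_subset[of xs] by (auto simp: nths_Cons)
qed simp

section \<open>Chains, paths and weights in a finite poset\<close>

locale finite_poset =
  fixes N :: nat and r :: "(nat \<times> nat) set"
  assumes N: "N \<ge> 1" and po: "partial_order_on {1..N} r"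
begin

lemma r_refl: "i \<in> {1..N} \<Longrightarrow> (i, i) \<in> r"
  using partial_order_onD(1)[OF po] by (simp only: refl_on_def)

lemma r_trans: "(i, j) \<in> r \<Longrightarrow> (j, k) \<in> r \<Longrightarrow> (i, k) \<in> r"
  by (rule transD[OF partial_order_onD(2)[OF po]])

lemma r_antisym: "(i, j) \<in> r \<Longrightarrow> (j, i) \<in> r \<Longrightarrow> i = j"
  by (rule antisymD[OF partial_order_onD(3)[OF po]])

lemma r_sub: "r \<subseteq> {1..N} \<times> {1..N}"
  by (rule partial_order_onD(4)[OF po])

lemma finite_r: "finite r"
  using r_sub by (rule finite_subset) simp

definition strict :: "nat \<Rightarrow> nat \<Rightarrow> bool"
  where "strict i j \<longleftrightarrow> (i, j) \<in> r \<and> i \<noteq> j"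

lemma strict_trans: "strict i j \<Longrightarrow> strict j k \<Longrightarrow> strict i k"
  unfolding strict_def using r_trans r_antisym by blast

lemma strict_sub: "strict i j \<Longrightarrow> i \<in> {1..N} \<and> j \<in> {1..N}"
  unfolding strict_def using r_sub by blast

definition chain :: "nat list \<Rightarrow> bool"
  where "chain vs \<longleftrightarrow> set vs \<subseteq> {1..N} \<and> sorted_wrt strict vs"

abbreviation K :: "nat list set"
  where "K \<equiv> augment (nerve N r)"

lemma K_eq: "vs \<in> K \<longleftrightarrow> chain vs"
proof -
  have "strict = (\<lambda>i j. (i, j) \<in> r \<and> i \<noteq> j)" by (intro ext) (simp add: strict_def)
  then show ?thesis by (auto simp: augment_def nerve_def chain_def)
qed

lemma chain_Cons: "chain (v # vs) \<longleftrightarrow> v \<in> {1..N} \<and> (\<forall>w\<in>set vs. strict v w) \<and> chain vs"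
  by (auto simp: chain_def)

lemma chain_ConsI: "strict v w \<Longrightarrow> chain (w # vs) \<Longrightarrow> chain (v # w # vs)"
  unfolding chain_Cons using strict_trans strict_sub by auto

lemma K_closed: "xs \<in> K \<Longrightarrow> nths xs (- {i}) \<in> K"
  unfolding K_eq chain_def using set_nths_subset[of xs "- {i}"] sorted_wrt_nths[of strict xs "- {i}"] by blast

lemma chain_distinct: "chain vs \<Longrightarrow> distinct vs"
  by (induction vs) (auto simp: chain_Cons strict_def)

lemma simplices_K: "vs \<in> simplices K n \<longleftrightarrow> chain vs \<and> int (length vs) = n + 1"
  by (simp add: simplices_def K_eq)

lemma finite_simplices: "finite (simplices K n)"
proof (rule finite_subset)
  show "simplices K n \<subseteq> {vs. set vs \<subseteq> {1..N} \<and> length vs = nat (n + 1)}"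
  proof
    fix vs assume "vs \<in> simplices K n"
    then have "set vs \<subseteq> {1..N}" "int (length vs) = n + 1" by (simp_all add: simplices_K chain_def)
    then show "vs \<in> {vs. set vs \<subseteq> {1..N} \<and> length vs = nat (n + 1)}" by (simp flip: \<open>int (length vs) = n + 1\<close>)
  qed
  show "finite {vs. set vs \<subseteq> {1..N} \<and> length vs = nat (n + 1)}" by (rule finite_lists_length_eq) simp
qed

lemma chain_edges_strict: "chain vs \<Longrightarrow> (a, b) \<in> set (chain_edges vs) \<Longrightarrow> strict a b"
  by (induction vs rule: chain_edges.induct) (auto simp: chain_Cons)

lemma chain_edges_distinct: "chain vs \<Longrightarrow> distinct (chain_edges vs)"
proof (induction vs rule: chain_edges.induct)
  case (1 a b vs)
  have "(a, b) \<notin> set (chain_edges (b # vs))"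
    using chain_edges_subset[of "b # vs"] chain_distinct[OF 1(2)] by auto
  then show ?case using 1 by (simp add: chain_Cons)
qed auto

lemma chain_hd_last: "chain vs \<Longrightarrow> length vs \<ge> 2 \<Longrightarrow> strict (hd vs) (last vs)"
  by (cases vs) (auto simp: chain_Cons)

text \<open>Both first vertices are the least element of the same set.\<close>

lemma chain_unique: "chain vs \<Longrightarrow> chain ws \<Longrightarrow> set vs = set ws \<Longrightarrow> vs = ws"
proof (induction vs arbitrary: ws)
  case (Cons v vs)
  obtain w ws' where ws: "ws = w # ws'" using Cons.prems(3) by (cases ws) auto
  have "v = w"
  proof (rule ccontr)
    assume "v \<noteq> w"
    then have "v \<in> set ws'" "w \<in> set vs" using Cons.prems(3) ws by auto
    then have "strict w v" "strict v w" using Cons.prems ws by (auto simp: chain_Cons)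
    then show False using r_antisym by (auto simp: strict_def)
  qed
  moreover have "v \<notin> set vs" "w \<notin> set ws'"
    using chain_distinct[OF Cons.prems(1)] chain_distinct[OF Cons.prems(2)] ws by auto
  ultimately have "set vs = set ws'" using Cons.prems(3) ws by auto
  then show ?case using Cons.IH[of ws'] Cons.prems ws \<open>v = w\<close> by (simp add: chain_Cons)
qed simp

lemma chain_edges_unique:
  assumes "chain vs" and "chain ws" and "length vs \<ge> 2" and "length ws \<ge> 2"
    and "set (chain_edges vs) = set (chain_edges ws)"
  shows "vs = ws"
proof (rule chain_unique[OF assms(1,2)])
  show "set vs = set ws"
    unfolding set_eq_chain_edges[OF assms(3)] set_eq_chain_edges[OF assms(4)] assms(5) ..
qed

text \<open>The eigenvalue of ad E_ii on the matrix unit at position \<open>p\<close>, kept as an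
  integer so that paths are found before anything is read in the field.\<close>

definition weight :: "nat \<Rightarrow> nat \<times> nat \<Rightarrow> int"
  where "weight i p = of_bool (fst p = i) - of_bool (snd p = i)"

text \<open>A minimal element among the sources cannot be a target, since the source of such an edge
  would be smaller.\<close>

lemma minimal_source:
  assumes "S \<noteq> {}" and "\<And>p. p \<in> S \<Longrightarrow> strict (fst p) (snd p)"
  shows "\<exists>p\<in>S. \<forall>q\<in>S. snd q \<noteq> fst p"
proof -
  have wf: "wf (r - Id)" by (rule partial_order_on_well_order_on[OF finite_r po])
  obtain p0 where p0: "p0 \<in> S" using assms(1) by blast
  have "\<exists>m\<in>fst ` S. \<forall>y. (y, m) \<in> r - Id \<longrightarrow> y \<notin> fst ` S"
    using wf imageI[OF p0, of fst] unfolding wf_eq_minimal by (elim allE impE)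
  then obtain m where m: "m \<in> fst ` S" "\<forall>y. (y, m) \<in> r - Id \<longrightarrow> y \<notin> fst ` S" by (rule bexE)
  obtain p where p: "m = fst p" "p \<in> S" using m(1) by (rule imageE)
  have "snd q \<noteq> fst p" if q: "q \<in> S" for q
  proof
    assume "snd q = fst p"
    then have "m = snd q" using p(1) by (simp only:)
    then have "(fst q, m) \<in> r - Id" using assms(2)[OF q] by (cases q) (simp add: strict_def)
    then have "fst q \<notin> fst ` S" using m(2) by (elim allE impE)
    then show False using imageI[OF q, of fst] by (rule notE)
  qed
  then have "\<forall>q\<in>S. snd q \<noteq> fst p" by (rule ballI)
  then show ?thesis using p(2) by (rule bexI)
qed

text \<open>Since the order is acyclic, a set of edges with the boundary of a path is a path: a minimal
  source has no incoming edge, so it must be \<open>a\<close>.\<close>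

lemma balanced_path:
  "card S = n \<Longrightarrow> finite S \<Longrightarrow> \<forall>p\<in>S. strict (fst p) (snd p) \<Longrightarrow> a \<in> {1..N} \<Longrightarrow>
    \<forall>i. weight i (a, b) = sum (weight i) S \<Longrightarrow>
    \<exists>vs. chain (a # vs) \<and> last (a # vs) = b \<and> set (chain_edges (a # vs)) = S"
proof (induction n arbitrary: S a)
  case 0
  have S: "S = {}" using 0(1,2) by simp
  have "weight a (a, b) = 0" using spec[OF 0(5), of a] unfolding S sum.empty .
  then have "a = b" by (cases "a = b") (simp_all add: weight_def)
  have "chain [a]" using 0(4) by (simp add: chain_def)
  then show ?case using S \<open>a = b\<close> by (intro exI[of _ "[]"]) simp
next
  case (Suc n)
  have fin: "finite S" by (rule Suc.prems(2))
  have str: "strict (fst p) (snd p)" if "p \<in> S" for p by (rule bspec[OF Suc.prems(3) that])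
  have "S \<noteq> {}" using Suc.prems(1) by (metis card.empty nat.distinct(1))
  then obtain p where p: "p \<in> S" "\<And>q. q \<in> S \<Longrightarrow> snd q \<noteq> fst p"
    using minimal_source[of S] str by blast
  have w1: "weight (fst p) p = 1" using p(2)[OF p(1)] by (simp add: weight_def)
  \<comment> \<open>No edge of \<open>S\<close> ends in the source of \<open>p\<close>, so all
    weights there are nonnegative and that of \<open>p\<close> is 1. For the pair
    \<open>(a, b)\<close> only the vertex \<open>a\<close> can have positive weight.\<close>
  have "weight (fst p) p \<le> sum (weight (fst p)) S"
  proof (rule member_le_sum[OF p(1) _ fin])
    fix q assume "q \<in> S - {p}"
    then show "0 \<le> weight (fst p) q" using p(2)[of q] by (simp add: weight_def)
  qed
  then have "1 \<le> weight (fst p) (a, b)" unfolding spec[OF Suc.prems(5), of "fst p"] w1 .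
  then have fst_p: "fst p = a" by (cases "fst p = a"; cases "fst p = b") (auto simp: weight_def)
  define v where "v = snd p"
  have pv: "p = (a, v)" using fst_p by (simp add: v_def prod_eq_iff)
  have av: "strict a v" using str[OF p(1)] pv by simp
  \<comment> \<open>Without the edge from \<open>a\<close> to \<open>v\<close> the set has the
    boundary of a path from \<open>v\<close> to \<open>b\<close>.\<close>
  have "\<exists>vs. chain (v # vs) \<and> last (v # vs) = b \<and> set (chain_edges (v # vs)) = S - {p}"
  proof (rule Suc.IH)
    show "card (S - {p}) = n" using Suc.prems(1) p(1) fin by simp
    show "finite (S - {p})" using fin by simp
    show "\<forall>q\<in>S - {p}. strict (fst q) (snd q)" using str by blast
    show "v \<in> {1..N}" using strict_sub[OF av] by simp
    show "\<forall>i. weight i (v, b) = sum (weight i) (S - {p})"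
    proof
      fix i show "weight i (v, b) = sum (weight i) (S - {p})"
      using spec[OF Suc.prems(5), of i] sum.remove[OF fin p(1), of "weight i"] by (simp add: weight_def pv)
    qed
  qed
  then obtain vs where vs: "chain (v # vs)" "last (v # vs) = b" "set (chain_edges (v # vs)) = S - {p}" by blast
  have "set (chain_edges (a # v # vs)) = S" using vs(3) p(1) pv by auto
  then show ?case
    using vs(2) chain_ConsI[OF av vs(1)] by (intro exI[of _ "v # vs"] conjI) simp_all
qed

text \<open>An edge at \<open>i\<close> is determined by its other end, as antisymmetry excludes
  both directions; so at most N - 1 edges contribute, each by at most 1 in absolute value.\<close>

lemma weight_sum_bound:
  assumes "\<And>p. p \<in> S \<Longrightarrow> strict (fst p) (snd p)" and "i \<in> {1..N}"
  shows "\<bar>\<Sum>p\<in>S. weight i p\<bar> \<le> int N - 1"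
proof -
  have fin: "finite S"
    by (rule finite_subset[OF _ finite_r]) (use assms(1) in \<open>auto simp: strict_def\<close>)
  let ?A = "{p \<in> S. fst p = i \<or> snd p = i}"
  let ?f = "\<lambda>p. if fst p = i then snd p else fst p"
  have "\<bar>\<Sum>p\<in>S. weight i p\<bar> \<le> (\<Sum>p\<in>S. \<bar>weight i p\<bar>)" by (rule sum_abs)
  also have "\<dots> \<le> (\<Sum>p\<in>S. of_bool (fst p = i \<or> snd p = i))"
    by (rule sum_mono) (auto simp: weight_def)
  also have "\<dots> = int (card ?A)" by (subst sum_of_bool_eq) (simp_all add: fin Int_def)
  also have "card ?A \<le> card ({1..N} - {i})"
  proof (rule card_inj_on_le)
    show "inj_on ?f ?A"
    proof (rule inj_onI)
      fix p q assume pq: "p \<in> ?A" "q \<in> ?A" "?f p = ?f q"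
      have "strict (fst p) (snd p)" "strict (fst q) (snd q)" using pq assms(1) by auto
      moreover obtain a b c d where "p = (a, b)" "q = (c, d)" by (cases p, cases q)
      ultimately show "p = q" using pq r_antisym[of a b] by (auto simp: strict_def split: if_splits)
    qed
    show "?f ` ?A \<subseteq> {1..N} - {i}"
    proof
      fix x assume "x \<in> ?f ` ?A"
      then obtain p where p: "p \<in> S" "fst p = i \<or> snd p = i" "x = ?f p" by blast
      show "x \<in> {1..N} - {i}"
        using strict_sub[OF assms(1)[OF p(1)]] assms(1)[OF p(1)] p(2,3) unfolding strict_def
        by (cases "fst p = i") simp_all
    qed
  qed simp
  also have "card ({1..N} - {i}) = N - 1" using assms(2) by simp
  finally show ?thesis using N by simp
qed

end

section \<open>The Lie poset algebra\<close>

lemma commutator_apply: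
  "commutator N c d (i, k) = (\<Sum>j\<in>{1..N}. c (i, j) * d (j, k)) - (\<Sum>j\<in>{1..N}. d (i, j) * c (j, k))"
  by (simp add: commutator_def poset_mult_def)

lemma poset_mult_assoc: "poset_mult N (poset_mult N x y) z = poset_mult N x (poset_mult N y z)"
proof
  fix p :: "nat \<times> nat"
  obtain i k where p: "p = (i, k)" by (cases p)
  have "(\<Sum>j\<in>{1..N}. (\<Sum>l\<in>{1..N}. x (i, l) * y (l, j)) * z (j, k)) =
      (\<Sum>j\<in>{1..N}. \<Sum>l\<in>{1..N}. x (i, l) * (y (l, j) * z (j, k)))"
    unfolding sum_distrib_right mult.assoc ..
  also have "\<dots> = (\<Sum>l\<in>{1..N}. \<Sum>j\<in>{1..N}. x (i, l) * (y (l, j) * z (j, k)))" by (rule sum.swap)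
  also have "\<dots> = (\<Sum>l\<in>{1..N}. x (i, l) * (\<Sum>j\<in>{1..N}. y (l, j) * z (j, k)))"
    unfolding sum_distrib_left ..
  finally show "poset_mult N (poset_mult N x y) z p = poset_mult N x (poset_mult N y z) p"
    unfolding p poset_mult_def prod.case .
qed

lemma poset_mult_apply: "poset_mult N x y (i, k) = (\<Sum>j\<in>{1..N}. x (i, j) * y (j, k))"
  by (simp add: poset_mult_def)

lemma poset_mult_add_left: "poset_mult N (x + y) z = poset_mult N x z + poset_mult N y z"
  by (rule ext) (simp add: poset_mult_apply distrib_right sum.distrib split_paired_all)

lemma poset_mult_add_right: "poset_mult N z (x + y) = poset_mult N z x + poset_mult N z y"
  by (rule ext) (simp add: poset_mult_apply distrib_left sum.distrib split_paired_all)

lemma poset_mult_diff_left: "poset_mult N (x - y) z = poset_mult N x z - poset_mult N y z"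
  by (rule ext) (simp add: poset_mult_apply left_diff_distrib sum_subtractf split_paired_all)

lemma poset_mult_diff_right: "poset_mult N z (x - y) = poset_mult N z x - poset_mult N z y"
  by (rule ext) (simp add: poset_mult_apply right_diff_distrib sum_subtractf split_paired_all)

lemma poset_mult_scale_left: "poset_mult N (fscale a x) z = fscale a (poset_mult N x z)"
proof
  fix p :: "nat \<times> nat"
  obtain i k where p: "p = (i, k)" by (cases p)
  show "poset_mult N (fscale a x) z p = fscale a (poset_mult N x z) p"
    unfolding p poset_mult_apply fscale_def sum_distrib_left mult.assoc ..
qed

lemma poset_mult_scale_right: "poset_mult N z (fscale a x) = fscale a (poset_mult N z x)"
proof
  fix p :: "nat \<times> nat"
  obtain i k where p: "p = (i, k)" by (cases p)
  show "poset_mult N z (fscale a x) p = fscale a (poset_mult N z x) p"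
    unfolding p poset_mult_apply fscale_def sum_distrib_left mult.left_commute[of _ a] ..
qed

locale poset_lie = finite_poset N r for N r +
  fixes field_type :: "'k::field itself"
  assumes char: "CHAR('k) = 0 \<or> CHAR('k) > N"
begin

abbreviation g :: "(nat \<times> nat \<Rightarrow> 'k) set"
  where "g \<equiv> lie_poset_algebra N r"

text \<open>A nonzero integer divisible by the characteristic is at least as large in absolute value
  and so exceeds \<open>N\<close>. All uses of the hypothesis on the field pass through
  here.\<close>

lemma of_int_eq_0: "\<bar>z\<bar> \<le> int N \<Longrightarrow> (of_int z :: 'k) = 0 \<Longrightarrow> z = 0"
proof -
  assume z: "\<bar>z\<bar> \<le> int N" "(of_int z :: 'k) = 0"
  have "(of_nat (nat \<bar>z\<bar>) :: 'k) = 0" using z(2) by (cases "z \<ge> 0") simp_all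
  then have d: "CHAR('k) dvd nat \<bar>z\<bar>" by (simp only: of_nat_eq_0_iff_char_dvd)
  show "z = 0"
  proof (rule ccontr)
    assume "z \<noteq> 0"
    then have "nat \<bar>z\<bar> > 0" by simp
    then have "CHAR('k) \<le> nat \<bar>z\<bar>" "CHAR('k) \<noteq> 0" using dvd_imp_le[OF d] d by auto
    then show False using char z(1) by linarith
  qed
qed

lemma N_nonzero: "(of_nat N :: 'k) \<noteq> 0"
  using of_int_eq_0[of "int N"] N by auto

lemma g_support: "x \<in> g \<Longrightarrow> p \<notin> r \<Longrightarrow> x p = 0"
  unfolding lie_poset_algebra_def poset_algebra_def by blast

lemma g_trace: "x \<in> g \<Longrightarrow> (\<Sum>i\<in>{1..N}. x (i, i)) = 0"
  by (simp add: lie_poset_algebra_def)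

lemma gI: "(\<And>p. p \<notin> r \<Longrightarrow> x p = 0) \<Longrightarrow> (\<Sum>i\<in>{1..N}. x (i, i)) = 0 \<Longrightarrow> x \<in> g"
  by (simp add: lie_poset_algebra_def poset_algebra_def)

lemma g_subspace: "fun_vs.subspace g"
proof (rule fun_vs.subspaceI)
  show "0 \<in> g" by (rule gI) simp_all
  show "x + y \<in> g" if "x \<in> g" "y \<in> g" for x y
    by (rule gI) (simp_all add: g_support[OF that(1)] g_support[OF that(2)] sum.distrib g_trace[OF that(1)] g_trace[OF that(2)] del: One_nat_def)
  show "fscale a x \<in> g" if "x \<in> g" for a x
    by (rule gI) (simp_all add: g_support[OF that] fscale_def sum_distrib_left[symmetric] g_trace[OF that] del: One_nat_def)
qed

text \<open>By antisymmetry only \<open>j = t\<close> contributes to this entry, where the two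
  products agree. Hence the diagonal coordinates vanish on brackets and are closed 1-forms.\<close>

lemma commutator_diagonal:
  assumes "x \<in> g" and "y \<in> g"
  shows "commutator N x y (t, t) = 0"
proof -
  have "x (t, j) * y (j, t) = y (t, j) * x (j, t)" for j
  proof (cases "j = t")
    case False
    then have "(t, j) \<notin> r \<or> (j, t) \<notin> r" using r_antisym by blast
    then show ?thesis using g_support[OF assms(1)] g_support[OF assms(2)] by (elim disjE) simp_all
  qed simp
  then show ?thesis unfolding commutator_apply by simp
qed

lemma commutator_closed:
  assumes "x \<in> g" and "y \<in> g"
  shows "commutator N x y \<in> g"
proof (rule gI)
  fix p assume p: "p \<notin> r"
  obtain i k where ik: "p = (i, k)" by (cases p)
  have z: "x (i, j) * y (j, k) = 0" "y (i, j) * x (j, k) = 0" for j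
  proof -
    have "(i, j) \<notin> r \<or> (j, k) \<notin> r" using p ik r_trans by blast
    then show "x (i, j) * y (j, k) = 0" "y (i, j) * x (j, k) = 0"
      using g_support[OF assms(1)] g_support[OF assms(2)] by (elim disjE, simp_all)+
  qed
  show "commutator N x y p = 0" unfolding ik commutator_apply z by simp
next
  show "(\<Sum>i\<in>{1..N}. commutator N x y (i, i)) = 0" unfolding commutator_diagonal[OF assms] by simp
qed

sublocale lie_forms fscale g "commutator N"
proof
  fix x y z :: "nat \<times> nat \<Rightarrow> 'k" and a
  show "commutator N (x + y) z = commutator N x z + commutator N y z"
    unfolding commutator_def poset_mult_add_left poset_mult_add_right by (rule ext) simp
  show "commutator N x (y + z) = commutator N x y + commutator N x z"
    unfolding commutator_def poset_mult_add_left poset_mult_add_right by (rule ext) simp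
  show "commutator N (fscale a x) y = fscale a (commutator N x y)"
    unfolding commutator_def poset_mult_scale_left poset_mult_scale_right by (rule ext) (simp add: fscale_def right_diff_distrib)
  show "commutator N x (fscale a y) = fscale a (commutator N x y)"
    unfolding commutator_def poset_mult_scale_left poset_mult_scale_right by (rule ext) (simp add: fscale_def right_diff_distrib)
  show "commutator N x x = 0" unfolding commutator_def by (rule diff_self)
  show "commutator N x (commutator N y z) = commutator N (commutator N x y) z + commutator N y (commutator N x z)"
    unfolding commutator_def poset_mult_diff_left poset_mult_diff_right poset_mult_assoc by (rule ext) simp
  show "commutator N x y \<in> g" if "x \<in> g" "y \<in> g" for x y by (rule commutator_closed[OF that])
qed (rule g_subspace)+

text \<open>\<open>E\<^sub>i\<^sub>i - 1/N\<close>: it acts on the algebra as the diagonal matrix unit \<open>E\<^sub>i\<^sub>i\<close>, which has trace one.\<close>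

definition hh :: "nat \<Rightarrow> nat \<times> nat \<Rightarrow> 'k"
  where "hh i = (\<lambda>(u, v). if u = v \<and> u \<in> {1..N} then of_bool (u = i) - inverse (of_nat N) else 0)"

definition unit :: "nat \<times> nat \<Rightarrow> nat \<times> nat \<Rightarrow> 'k"
  where "unit p = (if fst p = snd p then hh (fst p) else basis_vec p)"

text \<open>The difference on the diagonal reflects that the \<open>hh i\<close> sum to zero:
  entries x_ii of sum zero belong to the diagonal part \<Sum> x_ii hh_i, and eliminating hh_1 leaves
  the coefficients x_ii - x_11.\<close>

definition coord :: "nat \<times> nat \<Rightarrow> (nat \<times> nat \<Rightarrow> 'k) \<Rightarrow> 'k"
  where "coord p x = (if fst p = snd p then x p - x (1, 1) else x p)"

text \<open>The position \<open>(1, 1)\<close> is left out because of the linear relation among the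
  \<open>hh i\<close>. The order is arbitrary but fixed.\<close>

definition basis_index :: "(nat \<times> nat) list"
  where "basis_index = (SOME ps. set ps = r - {(1, 1)} \<and> distinct ps)"

lemma basis_index: "set basis_index = r - {(1, 1)}" "distinct basis_index"
proof -
  have "\<exists>ps. set ps = r - {(1, 1)} \<and> distinct ps"
    using finite_distinct_list[of "r - {(1, 1)}"] finite_r by simp
  then have "set basis_index = r - {(1, 1)} \<and> distinct basis_index"
    unfolding basis_index_def by (rule someI_ex)
  then show "set basis_index = r - {(1, 1)}" "distinct basis_index" by simp_all
qed

lemma hh_apply: "hh i (u, v) = (if u = v \<and> u \<in> {1..N} then of_bool (u = i) - inverse (of_nat N) else 0)"
  by (simp add: hh_def)

lemma hh_g: "i \<in> {1..N} \<Longrightarrow> hh i \<in> g"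
proof (rule gI)
  fix p assume "p \<notin> r"
  then show "hh i p = 0" using r_refl by (cases p) (auto simp: hh_apply)
next
  assume i: "i \<in> {1..N}"
  have "(\<Sum>u\<in>{1..N}. hh i (u, u)) = (\<Sum>u\<in>{1..N}. of_bool (u = i) - inverse (of_nat N))"
    by (rule sum.cong) (simp_all add: hh_apply)
  also have "\<dots> = (\<Sum>u\<in>{1..N}. if u = i then 1 else 0) - of_nat N * inverse (of_nat N)"
    unfolding sum_subtractf by (simp add: of_bool_def)
  also have "\<dots> = 0" using i N_nonzero by simp
  finally show "(\<Sum>u\<in>{1..N}. hh i (u, u)) = 0" .
qed

lemma basis_vec_g: "strict u v \<Longrightarrow> basis_vec (u, v) \<in> g"
  by (rule gI) (auto simp: basis_vec_def strict_def intro!: sum.neutral)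

lemma unit_g: "p \<in> r \<Longrightarrow> unit p \<in> g"
  using r_sub hh_g basis_vec_g[of "fst p" "snd p"] by (cases p) (auto simp: unit_def strict_def)

text \<open>On indices up to \<open>N\<close>, \<open>hh i\<close> differs from E_ii by a multiple
  of the identity, which commutes with everything.\<close>

lemma commutator_hh_apply:
  assumes "x \<in> g"
  shows "commutator N (hh i) x p = of_int (weight i p) * x p"
proof -
  obtain u v where p: "p = (u, v)" by (cases p)
  show ?thesis
  proof (cases "u \<in> {1..N} \<and> v \<in> {1..N}")
    case True
    have "(\<Sum>j\<in>{1..N}. hh i (u, j) * x (j, v)) = (\<Sum>j\<in>{1..N}. if j = u then hh i (u, u) * x (u, v) else 0)"
      by (rule sum.cong) (auto simp: hh_apply)
    also have "\<dots> = hh i (u, u) * x (u, v)" using True by simp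
    finally have 1: "(\<Sum>j\<in>{1..N}. hh i (u, j) * x (j, v)) = hh i (u, u) * x (u, v)" .
    have "(\<Sum>j\<in>{1..N}. x (u, j) * hh i (j, v)) = (\<Sum>j\<in>{1..N}. if j = v then x (u, v) * hh i (v, v) else 0)"
      by (rule sum.cong) (auto simp: hh_apply)
    also have "\<dots> = x (u, v) * hh i (v, v)" using True by simp
    finally have 2: "(\<Sum>j\<in>{1..N}. x (u, j) * hh i (j, v)) = x (u, v) * hh i (v, v)" .
    have h: "hh i (u, u) = of_bool (u = i) - inverse (of_nat N)" "hh i (v, v) = of_bool (v = i) - inverse (of_nat N)"
      using True by (simp_all add: hh_apply)
    show ?thesis unfolding p commutator_apply 1 2 weight_def h by (simp add: algebra_simps)
  next
    case False
    then have "p \<notin> r" using p r_sub by auto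
    moreover have "commutator N (hh i) x p = 0"
    proof -
      have x0: "x (u, v) = 0" using \<open>p \<notin> r\<close> p g_support[OF assms] by blast
      have z1: "hh i (u, j) * x (j, v) = 0" for j
        using x0 by (cases "j = u") (simp_all add: hh_apply)
      have z2: "x (u, j) * hh i (j, v) = 0" for j
        using x0 by (cases "j = v") (simp_all add: hh_apply)
      show ?thesis unfolding p commutator_apply z1 z2 by simp
    qed
    ultimately show ?thesis using g_support[OF assms, of p] by simp
  qed
qed

lemma weight_diag: "weight i (u, u) = 0"
  by (simp add: weight_def)

lemma commutator_hh_unit:
  assumes "p \<in> r"
  shows "commutator N (hh i) (unit p) = fscale (of_int (weight i p)) (unit p)"
proof
  fix q
  show "commutator N (hh i) (unit p) q = fscale (of_int (weight i p)) (unit p) q"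
  proof (cases "fst p = snd p")
    case True
    have wp: "weight i p = 0" using True by (simp add: weight_def)
    have "weight i q = 0 \<or> unit p q = 0" using True by (cases q) (auto simp: unit_def hh_apply weight_def)
    then show ?thesis unfolding commutator_hh_apply[OF unit_g[OF assms]] fscale_def wp by auto
  next
    case False
    then show ?thesis
      unfolding commutator_hh_apply[OF unit_g[OF assms]] fscale_def by (simp add: unit_def basis_vec_def)
  qed
qed

lemma functional_coord: "functional (coord p)"
  unfolding functional_def by (simp add: coord_def fscale_def right_diff_distrib)

lemma coord_unit:
  assumes "p \<in> r - {(1, 1)}" and "q \<in> r - {(1, 1)}"
  shows "coord p (unit q) = (if p = q then 1 else 0)"
proof -
  obtain u v where p: "p = (u, v)" by (cases p)
  obtain w x where q: "q = (w, x)" by (cases q)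
  have in_N: "u \<in> {1..N}" "1 \<in> {1..N}" using assms p r_sub N by auto
  show ?thesis
  proof (cases "u = v")
    case True
    show ?thesis
    proof (cases "w = x")
      case True
      then have "w \<noteq> 1" using assms q by auto
      then show ?thesis using \<open>u = v\<close> True in_N by (simp add: p q coord_def unit_def hh_apply)
    next
      case False
      then show ?thesis using \<open>u = v\<close> by (auto simp: p q coord_def unit_def basis_vec_def)
    qed
  next
    case False
    then show ?thesis by (auto simp: p q coord_def unit_def basis_vec_def hh_apply)
  qed
qed

lemma g_expand:
  assumes x: "x \<in> g"
  shows "x = (\<Sum>p\<in>r - {(1, 1)}. fscale (coord p x) (unit p))"
proof
  fix q :: "nat \<times> nat"
  obtain u v where q: "q = (u, v)" by (cases q)
  have fin: "finite (r - {(1, 1)})" using finite_r by simp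
  let ?D = "(\<lambda>i. (i, i)) ` {2..N}"
  have D: "?D \<subseteq> r - {(1, 1)}" using r_refl by auto
  have "x q = (\<Sum>p\<in>r - {(1, 1)}. coord p x * unit p q)"
  proof (cases "u = v")
    case False
    have "(\<Sum>p\<in>r - {(1, 1)}. coord p x * unit p q) = (\<Sum>p\<in>r - {(1, 1)}. if p = q then x q else 0)"
      using False q by (intro sum.cong refl) (auto simp: coord_def unit_def basis_vec_def hh_apply)
    also have "\<dots> = x q" using fin g_support[OF x, of q] False q by auto
    finally show ?thesis by simp
  next
    case True
    have "(\<Sum>p\<in>r - {(1, 1)}. coord p x * unit p q) = (\<Sum>p\<in>?D. coord p x * unit p q)"
    proof (rule sum.mono_neutral_right[OF fin D], rule ballI)
      fix p assume p: "p \<in> r - {(1, 1)} - ?D"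
      obtain a b where ab: "p = (a, b)" by (cases p)
      have "a \<in> {1..N}" "b \<in> {1..N}" using p ab r_sub by auto
      have "a \<noteq> b"
      proof
        assume "a = b"
        then have "a \<noteq> 1" using p ab by auto
        then have "a \<in> {2..N}" using \<open>a \<in> {1..N}\<close> by auto
        then show False using p ab \<open>a = b\<close> by auto
      qed
      then show "coord p x * unit p q = 0" using True by (auto simp: ab q unit_def basis_vec_def)
    qed
    also have "\<dots> = (\<Sum>i\<in>{2..N}. (x (i, i) - x (1, 1)) * hh i (u, u))"
      by (subst sum.reindex) (auto simp: inj_on_def coord_def unit_def q True)
    \<comment> \<open>The term for \<open>i = 1\<close> is zero; including it lets the trace
      condition apply to the whole diagonal.\<close>
    also have "\<dots> = (\<Sum>i\<in>{1..N}. (x (i, i) - x (1, 1)) * hh i (u, u))"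
    proof (rule sum.mono_neutral_left, simp, simp, rule ballI)
      fix i assume "i \<in> {1..N} - {2..N}"
      then have "i = 1" by auto
      then show "(x (i, i) - x (1, 1)) * hh i (u, u) = 0" by simp
    qed
    also have "\<dots> = x (u, u)"
    proof (cases "u \<in> {1..N}")
      case True
      have "(\<Sum>i\<in>{1..N}. (x (i, i) - x (1, 1)) * hh i (u, u)) =
          (\<Sum>i\<in>{1..N}. (if i = u then x (u, u) - x (1, 1) else 0) - (x (i, i) - x (1, 1)) * inverse (of_nat N))"
        using True by (intro sum.cong refl) (auto simp: hh_apply algebra_simps)
      also have "\<dots> = (x (u, u) - x (1, 1)) - (\<Sum>i\<in>{1..N}. x (i, i) - x (1, 1)) * inverse (of_nat N)"
        unfolding sum_subtractf[of "\<lambda>i. if i = u then x (u, u) - x (1, 1) else 0"] sum_distrib_right[symmetric]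
        using True by simp
      also have "(\<Sum>i\<in>{1..N}. x (i, i) - x (1, 1)) = - (of_nat N * x (1, 1))"
        unfolding sum_subtractf g_trace[OF x] by simp
      also have "x (u, u) - x (1, 1) - - (of_nat N * x (1, 1)) * inverse (of_nat N) = x (u, u)"
        using N_nonzero by simp
      finally show ?thesis .
    next
      case False
      then have "(u, u) \<notin> r" using r_sub by auto
      then show ?thesis using False g_support[OF x, of "(u, u)"] by (auto simp: hh_apply)
    qed
    finally show ?thesis using q True by simp
  qed
  then show "x q = (\<Sum>p\<in>r - {(1, 1)}. fscale (coord p x) (unit p)) q"
    unfolding sum_fun_apply by (simp add: fscale_def)
qed

sublocale dual_basis fscale fscale g g basis_index unit coord
proof
  show "distinct basis_index" by (rule basis_index)
  show "unit p \<in> g" if "p \<in> set basis_index" for p using that basis_index(1) unit_g by blast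
  show "functional (coord p)" if "p \<in> set basis_index" for p by (rule functional_coord)
  show "coord p (unit q) = (if p = q then 1 else 0)" if "p \<in> set basis_index" "q \<in> set basis_index" for p q
    by (rule coord_unit) (use that basis_index(1) in blast)+
  show "x = (\<Sum>p\<in>set basis_index. fscale (coord p x) (unit p))" if "x \<in> g" for x
    unfolding basis_index(1) by (rule g_expand[OF that])
qed

text \<open>Invariance is asked for all \<open>hh i\<close>, which gives one weight condition per
  vertex, while those with \<open>i \<ge> 2\<close> are independent and carry the dual
  coordinates.\<close>

sublocale torus_forms fscale g "commutator N" "hh ` {1..N}" "{2..N}" hh "\<lambda>i. coord (i, i)"
proof
  show "finite {2..N}" by simp
  show "hh i \<in> hh ` {1..N}" if "i \<in> {2..N}" for i using that by auto
  show "hh ` {1..N} \<subseteq> g" using hh_g by blast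
  show "commutator N x y = 0" if xy: "x \<in> hh ` {1..N}" "y \<in> hh ` {1..N}" for x y
  proof
    fix p
    obtain i j where ij: "x = hh i" "y = hh j" "j \<in> {1..N}" using xy by blast
    have "weight i p = 0 \<or> hh j p = 0" by (cases p) (auto simp: hh_apply weight_def)
    then show "commutator N x y p = 0 p" unfolding ij commutator_hh_apply[OF hh_g[OF ij(3)]] by auto
  qed
  show "functional (coord (i, i))" for i by (rule functional_coord)
  show "coord (i, i) (hh j) = (if i = j then 1 else 0)" if "i \<in> {2..N}" "j \<in> {2..N}" for i j
    using that by (auto simp: coord_def hh_apply)
  show "coord (i, i) (commutator N x y) = 0" if "x \<in> g" "y \<in> g" for i x y
    using commutator_diagonal[OF that] by (simp add: coord_def)
qed

section \<open>Weights of forms\<close>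

lemma wedge_scale_functional:
  assumes "\<And>y. y \<in> g \<Longrightarrow> \<theta>' y = a * \<theta> y"
  shows "wedge \<theta>' \<omega> = fsc a (wedge \<theta> \<omega>)"
proof
  fix xs show "wedge \<theta>' \<omega> xs = fsc a (wedge \<theta> \<omega>) xs"
  proof (induction xs arbitrary: \<omega>)
    case (Cons x xs)
    have "wedge \<theta>' (contract x \<omega>) xs = fsc a (wedge \<theta> (contract x \<omega>)) xs" by (rule Cons.IH)
    then have IH: "wedge \<theta>' (contract x \<omega>) xs = fscale a (wedge \<theta> (contract x \<omega>) xs)" by (simp only: fsc_apply)
    show ?case
    proof (cases "x \<in> g")
      case True
      then show ?thesis
        by (simp only: wedge.simps if_True fsc_apply IH assms[OF True] fun_vs.scale_right_diff_distrib fun_vs.scale_scale)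
    next
      case False
      then show ?thesis by (simp only: wedge.simps if_False fsc_apply fun_vs.scale_zero_right)
    qed
  qed simp
qed

text \<open>Each factor is a dual vector and so contributes the weight of its position with the
  opposite sign.\<close>

lemma lieD_mono_form:
  assumes i: "i \<in> {1..N}" and c: "commutator N (hh i) c = fscale l c"
  shows "lieD (hh i) (mono_form c ps) = fsc (l - (\<Sum>p\<leftarrow>ps. of_int (weight i p))) (mono_form c ps)"
proof (induction ps)
  case Nil
  show ?case
  proof
    fix xs :: "(nat \<times> nat \<Rightarrow> 'k) list"
    show "lieD (hh i) (mono_form c []) xs = fsc (l - (\<Sum>p\<leftarrow>[]. of_int (weight i p))) (mono_form c []) xs"
    proof (cases xs)
      case Nil
      then show ?thesis by (simp add: c)
    next
      case (Cons y ys)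
      have "contract y (mono_form c []) = 0" by (rule ext) simp
      then have "lieD (hh i) (contract y (mono_form c [])) ys = 0" by (simp only: lieD_0 zero_fun_apply)
      then show ?thesis unfolding Cons by (simp del: contract_apply)
    qed
  qed
next
  case (Cons p ps)
  have "wedge (\<lambda>y. coord p (commutator N (hh i) y)) (mono_form c ps) =
      fsc (of_int (weight i p)) (wedge (coord p) (mono_form c ps))"
  proof (rule wedge_scale_functional)
    fix y assume y: "y \<in> g"
    show "coord p (commutator N (hh i) y) = of_int (weight i p) * coord p y"
      unfolding coord_def commutator_hh_apply[OF y] weight_diag
      by (cases p) (simp add: weight_def)
  qed
  then show ?case
    unfolding mono_form.simps lieD_wedge[OF hh_g[OF i]] Cons.IH wedge_fsc
    by (simp only: fn.scale_left_diff_distrib[symmetric] list.map sum_list.Cons diff_diff_eq add.commute)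
qed

text \<open>Monomials whose value is a basis element are eigenvectors, and they span the
  forms.\<close>

lemma alt_eigen_expand:
  assumes i: "i \<in> {1..N}" and w: "alt m \<omega>"
  shows "\<exists>(K :: ((nat \<times> nat) list \<times> (nat \<times> nat)) set) \<omega>' c. finite K \<and> \<omega> = (\<Sum>k\<in>K. \<omega>' k) \<and>
      (\<forall>k\<in>K. lieD (hh i) (\<omega>' k) = fsc (c k) (\<omega>' k))"
proof -
  let ?S = "subseqs_of_length basis_index m" and ?R = "r - {(1, 1)}"
  define \<omega>' where "\<omega>' = (\<lambda>(ps, p). fsc (coord p (\<omega> (map unit ps))) (mono_form (unit p) ps))"
  define c :: "(nat \<times> nat) list \<times> (nat \<times> nat) \<Rightarrow> 'k"
    where "c = (\<lambda>(ps, p). of_int (weight i p) - (\<Sum>q\<leftarrow>ps. of_int (weight i q)))"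
  have mono0: "mono_form 0 ps = 0" for ps
  proof -
    have "mono_form (fscale 0 0) ps = fsc 0 (mono_form 0 ps)" by (rule mono_form_scale)
    then show ?thesis by (simp only: fun_vs.scale_zero_left fn.scale_zero_left)
  qed
  have mono_sum: "finite A \<Longrightarrow> mono_form (\<Sum>p\<in>A. fscale (a p) (unit p)) ps = (\<Sum>p\<in>A. fsc (a p) (mono_form (unit p) ps))" for A a ps
    by (induction A rule: finite_induct) (simp_all only: sum.empty sum.insert mono0 mono_form_add mono_form_scale if_False not_False_eq_True)
  have "\<omega> = (\<Sum>ps\<in>?S. mono_form (\<omega> (map unit ps)) ps)" by (rule alt_expand[OF w])
  also have "\<dots> = (\<Sum>ps\<in>?S. \<Sum>p\<in>?R. \<omega>' (ps, p))"
  proof (rule sum.cong[OF refl])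
    fix ps
    have "mono_form (\<omega> (map unit ps)) ps = mono_form (\<Sum>p\<in>?R. fscale (coord p (\<omega> (map unit ps))) (unit p)) ps"
      using g_expand[OF alt_closed[OF w, of "map unit ps"]] by (rule arg_cong[where f = "\<lambda>c. mono_form c ps"])
    then show "mono_form (\<omega> (map unit ps)) ps = (\<Sum>p\<in>?R. \<omega>' (ps, p))"
      unfolding mono_sum[OF finite_Diff[OF finite_r]] \<omega>'_def prod.case .
  qed
  also have "\<dots> = (\<Sum>k\<in>?S \<times> ?R. \<omega>' k)" unfolding sum.cartesian_product case_prod_eta ..
  finally have 1: "\<omega> = (\<Sum>k\<in>?S \<times> ?R. \<omega>' k)" .
  have 2: "lieD (hh i) (\<omega>' k) = fsc (c k) (\<omega>' k)" if k: "k \<in> ?S \<times> ?R" for k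
  proof -
    obtain ps p where kp: "k = (ps, p)" "p \<in> r" using k by auto
    show ?thesis
      unfolding kp(1) \<omega>'_def c_def prod.case lieD_fsc lieD_mono_form[OF i commutator_hh_unit[OF kp(2)]]
      by (rule fn.scale_left_commute)
  qed
  have "finite (?S \<times> ?R)" using finite_r by simp
  then show ?thesis using 1 2 by blast
qed

text \<open>N - 1 is the dimension of the diagonal subalgebra, hence the number of factors 1 +
  t.\<close>

theorem quotient_dim_adjoint:
  assumes "\<And>n. fn.quotient_dim (inv_cocycles (hh ` {1..N}) (hh ` {2..N}) n) (inv_coboundaries (hh ` {1..N}) (hh ` {2..N}) n) (s n)"
  shows "fn.quotient_dim (inv_cocycles {} {} n) (inv_coboundaries {} {} n) (\<Sum>p\<le>N - 1. ((N - 1) choose p) * s (n - int p))"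
proof -
  have card: "card {2..N} = N - 1" by simp
  show ?thesis
  proof (rule quotient_dim_invariants[where 'i = "(nat \<times> nat) list \<times> nat \<times> nat"])
    show "fn.quotient_dim (inv_cocycles (hh ` {1..N}) {} n) (inv_coboundaries (hh ` {1..N}) {} n)
      (\<Sum>p\<le>N - 1. ((N - 1) choose p) * s (n - int p))"
      using quotient_dim_torus[OF assms, of n] unfolding card .
    fix h m \<omega> assume "h \<in> hh ` {1..N}" and w: "alt m \<omega>"
    then obtain i where i: "h = hh i" "i \<in> {1..N}" by blast
    show "\<exists>(K :: ((nat \<times> nat) list \<times> nat \<times> nat) set) \<omega>' c. finite K \<and> \<omega> = sum \<omega>' K \<and>
      (\<forall>k\<in>K. lieD h (\<omega>' k) = fsc (c k) (\<omega>' k))"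
      unfolding i(1) by (rule alt_eigen_expand[OF i(2) w])
  qed (use H_L H_comm in blast)+
qed

end

section \<open>Invariant horizontal forms are simplicial cochains\<close>

context poset_lie
begin

abbreviation units :: "nat list \<Rightarrow> (nat \<times> nat \<Rightarrow> 'k) list"
  where "units vs \<equiv> map unit (chain_edges vs)"

lemma strict_r: "strict a b \<Longrightarrow> (a, b) \<in> r"
  by (simp add: strict_def)

lemma unit_strict: "strict a b \<Longrightarrow> unit (a, b) = basis_vec (a, b)"
  by (simp add: unit_def strict_def)

lemma commutator_unit_apply:
  assumes "strict a b"
  shows "commutator N (unit (a, b)) x (u, w) = (if u = a then x (b, w) else 0) - (if w = b then x (u, a) else 0)"
proof -
  have ab: "a \<in> {1..N}" "b \<in> {1..N}" using strict_sub[OF assms] by auto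
  have "(\<Sum>j\<in>{1..N}. basis_vec (a, b) (u, j) * x (j, w)) = (\<Sum>j\<in>{1..N}. if j = b then (if u = a then x (b, w) else 0) else 0)"
    by (rule sum.cong) (auto simp: basis_vec_def)
  also have "\<dots> = (if u = a then x (b, w) else 0)" using ab by simp
  finally have 1: "(\<Sum>j\<in>{1..N}. basis_vec (a, b) (u, j) * x (j, w)) = (if u = a then x (b, w) else 0)" .
  have "(\<Sum>j\<in>{1..N}. x (u, j) * basis_vec (a, b) (j, w)) = (\<Sum>j\<in>{1..N}. if j = a then (if w = b then x (u, a) else 0) else 0)"
    by (rule sum.cong) (auto simp: basis_vec_def)
  also have "\<dots> = (if w = b then x (u, a) else 0)" using ab by simp
  finally have 2: "(\<Sum>j\<in>{1..N}. x (u, j) * basis_vec (a, b) (j, w)) = (if w = b then x (u, a) else 0)" .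
  show ?thesis unfolding unit_strict[OF assms] commutator_apply 1 2 ..
qed

lemma commutator_units:
  assumes ab: "strict a b" and bc: "strict b c"
  shows "commutator N (unit (a, b)) (unit (b, c)) = unit (a, c)"
proof
  fix p :: "nat \<times> nat"
  obtain u w where p: "p = (u, w)" by (cases p)
  have ac: "strict a c" by (rule strict_trans[OF ab bc])
  have "a \<noteq> c" using ac by (simp add: strict_def)
  then show "commutator N (unit (a, b)) (unit (b, c)) p = unit (a, c) p"
    unfolding p commutator_unit_apply[OF ab] unit_strict[OF ac] unit_strict[OF bc]
    by (auto simp: basis_vec_def)
qed

lemma commutator_units_0:
  assumes ab: "strict a b" and cd: "strict c d" and "b \<noteq> c" and "d \<noteq> a"
  shows "commutator N (unit (a, b)) (unit (c, d)) = 0"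
proof
  fix p :: "nat \<times> nat"
  obtain u w where p: "p = (u, w)" by (cases p)
  show "commutator N (unit (a, b)) (unit (c, d)) p = 0 p"
    unfolding p commutator_unit_apply[OF ab] unit_strict[OF cd] using assms(3,4)
    by (auto simp: basis_vec_def)
qed

lemma lieD_annihilate:
  "alt n \<omega> \<Longrightarrow> \<forall>y\<in>set ys. y \<in> g \<and> commutator N x y = 0 \<Longrightarrow> lieD x \<omega> ys = commutator N x (\<omega> ys)"
proof (induction ys arbitrary: n \<omega>)
  case (Cons y ys)
  have y: "y \<in> g" "commutator N x y = 0" using Cons.prems(2) unfolding list.set(2) by blast+
  have "lieD x (contract y \<omega>) ys = commutator N x (contract y \<omega> ys)"
    by (rule Cons.IH[OF alt_contract_pred[OF Cons.prems(1) y(1)]]) (use Cons.prems(2) in simp)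
  moreover have "\<omega> (commutator N x y # ys) = 0" unfolding y(2) by (rule alt_zero_first[OF Cons.prems(1)])
  ultimately show ?case
    by (simp only: lieD.simps y(1) if_True contract_apply diff_0_right)
qed simp

text \<open>Among the edges of \<open>b # vs\<close> only the first is composable with the edge from
  \<open>a\<close> to \<open>b\<close>, and the bracket merges the two into one edge, which deletes
  the vertex \<open>b\<close>.\<close>

lemma lieD_path:
  assumes w: "alt n \<omega>" and ch: "chain (a # b # vs)"
  shows "lieD (unit (a, b)) \<omega> (units (b # vs)) = commutator N (unit (a, b)) (\<omega> (units (b # vs))) -
    (if vs = [] then 0 else \<omega> (units (a # vs)))"
proof (cases vs)
  case (Cons c vs')
  have ab: "strict a b" and bc: "strict b c" using ch Cons by (auto simp: chain_Cons)
  have yg: "unit (b, c) \<in> g" by (rule unit_g[OF strict_r[OF bc]])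
  have "lieD (unit (a, b)) (contract (unit (b, c)) \<omega>) (units (c # vs')) =
      commutator N (unit (a, b)) (contract (unit (b, c)) \<omega> (units (c # vs')))"
  proof (rule lieD_annihilate[OF alt_contract_pred[OF w yg]], rule ballI)
    fix y assume "y \<in> set (units (c # vs'))"
    then obtain p q where pq: "(p, q) \<in> set (chain_edges (c # vs'))" "y = unit (p, q)" by auto
    have st: "strict p q" using chain_edges_strict[OF _ pq(1)] ch Cons by (simp add: chain_Cons)
    have "p \<in> set (c # vs')" "q \<in> set (c # vs')" using chain_edges_subset[of "c # vs'"] pq(1) by auto
    then have "strict b p" "strict a q" using ch Cons by (auto simp: chain_Cons)
    then have "b \<noteq> p" "q \<noteq> a" by (auto simp: strict_def)
    then show "y \<in> g \<and> commutator N (unit (a, b)) y = 0"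
      unfolding pq(2) using unit_g[OF strict_r[OF st]] commutator_units_0[OF ab st] by blast
  qed
  then show ?thesis
    using Cons by (simp add: yg commutator_units[OF ab bc] del: contract_apply) simp
qed simp

text \<open>Serves the recursion of \<open>dd_path\<close>: after contraction with the first edge
  the row index stays at the start of the original chain, which is no longer in the list. Left
  multiplication then misses row \<open>u\<close>, so the face without the first vertex is
  absent.\<close>

lemma dd_path_tail:
  "alt n \<omega> \<Longrightarrow> chain vs \<Longrightarrow> 2 \<le> length vs \<Longrightarrow> u \<notin> set vs \<Longrightarrow>
    dd \<omega> (units vs) (u, last vs) = cob (\<lambda>ys. \<omega> (units ys) (u, last ys)) vs - \<omega> (units (tl vs)) (u, last vs)"
proof (induction vs arbitrary: n \<omega>)
  case (Cons a vs)
  obtain b vs2 where vs: "vs = b # vs2" using Cons.prems(3) by (cases vs) auto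
  have ch: "chain (a # b # vs2)" using Cons.prems(2) vs by simp
  have ab: "strict a b" using ch by (auto simp: chain_Cons)
  have ua: "u \<noteq> a" "u \<noteq> b" using Cons.prems(4) vs by auto
  have xg: "unit (a, b) \<in> g" by (rule unit_g[OF strict_r[OF ab]])
  let ?x = "unit (a, b)" and ?f = "\<lambda>ys. \<omega> (units ys) (u, last ys)" and ?W = "last (b # vs2)"
  have dd: "dd \<omega> (units (a # b # vs2)) (u, ?W) =
      lieD ?x \<omega> (units (b # vs2)) (u, ?W) - dd (contract ?x \<omega>) (units (b # vs2)) (u, ?W)"
    using xg by simp
  show ?case
  proof (cases vs2)
    case Nil
    show ?thesis using dd ua unfolding vs Nil
      by (simp add: commutator_unit_apply[OF ab])
  next
    case (Cons c vs3)
    have Wb: "?W \<noteq> b" using chain_distinct[OF ch] Cons by auto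
    have lie: "lieD ?x \<omega> (units (b # vs2)) (u, ?W) = - \<omega> (units (a # vs2)) (u, ?W)"
      unfolding lieD_path[OF Cons.prems(1) ch] using Cons ua Wb
      by (simp add: commutator_unit_apply[OF ab] del: chain_edges.simps last.simps)
    let ?g = "\<lambda>ys. contract ?x \<omega> (units ys) (u, last ys)"
    have IH: "dd (contract ?x \<omega>) (units (b # vs2)) (u, ?W) = cob ?g (b # vs2) - contract ?x \<omega> (units (tl (b # vs2))) (u, ?W)"
      unfolding vs[symmetric]
      by (rule Cons.IH[OF alt_contract_pred[OF Cons.prems(1) xg]]) (use Cons.prems vs Cons in \<open>auto simp: chain_Cons\<close>)
    have fg: "contract b (contract a ?f) = contract b ?g" by (rule ext) simp
    have "last vs2 = ?W" using Cons by simp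
    then show ?thesis
      unfolding vs list.sel last_ConsR[of "b # vs2", OF list.simps(3)] dd lie IH cob.simps fg
      using Cons by simp
  qed
qed simp

text \<open>The origin of the simplicial coboundary: merging two consecutive edges deletes an inner
  vertex, and the action of the first and of the last edge on the value deletes an end
  vertex.\<close>

lemma dd_path:
  assumes w: "alt n \<omega>" and ch: "chain vs" and len: "2 \<le> length vs"
  shows "dd \<omega> (units vs) (hd vs, last vs) = cob (\<lambda>ys. \<omega> (units ys) (hd ys, last ys)) vs"
proof -
  obtain a b vs2 where vs: "vs = a # b # vs2" using len by (cases vs; cases "tl vs") auto
  note ch = ch[unfolded vs]
  have ab: "strict a b" using ch by (auto simp: chain_Cons)
  have ab': "a \<noteq> b" using ab by (simp add: strict_def)
  have xg: "unit (a, b) \<in> g" by (rule unit_g[OF strict_r[OF ab]])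
  let ?x = "unit (a, b)" and ?f = "\<lambda>ys. \<omega> (units ys) (hd ys, last ys)" and ?W = "last (b # vs2)"
  have dd: "dd \<omega> (units (a # b # vs2)) (a, ?W) =
      lieD ?x \<omega> (units (b # vs2)) (a, ?W) - dd (contract ?x \<omega>) (units (b # vs2)) (a, ?W)"
    using xg by simp
  show ?thesis
  proof (cases vs2)
    case Nil
    show ?thesis using dd ab' unfolding vs Nil
      by (simp add: commutator_unit_apply[OF ab])
  next
    case (Cons c vs3)
    \<comment> \<open>Hence right multiplication by the first edge does not reach the entry in
      column \<open>?W\<close>.\<close>
    have Wb: "?W \<noteq> b" using chain_distinct[OF ch] Cons by auto
    have lie: "lieD ?x \<omega> (units (b # vs2)) (a, ?W) = \<omega> (units (b # vs2)) (b, ?W) - \<omega> (units (a # vs2)) (a, ?W)"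
      unfolding lieD_path[OF w ch] using Cons Wb
      by (simp add: commutator_unit_apply[OF ab] del: chain_edges.simps last.simps)
    let ?g = "\<lambda>ys. contract ?x \<omega> (units ys) (a, last ys)"
    have tail: "dd (contract ?x \<omega>) (units (b # vs2)) (a, ?W) = cob ?g (b # vs2) - contract ?x \<omega> (units (tl (b # vs2))) (a, ?W)"
      by (rule dd_path_tail[OF alt_contract_pred[OF w xg]]) (use ch Cons chain_distinct[OF ch] in \<open>auto simp: chain_Cons\<close>)
    have fg: "contract b (contract a ?f) = contract b ?g" by (rule ext) simp
    have "last vs2 = ?W" using Cons by simp
    then show ?thesis
      unfolding vs list.sel last_ConsR[of "b # vs2", OF list.simps(3)] dd lie tail cob.simps fg
      using Cons by simp
  qed
qed

text \<open>Restriction of a form to chains, read at the entry from first to last vertex. The empty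
  chain gets 0, as there are no nonzero forms of degree -1.\<close>

definition rho :: "int \<Rightarrow> ((nat \<times> nat \<Rightarrow> 'k) list \<Rightarrow> nat \<times> nat \<Rightarrow> 'k) \<Rightarrow> nat list \<Rightarrow> 'k"
  where "rho n \<omega> vs = (if vs \<in> simplices K n \<and> vs \<noteq> [] then \<omega> (units vs) (hd vs, last vs) else 0)"

lemma rho_add: "rho n (\<omega> + \<eta>) = rho n \<omega> + rho n \<eta>"
  by (rule ext) (simp add: rho_def)

lemma rho_fsc: "rho n (fsc a \<omega>) = fscale a (rho n \<omega>)"
proof
  fix vs show "rho n (fsc a \<omega>) vs = fscale a (rho n \<omega>) vs"
    unfolding rho_def fscale_def[of a "\<lambda>vs. _ vs"] fsc_apply by (simp add: fscale_def)
qed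

lemma rho_0: "rho n 0 = 0"
  by (rule ext) (simp add: rho_def)

lemma rho_sum: "rho n (\<Sum>i\<in>A. f i) = (\<Sum>i\<in>A. rho n (f i))"
  by (induction A rule: infinite_finite_induct)
    (simp_all only: sum.infinite sum.empty sum.insert rho_add rho_0 if_False not_False_eq_True)

lemma rho_cochain: "rho n \<omega> \<in> simplicial_cochains K n"
  by (simp add: simplicial_cochains_def rho_def)

text \<open>Faces of a chain with at least two vertices are nonempty chains, so the cut-offs in
  \<open>rho\<close> do not interfere with \<open>dd_path\<close>.\<close>

lemma rho_dd:
  assumes "alt q \<omega>"
  shows "rho (int q + 1) (dd \<omega>) = coboundary K (int q) (rho (int q) \<omega>)"
proof
  fix vs
  show "rho (int q + 1) (dd \<omega>) vs = coboundary K (int q) (rho (int q) \<omega>) vs"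
  proof (cases "vs \<in> simplices K (int q + 1)")
    case True
    then have ch: "chain vs" and len: "length vs = Suc (Suc q)" by (auto simp: simplices_K)
    have len2: "2 \<le> length vs" using len by simp
    have "vs \<noteq> []" using len by auto
    have "rho (int q + 1) (dd \<omega>) vs = dd \<omega> (units vs) (hd vs, last vs)"
      using True \<open>vs \<noteq> []\<close> by (simp only: rho_def simp_thms if_True not_False_eq_True)
    also have "\<dots> = (\<Sum>i<length vs. (-1) ^ i * \<omega> (units (nths vs (- {i}))) (hd (nths vs (- {i})), last (nths vs (- {i}))))"
      unfolding dd_path[OF assms ch len2] cob_eq_sum ..
    also have "\<dots> = (\<Sum>i<length vs. (-1) ^ i * rho (int q) \<omega> (nths vs (- {i})))"
    proof (rule sum.cong[OF refl])
      fix i assume "i \<in> {..<length vs}"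
      then have l: "length (nths vs (- {i})) = Suc q" using length_nths_omit[of i vs] len by simp
      have "chain (nths vs (- {i}))" using K_closed[of vs i] ch by (simp add: K_eq)
      then have "nths vs (- {i}) \<in> simplices K (int q)" "nths vs (- {i}) \<noteq> []"
        using l by (auto simp: simplices_K)
      then show "(-1) ^ i * \<omega> (units (nths vs (- {i}))) (hd (nths vs (- {i})), last (nths vs (- {i}))) =
          (-1) ^ i * rho (int q) \<omega> (nths vs (- {i}))"
        by (simp only: rho_def simp_thms if_True not_False_eq_True)
    qed
    also have "\<dots> = coboundary K (int q) (rho (int q) \<omega>) vs"
      using True by (simp only: coboundary_def if_True)
    finally show ?thesis .
  qed (simp add: rho_def coboundary_def)
qed

abbreviation R :: "int \<Rightarrow> ((nat \<times> nat \<Rightarrow> 'k) list \<Rightarrow> nat \<times> nat \<Rightarrow> 'k) set"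
  where "R \<equiv> inv_forms (hh ` {1..N}) (hh ` {2..N})"

section \<open>Invariant horizontal forms are determined on chains\<close>

lemma alt_move_front:
  "alt n \<omega> \<Longrightarrow> set (xs @ x # ys) \<subseteq> g \<Longrightarrow> \<omega> (xs @ x # ys) = \<omega> (x # xs @ ys) \<or> \<omega> (xs @ x # ys) = - \<omega> (x # xs @ ys)"
proof (induction xs arbitrary: n \<omega>)
  case (Cons z xs)
  have z: "z \<in> g" and x: "x \<in> g" using Cons.prems(2) by auto
  have "contract z \<omega> (xs @ x # ys) = contract z \<omega> (x # xs @ ys) \<or> contract z \<omega> (xs @ x # ys) = - contract z \<omega> (x # xs @ ys)"
    by (rule Cons.IH[OF alt_contract_pred[OF Cons.prems(1) z]]) (use Cons.prems(2) in simp)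
  then have "\<omega> (z # xs @ x # ys) = \<omega> (z # x # xs @ ys) \<or> \<omega> (z # xs @ x # ys) = - \<omega> (z # x # xs @ ys)"
    unfolding contract_apply .
  then show ?case unfolding alt_swap[OF Cons.prems(1) z x] append_Cons minus_minus by blast
qed simp

text \<open>The sign of the permutation is left open, as only the vanishing of values is transported
  along it.\<close>

lemma alt_permute:
  "alt n \<omega> \<Longrightarrow> distinct ps \<Longrightarrow> distinct qs \<Longrightarrow> set ps = set qs \<Longrightarrow> set ps \<subseteq> r \<Longrightarrow>
    \<omega> (map unit ps) = \<omega> (map unit qs) \<or> \<omega> (map unit ps) = - \<omega> (map unit qs)"
proof (induction ps arbitrary: n \<omega> qs)
  case (Cons p ps)
  have "p \<in> set qs" using Cons.prems(4) by auto
  then obtain q1 q2 where qs: "qs = q1 @ p # q2" by (meson split_list)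
  have pg: "unit p \<in> g" using Cons.prems(5) unit_g by auto
  have eq: "set ps = set (q1 @ q2)" using Cons.prems(2,3,4) unfolding qs by auto
  have "contract (unit p) \<omega> (map unit ps) = contract (unit p) \<omega> (map unit (q1 @ q2)) \<or>
      contract (unit p) \<omega> (map unit ps) = - contract (unit p) \<omega> (map unit (q1 @ q2))"
    by (rule Cons.IH[OF alt_contract_pred[OF Cons.prems(1) pg] _ _ eq]) (use Cons.prems qs in auto)
  moreover have "\<omega> (map unit qs) = \<omega> (unit p # map unit (q1 @ q2)) \<or> \<omega> (map unit qs) = - \<omega> (unit p # map unit (q1 @ q2))"
    unfolding qs map_append list.map
    by (rule alt_move_front[OF Cons.prems(1)]) (use Cons.prems(4,5) qs unit_g in auto)
  ultimately show ?case unfolding contract_apply list.map(2) by (metis minus_minus)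
qed simp

lemma alt_killed:
  "alt n \<omega> \<Longrightarrow> contract x \<omega> = 0 \<Longrightarrow> x \<in> g \<Longrightarrow> x \<in> set xs \<Longrightarrow> \<omega> xs = 0"
proof (induction xs arbitrary: n \<omega>)
  case (Cons y xs)
  show ?case
  proof (cases "y = x")
    case True
    then show ?thesis using fun_cong[OF Cons.prems(2), of xs] by simp
  next
    case False
    show ?thesis
    proof (cases "y \<in> g")
      case y: True
      have "contract x (contract y \<omega>) = 0"
        unfolding contract_contract[OF Cons.prems(1,3) y] Cons.prems(2) contract_0 by (rule minus_zero)
      then have "contract y \<omega> xs = 0"
        by (rule Cons.IH[OF alt_contract_pred[OF Cons.prems(1) y] _ Cons.prems(3)]) (use Cons.prems(4) False in simp)
      then show ?thesis by simp
    qed (rule alt_outside[OF Cons.prems(1)])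
  qed
qed simp

lemma lieD_unit_tuple:
  "alt n \<omega> \<Longrightarrow> set ps \<subseteq> r \<Longrightarrow> lieD (hh i) \<omega> (map unit ps) =
    commutator N (hh i) (\<omega> (map unit ps)) - fscale (\<Sum>p\<leftarrow>ps. of_int (weight i p)) (\<omega> (map unit ps))"
proof (induction ps arbitrary: n \<omega>)
  case (Cons p ps)
  have p: "p \<in> r" and pg: "unit p \<in> g" using Cons.prems(2) unit_g by auto
  let ?v = "\<omega> (unit p # map unit ps)"
  have IH: "lieD (hh i) (contract (unit p) \<omega>) (map unit ps) = commutator N (hh i) (contract (unit p) \<omega> (map unit ps)) -
      fscale (\<Sum>p\<leftarrow>ps. of_int (weight i p)) (contract (unit p) \<omega> (map unit ps))"
    by (rule Cons.IH[OF alt_contract_pred[OF Cons.prems(1) pg]]) (use Cons.prems(2) in simp)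
  have sc: "\<omega> (fscale a (unit p) # map unit ps) = fscale a ?v" for a
  proof (cases n)
    case 0
    have "\<omega> (y # ys) = 0" for y ys using Cons.prems(1) unfolding 0 by (rule alt_zero_cons)
    then show ?thesis by (simp only: fun_vs.scale_zero_right)
  next
    case (Suc m)
    show ?thesis using Cons.prems(1) unfolding Suc by (rule alt_first_scale[OF _ pg])
  qed
  show ?case
    unfolding list.map lieD.simps sum_list.Cons IH contract_apply commutator_hh_unit[OF p] sc fun_vs.scale_left_distrib
    using pg by (simp only: if_True diff_diff_eq add.commute)
qed simp

lemma mono_form_0: "mono_form 0 ps = 0"
proof -
  have "mono_form (fscale 0 0) ps = fsc 0 (mono_form 0 ps)" by (rule mono_form_scale)
  then show ?thesis by (simp only: fun_vs.scale_zero_left fn.scale_zero_left)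
qed

text \<open>By invariance, a nonzero entry (u, v) of a value on off-diagonal units forces their
  positions to have the boundary of a path from u to v, hence to be the edges of a chain, where
  \<open>rho\<close> knows the value. Diagonal units give zero by horizontality.\<close>

lemma rho_injective:
  assumes w: "\<omega> \<in> R n" and z: "rho n \<omega> = 0"
  shows "\<omega> = 0"
proof -
  have inv: "lieD (hh i) \<omega> = 0" if "i \<in> {1..N}" for i using w that unfolding inv_forms_def by blast
  have hor: "contract (hh i) \<omega> = 0" if "i \<in> {2..N}" for i using w that unfolding inv_forms_def by blast
  have "\<omega> \<in> forms n" using w unfolding inv_forms_def by blast
  then show ?thesis
  proof (cases rule: forms_cases)
    case (2 q)
    note a = 2(2)
    have zero: "\<omega> (map unit ss) = 0" if ss: "ss \<in> subseqs_of_length basis_index q" for ss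
    proof -
      have sub: "set ss \<subseteq> r - {(1, 1)}" using subseqs_of_length_subset[OF ss] basis_index(1) by simp
      have dis: "distinct ss" by (rule subseqs_of_length_distinct[OF basis_index(2) ss])
      have len: "length ss = q" using ss by (simp add: subseqs_of_length_def)
      show ?thesis
      proof (cases "\<exists>p\<in>set ss. fst p = snd p")
        case True
        then obtain p where p: "p \<in> set ss" "fst p = snd p" by blast
        have pr: "p \<in> r" "p \<noteq> (1, 1)" using p(1) sub by auto
        then have i: "fst p \<in> {1..N}" using r_sub by auto
        have "fst p \<noteq> 1" using pr(2) p(2) by (auto simp: prod_eq_iff)
        then have i2: "fst p \<in> {2..N}" using i by auto
        have "unit p = hh (fst p)" using p(2) by (simp add: unit_def)
        then have "hh (fst p) \<in> set (map unit ss)" using p(1) by force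
        then show ?thesis by (rule alt_killed[OF a hor[OF i2] hh_g[OF i]])
      next
        case False
        have str: "strict (fst p) (snd p)" if "p \<in> set ss" for p
          using that sub False by (auto simp: strict_def)
        show ?thesis
        proof (rule ext, rule ccontr)
          fix c assume nz: "\<omega> (map unit ss) c \<noteq> 0 c"
          obtain u v where c: "c = (u, v)" by (cases c)
          let ?W = "\<omega> (map unit ss)"
          have nz': "?W c \<noteq> 0" using nz by simp
          have Wg: "?W \<in> g" by (rule alt_closed[OF a])
          have "c \<in> r" using g_support[OF Wg] nz' by blast
          then have uv: "u \<in> {1..N}" "v \<in> {1..N}" using c r_sub by auto
          have bal: "weight i (u, v) = sum (weight i) (set ss)" for i
          proof (cases "i \<in> {1..N}")
            case True
            have s: "(\<Sum>p\<leftarrow>ss. of_int (weight i p)) = (of_int (sum (weight i) (set ss)) :: 'k)"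
              unfolding of_int_sum using sum.distinct_set_conv_list[OF dis, of "\<lambda>p. of_int (weight i p) :: 'k"] by simp
            have "0 = commutator N (hh i) ?W - fscale (\<Sum>p\<leftarrow>ss. of_int (weight i p)) ?W"
              using fun_cong[OF inv[OF True], of "map unit ss"] lieD_unit_tuple[OF a, of ss i] sub by auto
            then have "0 = commutator N (hh i) ?W c - fscale (\<Sum>p\<leftarrow>ss. of_int (weight i p)) ?W c"
              by (metis minus_apply zero_fun_apply)
            also have "\<dots> = (of_int (weight i c - sum (weight i) (set ss)) :: 'k) * ?W c"
              unfolding commutator_hh_apply[OF Wg] s fscale_def by (simp add: algebra_simps)
            finally have "(of_int (weight i c - sum (weight i) (set ss)) :: 'k) = 0" using nz' by simp
            \<comment> \<open>The bound \<open>N\<close> is the sum of 1 from the entry and N - 1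
              from the edges at \<open>i\<close>; within it, an integer that vanishes in the field
              is zero.\<close>
            moreover have "\<bar>weight i c\<bar> \<le> 1" by (simp add: weight_def)
            then have "\<bar>weight i c - sum (weight i) (set ss)\<bar> \<le> int N"
              using weight_sum_bound[of "set ss" i, OF str True] by linarith
            ultimately show ?thesis using of_int_eq_0 c by force
          next
            case False
            have "weight i p = 0" if "p \<in> set ss" for p
              using strict_sub[OF str[OF that]] False by (auto simp: weight_def)
            moreover have "weight i (u, v) = 0" using uv False by (auto simp: weight_def)
            ultimately show ?thesis by simp
          qed
          \<comment> \<open>In degree 0 the set is empty, the weights give \<open>u = v\<close>, and
            the chain is a single vertex.\<close>
          obtain vs where vs: "chain (u # vs)" "last (u # vs) = v" "set (chain_edges (u # vs)) = set ss"
            using balanced_path[of "set ss" "card (set ss)" u v] str uv(1) bal by blast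
          have de: "distinct (chain_edges (u # vs))" by (rule chain_edges_distinct[OF vs(1)])
          have "length (chain_edges (u # vs)) = q"
            using distinct_card[OF de] distinct_card[OF dis] vs(3) len by simp
          then have "u # vs \<in> simplices K n"
            using vs(1) 2(1) length_chain_edges[of "u # vs"] by (simp add: simplices_K)
          then have "\<omega> (units (u # vs)) c = 0"
            using fun_cong[OF z, of "u # vs"] vs(2) by (simp add: rho_def c)
          moreover have "?W = \<omega> (units (u # vs)) \<or> ?W = - \<omega> (units (u # vs))"
            by (rule alt_permute[OF a dis de]) (use vs(3) sub in auto)
          ultimately have "?W c = 0" by (elim disjE) simp_all
          then show False using nz' by blast
        qed
      qed
    qed
    have "\<omega> = (\<Sum>ss\<in>subseqs_of_length basis_index q. mono_form (\<omega> (map unit ss)) ss)" by (rule alt_expand[OF a])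
    also have "\<dots> = (\<Sum>ss\<in>subseqs_of_length basis_index q. 0)"
      by (rule sum.cong[OF refl]) (simp only: zero mono_form_0)
    also have "\<dots> = 0" by (rule sum.neutral_const)
    finally show ?thesis .
  qed
qed

section \<open>Forms attached to chains\<close>

lemma contract_mono_form: "x \<in> g \<Longrightarrow> \<forall>p\<in>set ps. coord p x = 0 \<Longrightarrow> contract x (mono_form c ps) = 0"
proof (induction ps)
  case Nil
  show ?case by (rule ext) simp
next
  case (Cons p ps)
  have "contract x (mono_form c ps) = 0" by (rule Cons.IH[OF Cons.prems(1)]) (use Cons.prems(2) in simp)
  moreover have "coord p x = 0" using Cons.prems(2) by simp
  ultimately show ?case
    unfolding mono_form.simps contract_wedge[OF Cons.prems(1)] by (simp only: wedge_0 fn.scale_zero_left diff_self)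
qed

text \<open>Invariance holds because the weights of value and factors agree, horizontality because
  off-diagonal coordinates vanish on \<open>hh i\<close>.\<close>

lemma mono_form_R:
  assumes "c \<in> g" and ps: "set ps \<subseteq> set basis_index" "\<And>p. p \<in> set ps \<Longrightarrow> fst p \<noteq> snd p"
    and c: "\<And>i. i \<in> {1..N} \<Longrightarrow> commutator N (hh i) c = fscale (\<Sum>p\<leftarrow>ps. of_int (weight i p)) c"
  shows "mono_form c ps \<in> R (int (length ps))"
  unfolding inv_forms_def mem_Collect_eq
proof (intro conjI ballI)
  show "mono_form c ps \<in> forms (int (length ps))" by (rule alt_forms[OF alt_mono_form[OF assms(1) ps(1)]])
  show "lieD x (mono_form c ps) = 0" if x: "x \<in> hh ` {1..N}" for x
  proof -
    obtain i where i: "i \<in> {1..N}" "x = hh i" using x by blast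
    show ?thesis unfolding i(2) lieD_mono_form[OF i(1) c[OF i(1)]] by (simp only: diff_self fn.scale_zero_left)
  qed
  show "contract x (mono_form c ps) = 0" if x: "x \<in> hh ` {2..N}" for x
  proof -
    obtain i where i2: "i \<in> {2..N}" "x = hh i" using x by blast
    then have i: "i \<in> {1..N}" "x = hh i" by simp_all
    have "coord p (hh i) = 0" if "p \<in> set ps" for p
      using ps(2)[OF that] by (cases p) (simp add: coord_def hh_apply)
    then show ?thesis unfolding i(2) by (intro contract_mono_form[OF hh_g[OF i(1)]]) simp
  qed
qed

text \<open>In positive degree every simplicial cochain is hit exactly, by monomials attached to
  chains. In degree 0 the invariant values are traceless diagonal matrices, so a function on the
  vertices is hit after removal of its mean, and the constant lost is a coboundary from dimension
  -1.\<close>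

lemma rho_surjective:
  assumes n: "0 \<le> n" and f: "f \<in> simplicial_cochains K n"
  shows "\<exists>\<omega>\<in>R n. f - rho n \<omega> \<in> simplicial_coboundaries K n"
proof (cases "n = 0")
  case True
  \<comment> \<open>The mean of \<open>f\<close> over the vertices, for which \<open>N\<close> must
    be invertible.\<close>
  define m where "m = (\<Sum>i\<in>{1..N}. f [i]) * inverse (of_nat N)"
  define c where "c = (\<lambda>(u, v). if u = v \<and> u \<in> {1..N} then f [u] - m else 0)"
  have c_apply: "c (u, v) = (if u = v \<and> u \<in> {1..N} then f [u] - m else 0)" for u v by (simp add: c_def)
  have cg: "c \<in> g"
  proof (rule gI)
    fix p assume "p \<notin> r" then show "c p = 0" using r_refl by (cases p) (auto simp: c_apply)
  next
    have "(\<Sum>i\<in>{1..N}. c (i, i)) = (\<Sum>i\<in>{1..N}. f [i] - m)" by (rule sum.cong) (simp_all add: c_apply)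
    also have "\<dots> = 0" unfolding sum_subtractf m_def using N_nonzero by simp
    finally show "(\<Sum>i\<in>{1..N}. c (i, i)) = 0" .
  qed
  have "mono_form c [] \<in> R (int (length ([] :: (nat \<times> nat) list)))"
  proof (rule mono_form_R[OF cg])
    fix i assume "i \<in> {1..N}"
    show "commutator N (hh i) c = fscale (\<Sum>p\<leftarrow>[]. of_int (weight i p)) c"
    proof
      fix p show "commutator N (hh i) c p = fscale (\<Sum>p\<leftarrow>[]. of_int (weight i p)) c p"
        unfolding commutator_hh_apply[OF cg] fscale_def by (cases p) (auto simp: c_apply weight_def)
    qed
  qed simp_all
  then have "mono_form c [] \<in> R n" using True by simp
  moreover have "f - rho n (mono_form c []) = coboundary K (n - 1) (\<lambda>xs. if xs = [] then m else 0)"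
  proof
    fix vs
    show "(f - rho n (mono_form c [])) vs = coboundary K (n - 1) (\<lambda>xs. if xs = [] then m else 0) vs"
    proof (cases "vs \<in> simplices K n")
      case t: True
      then obtain i where i: "vs = [i]" "i \<in> {1..N}" using True by (cases vs) (auto simp: simplices_K chain_def)
      show ?thesis using t i True by (simp add: rho_def coboundary_eq_cob c_apply)
    next
      case False
      then show ?thesis using f by (simp add: rho_def coboundary_def simplicial_cochains_def)
    qed
  qed
  moreover have "(\<lambda>xs. if xs = [] then m else 0) \<in> simplicial_cochains K (n - 1)"
    using True by (simp add: simplicial_cochains_def simplices_K chain_def)
  ultimately show ?thesis unfolding simplicial_coboundaries_def by (metis imageI)
next
  case False
  \<comment> \<open>The edges of the chain are the factors, and the value is the unit from first to
    last vertex, which by telescoping has the total weight of the edges.\<close>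
  define M where "M vs = mono_form (unit (hd vs, last vs)) (chain_edges vs)" for vs
  have S: "chain vs" "2 \<le> length vs" "int (length (chain_edges vs)) = n" if "vs \<in> simplices K n" for vs
    using that False n by (auto simp: simplices_K length_chain_edges)
  have edges: "set (chain_edges vs) \<subseteq> set basis_index" if "chain vs" for vs
    using chain_edges_strict[OF that] unfolding basis_index(1) strict_def by auto
  have edges': "fst p \<noteq> snd p" if ch: "chain vs" and "p \<in> set (chain_edges vs)" for vs p
    using chain_edges_strict[OF ch, of "fst p" "snd p"] that(2) unfolding strict_def by simp
  have M: "M vs \<in> R n" if vs: "vs \<in> simplices K n" for vs
  proof -
    have hl: "(hd vs, last vs) \<in> r" using chain_hd_last[OF S(1,2)[OF vs]] by (rule strict_r)
    have "M vs \<in> R (int (length (chain_edges vs)))"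
      unfolding M_def
    proof (rule mono_form_R[OF unit_g[OF hl] edges[OF S(1)[OF vs]] edges'[OF S(1)[OF vs]]])
      fix i
      have "vs \<noteq> []" using S(2)[OF vs] by auto
      then have "(\<Sum>p\<leftarrow>chain_edges vs. of_int (weight i p)) = (of_int (weight i (hd vs, last vs)) :: 'k)"
        using sum_list_telescope[of vs "\<lambda>x. of_bool (x = i) :: 'k"] by (simp add: weight_def)
      then show "commutator N (hh i) (unit (hd vs, last vs)) =
          fscale (\<Sum>p\<leftarrow>chain_edges vs. of_int (weight i p)) (unit (hd vs, last vs))"
        unfolding commutator_hh_unit[OF hl] by (simp only:)
    qed
    then show ?thesis unfolding S(3)[OF vs] .
  qed
  have rM: "rho n (M vs) ws = (if vs = ws then 1 else 0)" if vs: "vs \<in> simplices K n" and ws: "ws \<in> simplices K n" for vs ws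
  proof -
    have ne: "ws \<noteq> []" using S(2)[OF ws] by auto
    have r: "rho n (M vs) ws = M vs (units ws) (hd ws, last ws)"
      using ws ne by (simp only: rho_def simp_thms if_True not_False_eq_True)
    note dv = chain_edges_distinct[OF S(1)[OF vs]] and dw = chain_edges_distinct[OF S(1)[OF ws]]
    show ?thesis
    proof (cases "vs = ws")
      case True
      have "M vs (units ws) = unit (hd vs, last vs)"
        unfolding M_def True by (rule mono_form_self[OF dw edges[OF S(1)[OF ws]]])
      then show ?thesis using True
        unfolding r unit_strict[OF chain_hd_last[OF S(1,2)[OF vs]]] by (simp add: basis_vec_def)
    next
      case False
      have "M vs (units ws) = 0"
      proof (rule ccontr)
        assume "M vs (units ws) \<noteq> 0"
        then have "set (chain_edges vs) \<subseteq> set (chain_edges ws)"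
          unfolding M_def by (rule mono_form_map_nonzero[OF _ edges[OF S(1)[OF vs]] edges[OF S(1)[OF ws]]])
        moreover have "card (set (chain_edges vs)) = card (set (chain_edges ws))"
          using distinct_card[OF dv] distinct_card[OF dw] S(3)[OF vs] S(3)[OF ws] by simp
        ultimately have "set (chain_edges vs) = set (chain_edges ws)" by (simp add: card_subset_eq)
        then show False
          using chain_edges_unique[OF S(1)[OF vs] S(1)[OF ws] S(2)[OF vs] S(2)[OF ws]] False by blast
      qed
      then show ?thesis using False unfolding r by simp
    qed
  qed
  define \<omega> where "\<omega> = (\<Sum>vs\<in>simplices K n. fsc (f vs) (M vs))"
  have "\<omega> \<in> R n" unfolding \<omega>_def
    by (intro fn.subspace_sum fn.subspace_scale inv_forms_subspace M)
  moreover have "f - rho n \<omega> = 0"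
  proof
    fix ws
    show "(f - rho n \<omega>) ws = 0 ws"
    proof (cases "ws \<in> simplices K n")
      case True
      have "rho n \<omega> ws = (\<Sum>vs\<in>simplices K n. f vs * rho n (M vs) ws)"
        unfolding \<omega>_def rho_sum rho_fsc sum_fun_apply fscale_def ..
      also have "\<dots> = (\<Sum>vs\<in>simplices K n. if vs = ws then f ws else 0)"
        by (rule sum.cong) (simp_all add: rM True)
      also have "\<dots> = f ws" using True finite_simplices by simp
      finally show ?thesis by simp
    next
      case False
      then show ?thesis using f by (simp add: rho_def simplicial_cochains_def)
    qed
  qed
  ultimately show ?thesis using fun_vs.subspace_0[OF simplicial_coboundaries_subspace] by metis
qed

end

section \<open>Dimensions of the cohomology spaces\<close>

lemma scalar_dual_basisI:
  fixes sL :: "'k::field \<Rightarrow> 'v::ab_group_add \<Rightarrow> 'v"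
  assumes "vector_space sL" and "module.subspace sL L" and "distinct bs"
    and "\<And>b. b \<in> set bs \<Longrightarrow> e b \<in> L"
    and "\<And>b x y. b \<in> set bs \<Longrightarrow> x \<in> L \<Longrightarrow> y \<in> L \<Longrightarrow> \<theta> b (x + y) = \<theta> b x + \<theta> b y"
    and "\<And>b a x. b \<in> set bs \<Longrightarrow> x \<in> L \<Longrightarrow> \<theta> b (sL a x) = a * \<theta> b x"
    and "\<And>b c. b \<in> set bs \<Longrightarrow> c \<in> set bs \<Longrightarrow> \<theta> b (e c) = (if b = c then 1 else 0)"
    and "\<And>x. x \<in> L \<Longrightarrow> x = (\<Sum>b\<in>set bs. sL (\<theta> b x) (e b))"
  shows "scalar_dual_basis sL L bs e \<theta>"
proof -
  interpret A: alternating sL "(*)" L UNIV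
    by (intro alternating.intro alternating_axioms.intro assms(1,2) fun_functional.vs2.vector_space_axioms
        fun_functional.vs2.subspace_UNIV)
  show ?thesis
  proof (intro scalar_dual_basis.intro dual_basis.intro A.alternating_axioms dual_basis_axioms.intro)
    show "distinct bs" by (rule assms(3))
    show "e b \<in> L" if "b \<in> set bs" for b by (rule assms(4)[OF that])
    show "A.functional (\<theta> b)" if b: "b \<in> set bs" for b
      unfolding A.functional_def by (intro conjI ballI allI assms(5,6)[OF b])
    show "\<theta> b (e c) = (if b = c then 1 else 0)" if "b \<in> set bs" "c \<in> set bs" for b c
      by (rule assms(7)[OF that])
    show "x = (\<Sum>b\<in>set bs. sL (\<theta> b x) (e b))" if "x \<in> L" for x by (rule assms(8)[OF that])
  qed
qed

context scalar_dual_basis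
begin

text \<open>Evaluation at \<open>e b\<close> is dual to \<theta> b, so basis and functionals
  exchange roles; the cut-off outside \<open>L\<close> follows the convention of
  \<open>dual_space\<close>.\<close>

lemma dual_space_basis:
  "scalar_dual_basis fscale (carrier (dual_space sL L)) bs (\<lambda>b x. if x \<in> L then \<theta> b x else 0) (\<lambda>b f. f (e b))"
proof (rule scalar_dual_basisI)
  let ?U = "carrier (dual_space sL L)"
  have U: "f \<in> ?U \<longleftrightarrow> (\<forall>x\<in>L. \<forall>y\<in>L. f (x + y) = f x + f y) \<and> (\<forall>a. \<forall>x\<in>L. f (sL a x) = a * f x) \<and>
      (\<forall>x. x \<notin> L \<longrightarrow> f x = 0)" for f
    by (simp add: dual_space_def subspace_module_def)
  show "vector_space (fscale :: 'k \<Rightarrow> ('v \<Rightarrow> 'k) \<Rightarrow> 'v \<Rightarrow> 'k)" by (rule fun_vs.vector_space_axioms)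
  show "fun_vs.subspace ?U"
  proof (rule fun_vs.subspaceI)
    show "0 \<in> ?U" unfolding U by simp
    show "f + f' \<in> ?U" if "f \<in> ?U" "f' \<in> ?U" for f f'
      using that unfolding U by (simp add: add_ac distrib_left)
    show "fscale a f \<in> ?U" if f: "f \<in> ?U" for a f
      unfolding U fscale_def
    proof (intro conjI ballI allI impI)
      fix x y assume "x \<in> L" "y \<in> L"
      then have "f (x + y) = f x + f y" using f unfolding U by blast
      then show "a * f (x + y) = a * f x + a * f y" by (simp only: distrib_left)
    next
      fix b x assume "x \<in> L"
      then have e: "f (sL b x) = b * f x" using f unfolding U by blast
      show "a * f (sL b x) = b * (a * f x)" unfolding e by (rule mult.left_commute)
    next
      fix x assume "x \<notin> L"
      then have e: "f x = 0" using f unfolding U by blast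
      show "a * f x = 0" unfolding e by (rule mult_zero_right)
    qed
  qed
  show "distinct bs" by (rule dist_bs)
  show "(\<lambda>x. if x \<in> L then \<theta> b x else 0) \<in> ?U" if b: "b \<in> set bs" for b
    unfolding U using functional_\<theta>[OF b] unfolding functional_def
    by (simp add: dom.subspace_add[OF subL] dom.subspace_scale[OF subL])
  show "(f + f') (e b) = f (e b) + f' (e b)" for f f' b by simp
  show "fscale a f (e b) = a * f (e b)" for a f b by (simp add: fscale_def)
  show "(if e b \<in> L then \<theta> c (e b) else 0) = (if b = c then 1 else 0)" if b: "b \<in> set bs" and c: "c \<in> set bs" for b c
    using eL[OF b] \<theta>_e[OF c b] by simp
  show "f = (\<Sum>b\<in>set bs. fscale (f (e b)) (\<lambda>x. if x \<in> L then \<theta> b x else 0))" if f: "f \<in> ?U" for f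
  proof
    fix x
    note fU = f[unfolded U]
    show "f x = (\<Sum>b\<in>set bs. fscale (f (e b)) (\<lambda>x. if x \<in> L then \<theta> b x else 0)) x"
    proof (cases "x \<in> L")
      case True
      have add: "f (x + y) = f x + f y" if "x \<in> L" "y \<in> L" for x y using conjunct1[OF fU] that by blast
      have scale: "f (sL a x) = a * f x" if "x \<in> L" for a x using conjunct1[OF conjunct2[OF fU]] that by blast
      have "f (0 + 0) = f 0 + f 0" by (intro add dom.subspace_0[OF subL])
      then have f0: "f 0 = 0" unfolding add_0_left by (simp only: add_cancel_right_right)
      have sum: "(\<Sum>b\<in>B. sL (a b) (e b)) \<in> L \<and> f (\<Sum>b\<in>B. sL (a b) (e b)) = (\<Sum>b\<in>B. a b * f (e b))"
        if "finite B" "B \<subseteq> set bs" for a B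
        using that
      proof (induction B rule: finite_induct)
        case empty
        then show ?case using f0 dom.subspace_0[OF subL] by simp
      next
        case (insert b B)
        have b: "e b \<in> L" "sL (a b) (e b) \<in> L" using insert.prems eL dom.subspace_scale[OF subL] by auto
        have IH: "(\<Sum>b\<in>B. sL (a b) (e b)) \<in> L" "f (\<Sum>b\<in>B. sL (a b) (e b)) = (\<Sum>b\<in>B. a b * f (e b))"
          using insert.IH insert.prems by auto
        show ?case unfolding sum.insert[OF insert.hyps] add[OF b(2) IH(1)] scale[OF b(1)] IH(2)
          using dom.subspace_add[OF subL b(2) IH(1)] by blast
      qed
      have "f x = f (\<Sum>b\<in>set bs. sL (\<theta> b x) (e b))" by (rule arg_cong[OF expand[OF True]])
      also have "\<dots> = (\<Sum>b\<in>set bs. \<theta> b x * f (e b))"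
        by (rule conjunct2[OF sum]) simp_all
      finally show ?thesis unfolding sum_fun_apply fscale_def if_P[OF True] mult.commute[of "f _"] .
    next
      case False
      then have "f x = 0" using fU by blast
      then show ?thesis unfolding sum_fun_apply fscale_def if_not_P[OF False] by simp
    qed
  qed
qed

theorem has_dim_exterior_dual:
  "has_dim (exterior (dual_space sL L) n) (if n < 0 then 0 else length bs choose nat n)"
proof (cases n)
  case (nonneg m)
  have "dual_space sL L = subspace_module fscale (carrier (dual_space sL L))"
    by (simp add: dual_space_def subspace_module_def)
  then show ?thesis using scalar_dual_basis.has_dim_exterior[OF dual_space_basis, of m] nonneg by simp
next
  case (neg m)
  then show ?thesis using has_dim_exterior_neg[of n "dual_space sL L"] by simp
qed

end

text \<open>A coefficient of the product of (1 + t)^m with the series of \<open>s\<close>; outside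
  0..m the binomial coefficients vanish, which makes the direct sum finite.\<close>

lemma has_dim_graded_tensor:
  fixes V :: "int \<Rightarrow> ('k::field, 'v) module" and W :: "int \<Rightarrow> ('k, 'w) module"
  assumes V: "\<And>p. has_dim (V p) (if p < 0 then 0 else m choose nat p)" and W: "\<And>p. has_dim (W p) (s p)"
  shows "has_dim (graded_tensor V W n) (\<Sum>p\<le>m. (m choose p) * s (n - int p))"
proof -
  let ?c = "\<lambda>p :: int. if p < 0 then 0 else m choose nat p"
  have "has_dim (direct_sum (\<lambda>p. tensor (V p) (W (n - p)))) (\<Sum>p\<in>int ` {..m}. ?c p * s (n - p))"
  proof (rule has_dim_direct_sum)
    show "has_dim (tensor (V p) (W (n - p))) (?c p * s (n - p))" for p by (rule has_dim_tensor[OF V W])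
    show "finite (int ` {..m})" by simp
    show "?c p * s (n - p) = 0" if p: "p \<notin> int ` {..m}" for p
    proof (cases p)
      case (nonneg q)
      then have "m < q" using p by auto
      then show ?thesis using nonneg by simp
    qed simp
    show "\<zero>\<^bsub>tensor (V p) (W (n - p))\<^esub> \<in> carrier (tensor (V p) (W (n - p)))" for p
      unfolding tensor_def by (rule presented_space_zero[OF tensor_rels_free[OF V W]])
  qed
  also have "(\<Sum>p\<in>int ` {..m}. ?c p * s (n - p)) = (\<Sum>p\<le>m. (m choose p) * s (n - int p))"
    by (simp add: sum.reindex)
  finally show ?thesis unfolding graded_tensor_def .
qed

context poset_lie
begin

text \<open>Invariance holds as d commutes with L_x. Horizontality needs it: \<iota>_x d \<omega> =
  L_x \<omega> - d \<iota>_x \<omega>, and both terms vanish.\<close>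

lemma dd_R:
  assumes w: "\<omega> \<in> R n"
  shows "dd \<omega> \<in> R (n + 1)"
proof -
  have f: "\<omega> \<in> forms n" using w unfolding inv_forms_def by blast
  have inv: "lieD x \<omega> = 0" if "x \<in> hh ` {1..N}" for x using w that unfolding inv_forms_def by blast
  have hor: "contract x \<omega> = 0" if "x \<in> hh ` {2..N}" for x using w that unfolding inv_forms_def by blast
  show ?thesis using f
  proof (cases rule: forms_cases)
    case 1
    show ?thesis unfolding 1(2) dd_0 by (rule fn.subspace_0[OF inv_forms_subspace])
  next
    case (2 m)
    have H: "x \<in> g" if "x \<in> hh ` {1..N}" for x using that hh_g by blast
    have "lieD x (dd \<omega>) = 0" if x: "x \<in> hh ` {1..N}" for x
      unfolding lieD_dd[OF 2(2) H[OF x]] inv[OF x] by (rule dd_0)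
    moreover have "contract x (dd \<omega>) = 0" if x: "x \<in> hh ` {2..N}" for x
    proof -
      have x1: "x \<in> hh ` {1..N}" using x by auto
      show ?thesis unfolding contract_dd[OF H[OF x1]] inv[OF x1] hor[OF x] dd_0 by (rule diff_self)
    qed
    ultimately show ?thesis unfolding inv_forms_def using dd_forms[OF f] by blast
  qed
qed

lemma rho_dd_forms: "\<omega> \<in> forms n \<Longrightarrow> rho (n + 1) (dd \<omega>) = coboundary K n (rho n \<omega>)"
proof (erule forms_cases)
  assume "\<omega> = 0"
  then show ?thesis by (simp only: dd_0 rho_0 coboundary_0)
qed (simp only: rho_dd)

lemma rho_diff: "rho n (\<omega> - \<eta>) = rho n \<omega> - rho n \<eta>"
  by (rule ext) (simp add: rho_def)

lemma coboundary_coboundaries: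
  assumes "c \<in> simplicial_coboundaries K n"
  shows "coboundary K n c = 0"
  using simplicial_coboundaries_cocycles[of K n] K_closed assms unfolding simplicial_cocycles_def by blast

text \<open>In degree zero the trace condition takes over the role of the augmentation: a constant
  diagonal matrix of trace zero vanishes, as \<open>N\<close> is invertible.\<close>

lemma quotient_dim_invariant_simplicial:
  assumes qd: "fun_scaled.quotient_dim (simplicial_cocycles K n :: (nat list \<Rightarrow> 'k) set) (simplicial_coboundaries K n) m"
  shows "fn.quotient_dim (inv_cocycles (hh ` {1..N}) (hh ` {2..N}) n) (inv_coboundaries (hh ` {1..N}) (hh ` {2..N}) n) m"
proof (rule quotient_dim_transfer[OF fn.scaled_space_axioms fun_scaled.scaled_space_axioms qd rho_add rho_fsc
      inv_cocycles_subspace simplicial_coboundaries_subspace])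
  have forms: "\<omega> \<in> forms q" if "\<omega> \<in> R q" for \<omega> q using that unfolding inv_forms_def by blast
  show "rho n ` inv_cocycles (hh ` {1..N}) (hh ` {2..N}) n \<subseteq> simplicial_cocycles K n"
  proof
    fix c assume "c \<in> rho n ` inv_cocycles (hh ` {1..N}) (hh ` {2..N}) n"
    then obtain \<omega> where w: "\<omega> \<in> R n" "dd \<omega> = 0" "c = rho n \<omega>" unfolding inv_cocycles_def by blast
    have "coboundary K n (rho n \<omega>) = 0" unfolding rho_dd_forms[OF forms[OF w(1)], symmetric] w(2) by (rule rho_0)
    then show "c \<in> simplicial_cocycles K n" unfolding simplicial_cocycles_def w(3) using rho_cochain by blast
  qed
  show "rho n ` inv_coboundaries (hh ` {1..N}) (hh ` {2..N}) n \<subseteq> simplicial_coboundaries K n"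
  proof
    fix c assume "c \<in> rho n ` inv_coboundaries (hh ` {1..N}) (hh ` {2..N}) n"
    then obtain \<omega> where w: "\<omega> \<in> R (n - 1)" "c = rho n (dd \<omega>)" unfolding inv_coboundaries_def by blast
    have "rho n (dd \<omega>) = coboundary K (n - 1) (rho (n - 1) \<omega>)" using rho_dd_forms[OF forms[OF w(1)]] by simp
    then show "c \<in> simplicial_coboundaries K n"
      unfolding simplicial_coboundaries_def w(2) using rho_cochain by blast
  qed
  show "z \<in> inv_coboundaries (hh ` {1..N}) (hh ` {2..N}) n"
    if z: "z \<in> inv_cocycles (hh ` {1..N}) (hh ` {2..N}) n" and b: "rho n z \<in> simplicial_coboundaries K n" for z
  proof -
    have zR: "z \<in> R n" using z unfolding inv_cocycles_def by blast
    obtain c where c: "c \<in> simplicial_cochains K (n - 1)" "rho n z = coboundary K (n - 1) c"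
      using b unfolding simplicial_coboundaries_def by blast
    have z0: ?thesis if zero: "z = 0" unfolding zero by (rule fn.subspace_0[OF inv_coboundaries_subspace])
    consider "n < 0" | "n = 0" | "0 < n" by linarith
    then show ?thesis
    proof cases
      case 1
      then have "z = 0" using forms[OF zR] unfolding forms_def by simp
      then show ?thesis by (rule z0)
    next
      case 2
      have "z \<in> forms (int 0)" using forms[OF zR] 2 by simp
      then have a: "alt 0 z" by (simp add: forms_def)
      have diag: "z [] (i, i) = c []" if i: "i \<in> {1..N}" for i
      proof -
        have s: "[i] \<in> simplices K n" using i 2 by (simp add: simplices_K chain_def)
        have "rho n z [i] = z [] (i, i)" using s by (simp add: rho_def)
        moreover have "coboundary K (n - 1) c [i] = c []" using s by (simp add: coboundary_eq_cob)
        ultimately show ?thesis using fun_cong[OF c(2), of "[i]"] by simp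
      qed
      have "(\<Sum>i\<in>{1..N}. z [] (i, i)) = of_nat N * c []"
        using sum.cong[OF refl diag, of "{1..N}"] by simp
      then have "c [] = 0" using g_trace[OF alt_closed[OF a, of "[]"]] N_nonzero by simp
      moreover have "coboundary K (n - 1) c vs = (if vs \<in> simplices K n then c [] else 0)" for vs
      proof (cases "vs \<in> simplices K n")
        case True
        then obtain i where "vs = [i]" using 2 by (cases vs) (auto simp: simplices_K)
        then show ?thesis using True by (simp add: coboundary_eq_cob)
      qed (simp add: coboundary_def)
      ultimately have "rho n z = 0" unfolding c(2) by (intro ext) simp
      then show ?thesis by (rule z0[OF rho_injective[OF zR]])
    next
      case 3
      \<comment> \<open>The simplicial primitive \<open>c\<close> is replaced by one that comes from
        a form; changing it by a coboundary does not affect its own coboundary.\<close>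
      then obtain \<omega> where w: "\<omega> \<in> R (n - 1)" "c - rho (n - 1) \<omega> \<in> simplicial_coboundaries K (n - 1)"
        using rho_surjective[OF _ c(1)] by auto
      have "coboundary K (n - 1) c - coboundary K (n - 1) (rho (n - 1) \<omega>) = 0"
        unfolding coboundary_diff[symmetric] by (rule coboundary_coboundaries[OF w(2)])
      moreover have "rho n (dd \<omega>) = coboundary K (n - 1) (rho (n - 1) \<omega>)"
        using rho_dd_forms[OF forms[OF w(1)]] by simp
      ultimately have "rho n (z - dd \<omega>) = 0" unfolding rho_diff c(2) by (simp only:)
      moreover have "dd \<omega> \<in> R n" using dd_R[OF w(1)] by simp
      then have "z - dd \<omega> \<in> R n" by (rule fn.subspace_diff[OF inv_forms_subspace zR])
      ultimately have "z - dd \<omega> = 0" by (intro rho_injective)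
      then have "z = dd \<omega>" unfolding right_minus_eq .
      then show ?thesis unfolding inv_coboundaries_def using w(1) by blast
    qed
  qed
  show "\<exists>w\<in>inv_cocycles (hh ` {1..N}) (hh ` {2..N}) n. z - rho n w \<in> simplicial_coboundaries K n"
    if z: "z \<in> simplicial_cocycles K n" for z
  proof -
    have zc: "z \<in> simplicial_cochains K n" "coboundary K n z = 0" using z unfolding simplicial_cocycles_def by blast+
    show ?thesis
    proof (cases "n < 0")
      case True
      \<comment> \<open>The cocycle condition at a vertex, which exists as \<open>N \<ge> 1\<close>,
        rules out cohomology of the augmented complex in degree -1.\<close>
      have e: "z [] = 0"
      proof (cases "n = -1")
        case n: True
        have "[1] \<in> simplices K (n + 1)" using n N by (simp add: simplices_K chain_def)
        then have "coboundary K n z [1] = z []" by (simp add: coboundary_eq_cob)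
        then show ?thesis unfolding zc(2) by simp
      next
        case False
        then show ?thesis using zc(1) by (simp add: simplicial_cochains_def simplices_K)
      qed
      have "z vs = 0" for vs
      proof (cases "vs = []")
        case False
        then have "length vs > 0" by simp
        then have "vs \<notin> simplices K n" using True by (simp add: simplices_K del: length_greater_0_conv)
        then show ?thesis using zc(1) by (simp add: simplicial_cochains_def)
      qed (use e in simp)
      then have z0: "z = 0" by (intro ext) simp
      have "z - rho n 0 = 0" unfolding z0 rho_0 by (rule diff_self)
      then show ?thesis
        using fn.subspace_0[OF inv_cocycles_subspace] fun_vs.subspace_0[OF simplicial_coboundaries_subspace] by metis
    next
      case False
      then obtain \<omega> where w: "\<omega> \<in> R n" "z - rho n \<omega> \<in> simplicial_coboundaries K n"
        using rho_surjective[OF _ zc(1)] by auto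
      have "coboundary K n z - coboundary K n (rho n \<omega>) = 0"
        unfolding coboundary_diff[symmetric] by (rule coboundary_coboundaries[OF w(2)])
      then have "0 = coboundary K n (rho n \<omega>)" unfolding zc(2) right_minus_eq .
      then have "coboundary K n (rho n \<omega>) = 0" by (rule sym)
      \<comment> \<open>Closedness of \<omega> is read off through the injectivity of
        \<open>rho\<close> in degree n + 1.\<close>
      then have "rho (n + 1) (dd \<omega>) = 0" unfolding rho_dd_forms[OF forms[OF w(1)]] .
      then have "dd \<omega> = 0" by (rule rho_injective[OF dd_R[OF w(1)]])
      then have "\<omega> \<in> inv_cocycles (hh ` {1..N}) (hh ` {2..N}) n" unfolding inv_cocycles_def using w(1) by blast
      then show ?thesis using w(2) by blast
    qed
  qed
qed

text \<open>Translates the given complex into \<open>forms\<close> and \<open>dd\<close>; in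
  negative degrees both are zero.\<close>

lemma has_dim_adjoint_cohomology:
  assumes "fn.quotient_dim (inv_cocycles {} {} n) (inv_coboundaries {} {} n) m"
  shows "has_dim (adjoint_cohomology fscale g (commutator N) n) m"
proof -
  let ?D = "ce_diff g (commutator N) fscale (commutator N)"
  have C: "ce_cochains fscale g fscale g n = forms n" for n
  proof (cases n)
    case (nonneg m)
    then show ?thesis by (simp add: ce_cochains_eq forms_def)
  next
    case (neg m)
    then show ?thesis using ce_cochains_neg[of n] by (simp add: forms_def)
  qed
  have D: "?D n \<omega> = dd \<omega>" if "\<omega> \<in> forms n" for n \<omega>
    using that
  proof (cases rule: forms_cases)
    case 1
    show ?thesis unfolding 1(2) dd_0
      by (rule ext) (use 1(1) in \<open>auto simp: ce_diff_def tuples_def\<close>)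
  next
    case (2 q)
    show ?thesis unfolding 2(1) by (rule ce_diff_eq_dd[OF 2(2)])
  qed
  have F: "inv_forms {} {} n = forms n" for n unfolding inv_forms_def by simp
  have Z: "{\<omega> \<in> forms n. ?D n \<omega> = 0} = inv_cocycles {} {} n"
    unfolding inv_cocycles_def F
  proof (rule Collect_cong, rule conj_cong[OF refl])
    fix \<omega> assume "\<omega> \<in> forms n"
    show "(?D n \<omega> = 0) = (dd \<omega> = 0)" unfolding D[OF \<open>\<omega> \<in> forms n\<close>] ..
  qed
  have B: "?D (n - 1) ` forms (n - 1) = inv_coboundaries {} {} n"
    unfolding inv_coboundaries_def F by (rule image_cong[OF refl D])
  have S: "(\<lambda>a \<omega> xs. fscale a (\<omega> xs)) = fsc" by (intro ext) (simp only: fsc_apply)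
  have sub: "inv_coboundaries {} {} n \<subseteq> inv_cocycles {} {} n"
  proof
    fix z assume z: "z \<in> inv_coboundaries {} {} n"
    then obtain \<omega> where "\<omega> \<in> forms (n - 1)" "z = dd \<omega>" unfolding inv_coboundaries_def F by blast
    then have "z \<in> forms n" using dd_forms[of \<omega> "n - 1"] by simp
    then show "z \<in> inv_cocycles {} {} n" using inv_coboundaries_closed[OF z] unfolding inv_cocycles_def F by blast
  qed
  show ?thesis
    unfolding adjoint_cohomology_def ce_cohomology_def C Z B S
    by (rule fn.has_dim_quotient[OF inv_cocycles_subspace inv_coboundaries_subspace sub assms])
qed

text \<open>The numbers \<open>s n\<close> are not computed. They exist because there are finitely
  many chains, and both sides of the theorem depend on them in the same way.\<close>

lemma cohomology_dims:
  obtains s where "\<And>n. has_dim (simplicial_cohomology K n :: ('k, (nat list \<Rightarrow> 'k) set) module) (s n)"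
    and "\<And>n. has_dim (adjoint_cohomology fscale g (commutator N) n) (\<Sum>p\<le>N - 1. ((N - 1) choose p) * s (n - int p))"
proof -
  have "\<exists>m. fun_scaled.quotient_dim (simplicial_cocycles K n :: (nat list \<Rightarrow> 'k) set) (simplicial_coboundaries K n) m" for n
    by (rule quotient_dim_simplicial_exists[OF K_closed finite_simplices])
  then obtain s where s: "\<And>n. fun_scaled.quotient_dim (simplicial_cocycles K n :: (nat list \<Rightarrow> 'k) set) (simplicial_coboundaries K n) (s n)"
    by metis
  show thesis
  proof (rule that)
    show "has_dim (simplicial_cohomology K n :: ('k, (nat list \<Rightarrow> 'k) set) module) (s n)" for n
      by (rule has_dim_simplicial_cohomology[OF K_closed s])
    show "has_dim (adjoint_cohomology fscale g (commutator N) n) (\<Sum>p\<le>N - 1. ((N - 1) choose p) * s (n - int p))" for n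
      by (rule has_dim_adjoint_cohomology[OF quotient_dim_adjoint[OF quotient_dim_invariant_simplicial[OF s]]])
  qed
qed

section \<open>The diagonal subalgebra\<close>

abbreviation diagonal :: "(nat \<times> nat \<Rightarrow> 'k) set"
  where "diagonal \<equiv> diagonal_subalgebra N r"

lemma diagonal_iff: "x \<in> diagonal \<longleftrightarrow> x \<in> g \<and> (\<forall>i j. i \<noteq> j \<longrightarrow> x (i, j) = 0)"
  by (simp add: diagonal_subalgebra_def)

lemma diagonal_expand:
  assumes x: "x \<in> diagonal"
  shows "x = (\<Sum>i\<in>{2..N}. fscale (coord (i, i) x) (hh i))"
proof -
  let ?f = "\<lambda>p. fscale (coord p x) (unit p)" and ?d = "\<lambda>i. (i, i) :: nat \<times> nat"
  have xg: "x \<in> g" using x unfolding diagonal_iff by blast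
  have "x = (\<Sum>p\<in>r - {(1, 1)}. ?f p)" by (rule g_expand[OF xg])
  also have "\<dots> = (\<Sum>p\<in>?d ` {2..N}. ?f p)"
  proof (rule sum.mono_neutral_right)
    show "finite (r - {(1, 1)})" using finite_r by simp
    show "?d ` {2..N} \<subseteq> r - {(1, 1)}" using r_refl by auto
    show "\<forall>p\<in>r - {(1, 1)} - ?d ` {2..N}. ?f p = 0"
    proof
      fix p assume p: "p \<in> r - {(1, 1)} - ?d ` {2..N}"
      obtain u v where uv: "p = (u, v)" by (cases p)
      have "u \<noteq> v"
      proof
        assume "u = v"
        moreover have "u \<in> {1..N}" "(u, v) \<noteq> (1, 1)" using p uv r_sub by auto
        ultimately have "u \<in> {2..N}" by auto
        then show False using p uv \<open>u = v\<close> by blast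
      qed
      then have "coord p x = 0" using x unfolding diagonal_iff by (simp add: uv coord_def)
      then show "?f p = 0" by (simp only: fun_vs.scale_zero_left)
    qed
  qed
  also have "\<dots> = (\<Sum>i\<in>{2..N}. ?f (i, i))" by (subst sum.reindex) (auto intro: inj_onI)
  also have "\<dots> = (\<Sum>i\<in>{2..N}. fscale (coord (i, i) x) (hh i))" by (simp add: unit_def)
  finally show ?thesis .
qed

text \<open>The length N - 1 of the index list matches the exponent in
  \<open>quotient_dim_adjoint\<close>.\<close>

lemma diagonal_basis: "scalar_dual_basis fscale diagonal [2..<Suc N] hh (\<lambda>i. coord (i, i))"
proof (rule scalar_dual_basisI)
  have bs: "set [2..<Suc N] = {2..N}" by auto
  show "vector_space (fscale :: 'k \<Rightarrow> (nat \<times> nat \<Rightarrow> 'k) \<Rightarrow> nat \<times> nat \<Rightarrow> 'k)" by (rule fun_vs.vector_space_axioms)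
  show "fun_vs.subspace diagonal"
  proof (rule fun_vs.subspaceI)
    show "0 \<in> diagonal" unfolding diagonal_iff using fun_vs.subspace_0[OF g_subspace] by simp
    show "x + y \<in> diagonal" if "x \<in> diagonal" "y \<in> diagonal" for x y
      using that fun_vs.subspace_add[OF g_subspace] unfolding diagonal_iff by simp
    show "fscale a x \<in> diagonal" if "x \<in> diagonal" for a x
      using that fun_vs.subspace_scale[OF g_subspace] unfolding diagonal_iff by (simp add: fscale_def)
  qed
  show "distinct [2..<Suc N]" by simp
  show "hh i \<in> diagonal" if i: "i \<in> set [2..<Suc N]" for i
  proof -
    have "i \<in> {1..N}" using i by auto
    then show ?thesis unfolding diagonal_iff using hh_g by (simp add: hh_apply)
  qed
  show "coord (i, i) (x + y) = coord (i, i) x + coord (i, i) y" for i x y by (simp add: coord_def)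
  show "coord (i, i) (fscale a x) = a * coord (i, i) x" for i a x by (simp add: coord_def fscale_def right_diff_distrib)
  show "coord (i, i) (hh j) = (if i = j then 1 else 0)" if "i \<in> set [2..<Suc N]" "j \<in> set [2..<Suc N]" for i j
  proof -
    have ij: "(i, i) \<in> r - {(1, 1)}" "(j, j) \<in> r - {(1, 1)}" using that r_refl by auto
    show ?thesis using coord_unit[OF ij] by (simp add: unit_def)
  qed
  show "x = (\<Sum>i\<in>set [2..<Suc N]. fscale (coord (i, i) x) (hh i))" if "x \<in> diagonal" for x
    unfolding bs by (rule diagonal_expand[OF that])
qed

lemma commutator_diagonal_0:
  assumes "x \<in> diagonal" and "y \<in> diagonal"
  shows "commutator N x y = 0"
proof
  fix p :: "nat \<times> nat"
  obtain u w where p: "p = (u, w)" by (cases p)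
  have "x (u, j) * y (j, w) = y (u, j) * x (j, w)" for j
    using assms unfolding diagonal_iff by (cases "u = j"; cases "j = w") simp_all
  then show "commutator N x y p = 0 p" unfolding p commutator_apply by simp
qed

lemma has_dim_diagonal_cohomology:
  "has_dim (trivial_cohomology fscale diagonal (commutator N) n) (if n < 0 then 0 else (N - 1) choose nat n)"
proof -
  have l: "length [2..<Suc N] = N - 1" unfolding length_upt by simp
  show ?thesis
    using scalar_dual_basis.has_dim_trivial_cohomology[OF diagonal_basis, of "commutator N" n] commutator_diagonal_0
    unfolding l by blast
qed

lemma has_dim_exterior_diagonal:
  "has_dim (exterior (dual_space fscale diagonal) n) (if n < 0 then 0 else (N - 1) choose nat n)"
proof -
  have l: "length [2..<Suc N] = N - 1" unfolding length_upt by simp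
  show ?thesis using scalar_dual_basis.has_dim_exterior_dual[OF diagonal_basis, of n] unfolding l .
qed

end

theorem theorem10:
  fixes N :: nat and r :: "(nat \<times> nat) set"
  assumes "N \<ge> 1"
    and "partial_order_on {1..N} r"
    and "CHAR('k::field) = 0 \<or> CHAR('k) > N"
  shows "let \<gg> = lie_poset_algebra N r :: (nat \<times> nat \<Rightarrow> 'k) set;
             \<hh> = diagonal_subalgebra N r :: (nat \<times> nat \<Rightarrow> 'k) set;
             Hgg = adjoint_cohomology fscale \<gg> (commutator N);
             Hhk = trivial_cohomology fscale \<hh> (commutator N);
             \<Lambda>h = exterior (dual_space fscale \<hh>);
             H\<Sigma> = simplicial_cohomology (augment (nerve N r)) :: int \<Rightarrow> ('k, (nat list \<Rightarrow> 'k) set) module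
         in graded_iso Hgg (graded_tensor \<Lambda>h H\<Sigma>) \<and>
            graded_iso \<Lambda>h Hhk \<and>
            graded_iso (graded_tensor \<Lambda>h H\<Sigma>) (graded_tensor Hhk H\<Sigma>)"
proof -
  interpret poset_lie N r "TYPE('k)"
    by (intro poset_lie.intro finite_poset.intro poset_lie_axioms.intro assms)
  obtain s where s: "\<And>n. has_dim (simplicial_cohomology K n :: ('k, (nat list \<Rightarrow> 'k) set) module) (s n)"
    and A: "\<And>n. has_dim (adjoint_cohomology fscale g (commutator N) n) (\<Sum>p\<le>N - 1. ((N - 1) choose p) * s (n - int p))"
    by (rule cohomology_dims) blast
  \<comment> \<open>Exterior powers of the dual and cohomology of the diagonal algebra have the same
    binomial dimensions, so all three isomorphisms follow by combining these with \<open>s\<close>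
    and \<open>A\<close>.\<close>
  note L = has_dim_exterior_diagonal and H = has_dim_diagonal_cohomology
  show ?thesis
    unfolding Let_def graded_iso_def
    by (intro conjI allI has_dim_imp_module_iso[OF A has_dim_graded_tensor[OF L s]] has_dim_imp_module_iso[OF L H]
        has_dim_imp_module_iso[OF has_dim_graded_tensor[OF L s] has_dim_graded_tensor[OF H s]])
qed

end
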